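(* Let $v:\mathbb R^3\to\mathbb R^3$ and $p:\mathbb R^3\to\mathbb R$ be smooth functions satisfying the stationary Navier--Stokes equations $$-\Delta v+(v\cdot\nabla)v+\nabla p=0,\qquad \operatorname{div} v=0\quad\text{in }\mathbb R^3,$$ and suppose that $v(x)\to 0$ as $|x|\to\infty$. Let $\omega=\operatorname{curl} v$. If $$\omega\in L^{9/5,\infty}(\mathbb R^3),$$ then $v\equiv 0$.
   Context: $L^{p,\infty}(E)$ denotes the weak Lorentz (weak $L^p$) space of measurable $f$ on $E$ with $\|f\|_{L^{p,\infty}(E)}=\sup_{\lambda>0}\lambda\,|\{x\in E:|f(x)|>\lambda\}|^{1/p}<\infty$, where $|\cdot|$ of a set is Lebesgue measure. No smallness of the norm and no finiteness of $\int_{\mathbb R^3}|\nabla v|^2\,dx$ is assumed. *)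

theory Defs
  imports "HOL-Analysis.Analysis"
begin

section \<open>Smooth functions and differential operators on Euclidean space\<close>

text \<open>
  As usual for \<^const>\<open>frechet_derivative\<close>, the value is meaningful only where the function is
  differentiable; the differential operators below are intended for smooth functions.
\<close>

definition partial_deriv ::
    "'n \<Rightarrow> (real^'n \<Rightarrow> 'b) \<Rightarrow> real^'n \<Rightarrow> 'b::real_normed_vector" where
  "partial_deriv i f x = frechet_derivative f (at x) (axis i 1)"

primrec k_times_cont_differentiable ::
    "nat \<Rightarrow> (real^'n \<Rightarrow> 'b::real_normed_vector) \<Rightarrow> bool" where
  "k_times_cont_differentiable 0 f \<longleftrightarrow> continuous_on UNIV f"
| "k_times_cont_differentiable (Suc k) f \<longleftrightarrow>
     (\<forall>x. f differentiable (at x)) \<and> (\<forall>i. k_times_cont_differentiable k (partial_deriv i f))"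

definition smooth :: "(real^'n \<Rightarrow> 'b::real_normed_vector) \<Rightarrow> bool" where
  "smooth f \<longleftrightarrow> (\<forall>k. k_times_cont_differentiable k f)"

definition gradient :: "(real^'n \<Rightarrow> real) \<Rightarrow> real^'n \<Rightarrow> real^'n" where
  "gradient f x = (\<chi> i. partial_deriv i f x)"

definition laplacian :: "(real^'n \<Rightarrow> 'b) \<Rightarrow> real^'n \<Rightarrow> 'b::real_normed_vector" where
  "laplacian f x = (\<Sum>i\<in>UNIV. partial_deriv i (partial_deriv i f) x)"

definition divergence :: "(real^'n \<Rightarrow> real^'n) \<Rightarrow> real^'n \<Rightarrow> real" where
  "divergence u x = (\<Sum>i\<in>UNIV. partial_deriv i (\<lambda>y. u y $ i) x)"

text \<open>\<open>convective u w\<close> is \<open>(u \<cdot> \<nabla>) w\<close>.\<close>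

definition convective ::
    "(real^'n \<Rightarrow> real^'n) \<Rightarrow> (real^'n \<Rightarrow> 'b) \<Rightarrow> real^'n \<Rightarrow> 'b::real_normed_vector" where
  "convective u w x = (\<Sum>i\<in>UNIV. u x $ i *\<^sub>R partial_deriv i w x)"

definition curl :: "(real^3 \<Rightarrow> real^3) \<Rightarrow> real^3 \<Rightarrow> real^3" where
  "curl u x = vector
     [partial_deriv 2 (\<lambda>y. u y $ 3) x - partial_deriv 3 (\<lambda>y. u y $ 2) x,
      partial_deriv 3 (\<lambda>y. u y $ 1) x - partial_deriv 1 (\<lambda>y. u y $ 3) x,
      partial_deriv 1 (\<lambda>y. u y $ 2) x - partial_deriv 2 (\<lambda>y. u y $ 1) x]"

section \<open>Weak Lebesgue spaces\<close>

text \<open>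
  The library has no real powers on \<^typ>\<open>ennreal\<close>. The exponent is meant to be positive, so that
  the power of infinity is infinity.
\<close>

definition ennreal_pos_powr :: "ennreal \<Rightarrow> real \<Rightarrow> ennreal" where
  "ennreal_pos_powr m a = (if m = \<infinity> then \<infinity> else ennreal (enn2real m powr a))"

text \<open>
  Both definitions are intended for exponents \<open>0 < q < \<infinity>\<close> and Lebesgue measurable \<open>E\<close>.
  The quasinorm is \<^typ>\<open>ennreal\<close>-valued, so that super-level sets of infinite measure and
  unbounded suprema give the value infinity.
\<close>

definition weak_Lq_norm ::
    "real \<Rightarrow> 'a::euclidean_space set \<Rightarrow> ('a \<Rightarrow> 'b::real_normed_vector) \<Rightarrow> ennreal" where
  "weak_Lq_norm q E f =
     (SUP l\<in>{0<..}. ennreal l * ennreal_pos_powr (emeasure lebesgue {x\<in>E. norm (f x) > l}) (1 / q))"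

definition weak_Lq ::
    "real \<Rightarrow> 'a::euclidean_space set \<Rightarrow> ('a \<Rightarrow> 'b::real_normed_vector) set" where
  "weak_Lq q E = {f. f \<in> borel_measurable (lebesgue_on E) \<and> weak_Lq_norm q E f < \<infinity>}"

end

theory Submission
  imports Defs
begin

text \<open>
  Let \<open>h = - (p + |v|\<^sup>2/2) + const\<close> and let \<open>b = curl v \<times> v\<close>. The equations read
  \<open>\<nabla>h = curl (curl v) + b\<close>, so \<open>\<nabla>h - b\<close> is divergence free and
  \<open>v \<cdot> \<nabla>h = div b + |curl v|\<^sup>2\<close>. Averaging Poisson equations over balls gives a local
  bound for \<open>curl v\<close>, a Biot--Savart bound for \<open>v\<close>, and \<open>h \<rightarrow> 0\<close> at infinity for the right
  constant; testing with \<open>max 0 (- h - \<epsilon>)\<^sup>2\<close> then gives \<open>h \<ge> 0\<close>.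

  The dissipation is computed by testing with \<open>f (h + c \<kappa>)\<close>, where \<open>f\<close> cuts off logarithmically
  near \<open>0\<close>. Since \<open>h + c \<kappa> \<rightarrow> 0\<close> at infinity, the test function has compact support and the
  energy flux of \<open>h\<close> disappears except for the term \<open>c \<integral>f v \<cdot> \<nabla>\<kappa>\<close>. Here
  \<open>\<kappa>\<close> is the convolution of \<open>|curl v|\<close> to the power \<open>11/6\<close> (integrable, as \<open>11/6 > 9/5\<close>) with
  \<open>(1 + |z|\<^sup>2)\<close> to the power \<open>-7/10\<close>. The Biot--Savart bound becomes the pointwise
  inequality \<open>|v| \<le> C \<kappa>\<close> to the power \<open>5/11\<close>, which makes \<open>|v| |\<nabla>\<kappa>|\<close>,
  \<open>|\<nabla>\<kappa>|\<^sup>2/\<kappa>\<close> and \<open>|b|\<^sup>2/\<kappa>\<close> integrable. Letting first \<open>f \<rightarrow> 1\<close> and then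
  \<open>c \<rightarrow> 0\<close> yields \<open>\<integral>|curl v|\<^sup>2 = 0\<close>.
\<close>

section \<open>Calculus of smooth functions\<close>

text \<open>A cutoff in space would leave a flux of h through large spheres that the weak bound does
  not visibly make small. A cutoff by the level H = h + c kap avoids it, since f(H) v . grad H is
  the divergence of F(H) v when F' = f. The summand c kap bounds 1/H by 1/(c kap), which is then met
  by the integrable |b|^2/kap and |grad kap|^2/kap; the price is a constant of order 1/c, hence the
  order of the limits.

  The exponents are linked. Let s = 11/6 be the power of the vorticity and 2a = 7/5 the decay of the
  kernel. Interpolation between \<open>kap\<close> and the total mass yields the power (3/s -
  1)/(2a) of \<open>kap\<close> in the velocity bound. For |b|^2/kap to be controlled by |curl v|^s
  this power is set to 1 - 1/s, which gives 2a = (3 - s)/(s - 1). By scaling, |v| |grad kap| is then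
  integrable at infinity if 1/s + 2a/3 > 1, here 167/165, and |grad kap|^2/kap if 2a > 1. Both leave
  room for an s slightly above 9/5.\<close>

abbreviation pd where "pd \<equiv> partial_deriv"

lemma smooth_differentiable: "smooth f \<Longrightarrow> f differentiable (at x)"
  unfolding smooth_def by (meson k_times_cont_differentiable.simps(2))

lemma smooth_pd: "smooth f \<Longrightarrow> smooth (pd i f)"
  unfolding smooth_def by (meson k_times_cont_differentiable.simps(2))

lemma smooth_continuous_on: "smooth f \<Longrightarrow> continuous_on S f"
  unfolding smooth_def using k_times_cont_differentiable.simps(1) continuous_on_subset by blast

lemma pd_has_derivative:
  "(f has_derivative f') (at x) \<Longrightarrow> pd i f x = f' (axis i 1)"
  unfolding partial_deriv_def by (metis frechet_derivative_at)

lemma has_derivative_frechet: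
  "f differentiable (at x) \<Longrightarrow> (f has_derivative frechet_derivative f (at x)) (at x)"
  using frechet_derivative_works by blast

lemma pd_const: "pd i (\<lambda>x. c) = (\<lambda>x. 0)"
  by (rule ext, subst pd_has_derivative[OF has_derivative_const]) simp

lemma pd_add:
  assumes "\<And>x. f differentiable (at x)" "\<And>x. g differentiable (at x)"
  shows "pd i (\<lambda>x. f x + g x) = (\<lambda>x. pd i f x + pd i g x)"
proof
  fix x
  show "pd i (\<lambda>x. f x + g x) x = pd i f x + pd i g x"
    by (subst pd_has_derivative[OF has_derivative_add[OF has_derivative_frechet[OF assms(1)] has_derivative_frechet[OF assms(2)]]])
      (simp add: partial_deriv_def)
qed

lemma pd_linear:
  assumes "bounded_linear L" "\<And>x. f differentiable (at x)"
  shows "pd i (\<lambda>x. L (f x)) = (\<lambda>x. L (pd i f x))"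
proof
  fix x
  show "pd i (\<lambda>x. L (f x)) x = L (pd i f x)"
    by (subst pd_has_derivative[OF bounded_linear.has_derivative[OF assms(1) has_derivative_frechet[OF assms(2)]]])
      (simp add: partial_deriv_def)
qed

lemma pd_mult:
  fixes f g :: "real^'n \<Rightarrow> real"
  assumes "\<And>x. f differentiable (at x)" "\<And>x. g differentiable (at x)"
  shows "pd i (\<lambda>x. f x * g x) = (\<lambda>x. f x * pd i g x + pd i f x * g x)"
proof
  fix x
  show "pd i (\<lambda>x. f x * g x) x = f x * pd i g x + pd i f x * g x"
    by (subst pd_has_derivative[OF has_derivative_mult[OF has_derivative_frechet[OF assms(1)] has_derivative_frechet[OF assms(2)]]])
      (simp add: partial_deriv_def)
qed

text \<open>For \<open>k_times_mult\<close>: the product rule leaves one factor undifferentiated,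
  which then has to be known at the lower order as well.\<close>

lemma k_times_Suc_imp: "k_times_cont_differentiable (Suc k) f \<Longrightarrow> k_times_cont_differentiable k f"
proof (induction k arbitrary: f)
  case 0
  then show ?case by (auto intro!: continuous_at_imp_continuous_on differentiable_imp_continuous_within)
next
  case (Suc k)
  then show ?case by auto
qed

lemma k_times_const: "k_times_cont_differentiable k (\<lambda>x. c)"
  by (induction k arbitrary: c) (auto simp: pd_const)

lemma k_times_add:
  "k_times_cont_differentiable k f \<Longrightarrow> k_times_cont_differentiable k g \<Longrightarrow>
    k_times_cont_differentiable k (\<lambda>x. f x + g x)"
proof (induction k arbitrary: f g)
  case 0 then show ?case by (auto intro: continuous_intros)
next
  case (Suc k) then show ?case by (auto simp: pd_add)
qed

lemma k_times_linear:
  assumes "bounded_linear L"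
  shows "k_times_cont_differentiable k f \<Longrightarrow> k_times_cont_differentiable k (\<lambda>x. L (f x))"
proof (induction k arbitrary: f)
  case 0 then show ?case by (auto intro: bounded_linear.continuous_on[OF assms])
next
  case (Suc k)
  have "(\<lambda>x. L (f x)) differentiable (at x)" for x
    using Suc.prems bounded_linear.has_derivative[OF assms has_derivative_frechet, of f x]
    by (auto simp: differentiable_def)
  with Suc show ?case by (auto simp: pd_linear[OF assms])
qed

lemma k_times_mult:
  fixes f g :: "real^'n \<Rightarrow> real"
  shows "k_times_cont_differentiable k f \<Longrightarrow> k_times_cont_differentiable k g \<Longrightarrow>
    k_times_cont_differentiable k (\<lambda>x. f x * g x)"
proof (induction k arbitrary: f g)
  case 0 then show ?case by (auto intro: continuous_intros)
next
  case (Suc k)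
  have fg: "k_times_cont_differentiable k f" "k_times_cont_differentiable k g"
    using Suc.prems k_times_Suc_imp by blast+
  then show ?case using Suc by (auto simp: pd_mult intro!: k_times_add)
qed

lemma smooth_const: "smooth (\<lambda>x. c)"
  by (simp add: smooth_def k_times_const)

lemma smooth_add: "smooth f \<Longrightarrow> smooth g \<Longrightarrow> smooth (\<lambda>x. f x + g x)"
  by (simp add: smooth_def k_times_add)

lemma smooth_linear: "bounded_linear L \<Longrightarrow> smooth f \<Longrightarrow> smooth (\<lambda>x. L (f x))"
  by (simp add: smooth_def k_times_linear)

lemma smooth_minus: "smooth f \<Longrightarrow> smooth (\<lambda>x. - f x)"
  by (rule smooth_linear[OF bounded_linear_minus[OF bounded_linear_ident]])

lemma smooth_diff: "smooth f \<Longrightarrow> smooth g \<Longrightarrow> smooth (\<lambda>x. f x - g x)"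
  using smooth_add[OF _ smooth_minus, of f g] by simp

lemma smooth_mult: "smooth f \<Longrightarrow> smooth g \<Longrightarrow> smooth (\<lambda>x. f x * g x :: real)"
  by (simp add: smooth_def k_times_mult)

lemma smooth_component: "smooth f \<Longrightarrow> smooth (\<lambda>x. f x $ j)"
  by (rule smooth_linear[OF bounded_linear_vec_nth])

lemma smooth_sum: "(\<And>i. i \<in> I \<Longrightarrow> smooth (f i)) \<Longrightarrow> smooth (\<lambda>x. \<Sum>i\<in>I. f i x)"
  by (induction I rule: infinite_finite_induct) (auto intro: smooth_add smooth_const)

lemmas smooth_intros = smooth_const smooth_add smooth_minus smooth_diff smooth_mult
  smooth_component smooth_sum smooth_pd

lemma pd_minus:
  "smooth f \<Longrightarrow> pd i (\<lambda>x. - f x) = (\<lambda>x. - pd i f x)"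
  by (rule pd_linear[OF bounded_linear_minus[OF bounded_linear_ident]]) (rule smooth_differentiable)

lemma pd_diff:
  "smooth f \<Longrightarrow> smooth g \<Longrightarrow> pd i (\<lambda>x. f x - g x) = (\<lambda>x. pd i f x - pd i g x)"
  using pd_add[of f "\<lambda>x. - g x" i]
  by (simp add: smooth_differentiable smooth_minus pd_minus)

lemma pd_component:
  "smooth f \<Longrightarrow> pd i (\<lambda>x. f x $ j) = (\<lambda>x. pd i f x $ j)"
  by (rule pd_linear[OF bounded_linear_vec_nth]) (rule smooth_differentiable)

lemma pd_sum:
  "(\<And>i. i \<in> I \<Longrightarrow> smooth (f i)) \<Longrightarrow>
    pd j (\<lambda>x. \<Sum>i\<in>I. f i x) = (\<lambda>x. \<Sum>i\<in>I. pd j (f i) x)"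
  by (induction I rule: infinite_finite_induct)
    (auto simp: pd_const pd_add smooth_differentiable smooth_sum)

lemma pd_prod:
  fixes f g :: "real^'n \<Rightarrow> real"
  shows "smooth f \<Longrightarrow> smooth g \<Longrightarrow>
   pd i (\<lambda>x. f x * g x) = (\<lambda>x. f x * pd i g x + pd i f x * g x)"
  by (simp add: pd_mult smooth_differentiable)

section \<open>Derivatives along lines and symmetry of second derivatives\<close>

lemma frechet_derivative_partials:
  fixes f :: "real^'n \<Rightarrow> real"
  assumes "f differentiable (at x)"
  shows "frechet_derivative f (at x) y = (\<Sum>i\<in>UNIV. y $ i * pd i f x)"
proof -
  interpret bounded_linear "frechet_derivative f (at x)"
    using has_derivative_bounded_linear has_derivative_frechet[OF assms] by blast
  have "frechet_derivative f (at x) y = frechet_derivative f (at x) (\<Sum>i\<in>UNIV. (y $ i) *\<^sub>R axis i 1)"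
    using basis_expansion[of y] by (simp add: scalar_mult_eq_scaleR)
  then show ?thesis by (simp add: sum scaleR partial_deriv_def)
qed

lemma has_derivative_partials:
  fixes f :: "real^'n \<Rightarrow> real"
  assumes "smooth f"
  shows "(f has_derivative (\<lambda>y. \<Sum>i\<in>UNIV. y $ i * pd i f x)) (at x)"
  by (rule has_derivative_eq_rhs[OF has_derivative_frechet[OF smooth_differentiable[OF assms]]])
    (simp add: fun_eq_iff frechet_derivative_partials[OF smooth_differentiable[OF assms]])

lemma line_derivative:
  fixes f :: "real^'n \<Rightarrow> real"
  assumes "smooth f"
  shows "((\<lambda>t. f (x + t *\<^sub>R y)) has_real_derivative
    (\<Sum>i\<in>UNIV. y $ i * pd i f (x + t *\<^sub>R y))) (at t within S)"
proof -
  have "((\<lambda>t. f (x + t *\<^sub>R y)) has_derivative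
    (\<lambda>s. \<Sum>i\<in>UNIV. (s *\<^sub>R y) $ i * pd i f (x + t *\<^sub>R y))) (at t within S)"
    by (rule has_derivative_compose[OF _ has_derivative_partials[OF assms]])
       (auto intro!: derivative_eq_intros)
  then show ?thesis
    unfolding has_field_derivative_def
    by (rule has_derivative_eq_rhs) (simp add: fun_eq_iff sum_distrib_left mult_ac)
qed

lemma axis_derivative:
  fixes f :: "real^'n \<Rightarrow> real"
  assumes "smooth f"
  shows "((\<lambda>t. f (x + t *\<^sub>R axis i 1)) has_real_derivative
    pd i f (x + t *\<^sub>R axis i 1)) (at t within S)"
proof -
  have "(\<Sum>k\<in>UNIV. (axis i 1 :: real^'n) $ k * pd k f (x + t *\<^sub>R axis i 1))
    = pd i f (x + t *\<^sub>R axis i 1)"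
    by (simp add: axis_def if_distrib[of "\<lambda>c. c * _"] cong: if_cong)
  then show ?thesis using line_derivative[OF assms, of x "axis i 1" t S] by simp
qed

text \<open>The mean value theorem twice: along \<open>axis i\<close> for the increment of
  \<open>f\<close> across \<open>axis j\<close>, then along \<open>axis j\<close> for
  \<open>pd i f\<close>. The left side is symmetric in \<open>i\<close> and \<open>j\<close>, which
  \<open>pd_commute\<close> exploits.\<close>

lemma second_difference_mvt:
  fixes f :: "real^'n \<Rightarrow> real"
  assumes "smooth f" "t > 0"
  shows "\<exists>r\<in>{0..t}. \<exists>s\<in>{0..t}.
    f (x + t *\<^sub>R axis i 1 + t *\<^sub>R axis j 1) - f (x + t *\<^sub>R axis i 1) - f (x + t *\<^sub>R axis j 1) + f x
    = t * t * pd j (pd i f) (x + r *\<^sub>R axis i 1 + s *\<^sub>R axis j 1)"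
proof -
  define g where "g s = f (x + t *\<^sub>R axis j 1 + s *\<^sub>R axis i 1) - f (x + s *\<^sub>R axis i 1)" for s
  have "(g has_real_derivative pd i f (x + t *\<^sub>R axis j 1 + s *\<^sub>R axis i 1)
      - pd i f (x + s *\<^sub>R axis i 1)) (at s)" for s
    unfolding g_def by (intro derivative_intros axis_derivative assms)
  from MVT2[OF assms(2) this] obtain r where r: "0 < r" "r < t" and g: "g t - g 0 = (t - 0) *
      (pd i f (x + t *\<^sub>R axis j 1 + r *\<^sub>R axis i 1) - pd i f (x + r *\<^sub>R axis i 1))"
    by blast
  define k where "k s = pd i f (x + r *\<^sub>R axis i 1 + s *\<^sub>R axis j 1)" for s
  have "(k has_real_derivative pd j (pd i f) (x + r *\<^sub>R axis i 1 + s *\<^sub>R axis j 1)) (at s)" for s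
    unfolding k_def by (intro axis_derivative smooth_pd assms)
  from MVT2[OF assms(2) this] obtain s where s: "0 < s" "s < t" and k: "k t - k 0 = (t - 0) *
      pd j (pd i f) (x + r *\<^sub>R axis i 1 + s *\<^sub>R axis j 1)"
    by blast
  have "g t - g 0 = t * (k t - k 0)"
    using g by (simp add: k_def algebra_simps)
  then show ?thesis using r s k
    by (intro bexI[of _ r] bexI[of _ s]) (auto simp: g_def algebra_simps)
qed

text \<open>Schwarz's theorem. The second difference, expanded in either order of the directions,
  makes the two mixed partials agree at points close to \<open>x\<close>, and continuity moves both
  points to \<open>x\<close>.\<close>

lemma pd_commute:
  fixes f :: "real^'n \<Rightarrow> real"
  assumes "smooth f"
  shows "pd i (pd j f) x = pd j (pd i f) x"
proof -
  let ?q = "\<lambda>i j r s. x + r *\<^sub>R axis i 1 + s *\<^sub>R axis j 1"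
  have lim: "\<exists>d>0. \<forall>t r s. 0 < t \<and> t < d \<and> r \<in> {0..t} \<and> s \<in> {0..t} \<longrightarrow>
      \<bar>pd j (pd i f) (?q i j r s)
        - pd j (pd i f) x\<bar> < e" if "e > 0" for e i j
  proof -
    have "isCont (pd j (pd i f)) x"
      using smooth_continuous_on[of "pd j (pd i f)" UNIV] assms
      by (simp add: smooth_pd continuous_on_eq_continuous_at)
    then obtain d where d: "d > 0" and dd: "\<And>y. dist y x < d \<Longrightarrow>
        \<bar>pd j (pd i f) y - pd j (pd i f) x\<bar> < e"
      using \<open>e > 0\<close> unfolding continuous_at_eps_delta by (auto simp: dist_real_def)
    show ?thesis
    \<comment> \<open>The evaluation point is within \<open>r + s \<le> 2 * t\<close> of
      \<open>x\<close>, hence half of \<open>d\<close>.\<close>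
    proof (intro exI[of _ "d/2"] conjI allI impI)
      fix t r s :: real assume a: "0 < t \<and> t < d / 2 \<and> r \<in> {0..t} \<and> s \<in> {0..t}"
      have "norm (r *\<^sub>R axis i 1 + s *\<^sub>R axis j (1::real)) \<le> \<bar>r\<bar> * 1 + \<bar>s\<bar> * 1"
        by (rule norm_triangle_le) simp
      then show "\<bar>pd j (pd i f) (?q i j r s)
        - pd j (pd i f) x\<bar> < e"
        using a by (intro dd) (auto simp: dist_norm add.assoc)
    qed (use d in auto)
  qed
  have "\<bar>pd i (pd j f) x - pd j (pd i f) x\<bar> < e + e" if e: "e > 0" for e
  proof -
    obtain d1 where d1: "d1 > 0" "\<And>t r s. 0 < t \<Longrightarrow> t < d1 \<Longrightarrow> r \<in> {0..t} \<Longrightarrow> s \<in> {0..t} \<Longrightarrow>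
      \<bar>pd j (pd i f) (?q i j r s)
        - pd j (pd i f) x\<bar> < e" using lim[OF e] by meson
    obtain d2 where d2: "d2 > 0" "\<And>t r s. 0 < t \<Longrightarrow> t < d2 \<Longrightarrow> r \<in> {0..t} \<Longrightarrow> s \<in> {0..t} \<Longrightarrow>
      \<bar>pd i (pd j f) (?q j i r s)
        - pd i (pd j f) x\<bar> < e" using lim[OF e] by meson
    define t where "t = min d1 d2 / 2"
    have t: "0 < t" "t < d1" "t < d2" using d1 d2 by (auto simp: t_def)
    obtain r s where rs: "r \<in> {0..t}" "s \<in> {0..t}"
      "f (x + t *\<^sub>R axis i 1 + t *\<^sub>R axis j 1) - f (x + t *\<^sub>R axis i 1) - f (x + t *\<^sub>R axis j 1) + f x
       = t * t * pd j (pd i f) (?q i j r s)"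
      using second_difference_mvt[OF assms t(1)] by blast
    obtain r' s' where rs': "r' \<in> {0..t}" "s' \<in> {0..t}"
      "f (x + t *\<^sub>R axis j 1 + t *\<^sub>R axis i 1) - f (x + t *\<^sub>R axis j 1) - f (x + t *\<^sub>R axis i 1) + f x
       = t * t * pd i (pd j f) (?q j i r' s')"
      using second_difference_mvt[OF assms t(1)] by blast
    have "t * t * pd j (pd i f) (?q i j r s)
      = t * t * pd i (pd j f) (?q j i r' s')"
      using rs(3) rs'(3) by (simp add: algebra_simps)
    then have "pd j (pd i f) (?q i j r s)
      = pd i (pd j f) (?q j i r' s')"
      using t by simp
    then show ?thesis using d1(2)[OF t(1,2) rs(1,2)] d2(2)[OF t(1,3) rs'(1,2)] by linarith
  qed
  from this[of "\<bar>pd i (pd j f) x - pd j (pd i f) x\<bar> / 2"]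
  show ?thesis by fastforce
qed

section \<open>The vorticity form of the equations\<close>

locale stationary_navier_stokes =
  fixes v :: "real^3 \<Rightarrow> real^3" and p :: "real^3 \<Rightarrow> real"
  assumes smooth_v: "smooth v" and smooth_p: "smooth p"
    and momentum: "\<And>x. - laplacian v x + convective v v x + gradient p x = 0"
    and incompressible: "\<And>x. divergence v x = 0"
begin

abbreviation V :: "3 \<Rightarrow> real^3 \<Rightarrow> real" where "V j \<equiv> \<lambda>x. v x $ j"

text \<open>\<open>Om\<close> is the vorticity as an antisymmetric matrix, \<open>lamb\<close> the Lamb vector \<open>curl v \<times> v\<close>, and
  \<open>head\<close> is minus the Bernoulli function, so that it is nonnegative up to a constant.\<close>

definition Om :: "3 \<Rightarrow> 3 \<Rightarrow> real^3 \<Rightarrow> real" where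
  "Om i j x = pd i (V j) x - pd j (V i) x"

definition lamb :: "3 \<Rightarrow> real^3 \<Rightarrow> real" where
  "lamb j x = (\<Sum>i\<in>UNIV. V i x * Om i j x)"

definition head :: "real^3 \<Rightarrow> real" where
  "head x = - (p x + (\<Sum>i\<in>UNIV. V i x * V i x) / 2)"

definition rho :: "real^3 \<Rightarrow> real" where
  "rho x = norm (curl v x)"

lemma smooth_V: "smooth (V j)"
  by (intro smooth_intros smooth_v)

lemma smooth_Om: "smooth (Om i j)"
  unfolding Om_def[abs_def] by (intro smooth_intros smooth_v)

lemma smooth_lamb: "smooth (lamb j)"
  unfolding lamb_def[abs_def] by (intro smooth_intros smooth_v smooth_Om)

lemma smooth_half_square: "smooth (\<lambda>x. (\<Sum>i\<in>UNIV. V i x * V i x) / 2)"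
proof -
  have "smooth (\<lambda>x. (\<Sum>i\<in>UNIV. V i x * V i x) * (1/2))"
    by (intro smooth_intros smooth_v)
  then show ?thesis by simp
qed

lemma smooth_head: "smooth head"
  unfolding head_def[abs_def] by (intro smooth_minus smooth_add smooth_p smooth_half_square)

lemma divergence_V: "(\<Sum>i\<in>UNIV. pd i (V i) x) = 0"
  using incompressible[of x] by (simp add: divergence_def)

lemma momentum_component:
  "pd j p x = (\<Sum>i\<in>UNIV. pd i (pd i (V j)) x)
    - (\<Sum>i\<in>UNIV. V i x * pd i (V j) x)"
proof -
  have "pd i (pd i (V j)) x = pd i (pd i v) x $ j" for i
    by (simp add: pd_component smooth_v smooth_pd)
  moreover have "pd i (V j) x = pd i v x $ j" for i
    by (simp add: pd_component smooth_v)
  ultimately show ?thesis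
    using arg_cong[OF momentum[of x], of "\<lambda>z. z $ j"]
    by (simp add: laplacian_def convective_def gradient_def)
qed

lemma partial_divergence_V: "(\<Sum>i\<in>UNIV. pd j (pd i (V i)) x) = 0"
proof -
  have "(\<Sum>i\<in>UNIV. pd j (pd i (V i)) x)
      = pd j (\<lambda>x. \<Sum>i\<in>UNIV. pd i (V i) x) x"
    by (simp add: pd_sum smooth_pd smooth_V)
  also have "\<dots> = 0" by (simp add: divergence_V pd_const)
  finally show ?thesis .
qed

lemma partial_Om: "pd k (Om i j) x =
    pd k (pd i (V j)) x - pd k (pd j (V i)) x"
  unfolding Om_def[abs_def]
  by (simp add: pd_diff smooth_pd smooth_V)

text \<open>The index form of \<Delta>v = - curl (curl v): the other half of \<open>Om\<close>
  contributes the gradient of div v, which vanishes.\<close>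

lemma div_Om: "(\<Sum>i\<in>UNIV. pd i (Om i j) x) = (\<Sum>i\<in>UNIV. pd i (pd i (V j)) x)"
  using partial_divergence_V[of j x]
  by (simp add: partial_Om sum_subtractf pd_commute[OF smooth_V, of _ j])

lemma partial_head: "pd j head x = - pd j p x - (\<Sum>i\<in>UNIV. V i x * pd j (V i) x)"
proof -
  have 1: "pd j (\<lambda>x. (\<Sum>i\<in>UNIV. V i x * V i x) * (1/2)) x = (\<Sum>i\<in>UNIV. V i x * pd j (V i) x)"
    by (subst pd_prod; (intro smooth_intros smooth_v)?;
      subst pd_sum; (intro smooth_intros smooth_v)?)
      (simp add: pd_const pd_prod smooth_V sum_divide_distrib mult_ac)
  show ?thesis
    using 1 unfolding head_def[abs_def]
    by (subst pd_minus[OF smooth_add[OF smooth_p smooth_half_square]],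
        subst pd_add[OF smooth_differentiable[OF smooth_p] smooth_differentiable[OF smooth_half_square]]) simp
qed

text \<open>The convective term splits as v_i (d_i v_j - d_j v_i) + v_i d_j v_i. The first part is
  the Lamb vector; the second is the gradient of |v|^2/2 and cancels against the one in
  \<open>partial_head\<close>.\<close>

lemma grad_head: "pd j head x = lamb j x - (\<Sum>i\<in>UNIV. pd i (Om i j) x)"
  by (simp add: partial_head momentum_component div_Om lamb_def Om_def right_diff_distrib sum_subtractf)

lemma V_lamb: "(\<Sum>j\<in>UNIV. V j x * lamb j x) = 0"
  by (simp add: lamb_def Om_def sum_3 algebra_simps)

text \<open>A Poisson equation in the form div (grad u - w) = 0, as \<open>bump_mean_deriv\<close>
  takes it, so that no derivative falls on w in the estimates. \<open>laplace_head\<close> and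
  \<open>laplace_Om\<close> have the same form.\<close>

lemma laplace_V: "(\<Sum>i\<in>UNIV. pd i (\<lambda>y. pd i (V j) y - Om i j y) x) = 0"
proof -
  have "pd i (\<lambda>y. pd i (V j) y - Om i j y) x = pd j (pd i (V i)) x" for i
    by (subst pd_diff) (auto intro!: smooth_intros smooth_v smooth_Om simp: partial_Om
      pd_commute[OF smooth_V, of _ j])
  then show ?thesis by (simp add: partial_divergence_V)
qed

text \<open>By \<open>grad_head\<close> the field is minus the divergence of \<open>Om\<close>, and
  the double divergence of an antisymmetric matrix equals its own negative after swapping the
  indices.\<close>

lemma laplace_head: "(\<Sum>j\<in>UNIV. pd j (\<lambda>y. pd j head y - lamb j y) x) = 0"
proof -
  have "pd j (\<lambda>y. pd j head y - lamb j y) x = - (\<Sum>i\<in>UNIV. pd j (pd i (Om i j)) x)" for j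
  proof -
    have "(\<lambda>y. pd j head y - lamb j y) = (\<lambda>y. - (\<Sum>i\<in>UNIV. pd i (Om i j) y))"
      by (simp add: grad_head)
    then show ?thesis
      by (simp add: pd_minus pd_sum smooth_sum smooth_pd smooth_Om)
  qed
  moreover have "(\<Sum>j\<in>UNIV. \<Sum>i\<in>UNIV. pd j (pd i (Om i j)) x) = 0"
  proof -
    have "pd i (Om j i) x = - pd i (Om i j) x" for i j x
      by (simp add: partial_Om)
    then have m: "pd i (Om j i) = (\<lambda>x. - pd i (Om i j) x)" for i j
      by blast
    have "(\<Sum>j\<in>UNIV. \<Sum>i\<in>UNIV. pd j (pd i (Om i j)) x)
        = (\<Sum>i\<in>UNIV. \<Sum>j\<in>UNIV. pd i (pd j (Om i j)) x)"
      by (subst sum.swap) (simp add: pd_commute[OF smooth_Om])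
    also have "\<dots> = - (\<Sum>j\<in>UNIV. \<Sum>i\<in>UNIV. pd j (pd i (Om i j)) x)"
      by (simp add: m pd_minus smooth_pd smooth_Om sum_negf)
    finally show ?thesis by simp
  qed
  ultimately show ?thesis by (simp add: sum_negf)
qed

text \<open>Its divergence in \<open>k\<close> is d_i b_j - d_j b_i for the Lamb vector b, which
  puts the right side of the vorticity equation in divergence form.\<close>

definition flux_Om :: "3 \<Rightarrow> 3 \<Rightarrow> 3 \<Rightarrow> real^3 \<Rightarrow> real" where
  "flux_Om i j k x = (if k = i then lamb j x else 0) - (if k = j then lamb i x else 0)"

lemma smooth_flux_Om: "smooth (flux_Om i j k)"
  unfolding flux_Om_def[abs_def]
  by (cases "k = i"; cases "k = j") (auto intro!: smooth_minus smooth_diff smooth_lamb smooth_const)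

lemma partial_flux_Om: "pd k (flux_Om i j k) x =
   (if k = i then pd i (lamb j) x else 0) - (if k = j then pd j (lamb i) x else 0)"
  unfolding flux_Om_def[abs_def]
  by (cases "k = i"; cases "k = j") (auto simp: pd_diff pd_minus smooth_lamb pd_const)

text \<open>The cyclic identity \<open>bianchi\<close> turns the Laplacian of \<open>Om i j\<close>
  into an antisymmetrised gradient of the divergence of \<open>Om\<close>. Replacing that divergence
  by \<open>grad_head\<close> leaves the curl of the Lamb vector, since the second derivatives of
  \<open>head\<close> cancel.\<close>

lemma laplace_Om: "(\<Sum>k\<in>UNIV. pd k (\<lambda>y. pd k (Om i j) y - flux_Om i j k y) x) = 0"
proof -
  have bianchi: "pd k (Om i j) y = pd i (Om k j) y - pd j (Om k i) y" for k y
    unfolding partial_Om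
    using pd_commute[OF smooth_V, of k i j y] pd_commute[OF smooth_V, of k j i y]
      pd_commute[OF smooth_V, of i j k y] by linarith
  have "pd k (pd k (Om i j)) x
     = pd i (pd k (Om k j)) x - pd j (pd k (Om k i)) x" for k
  proof -
    have "pd k (Om i j) = (\<lambda>y. pd i (Om k j) y - pd j (Om k i) y)"
      using bianchi by blast
    then show ?thesis
      by (simp add: pd_diff smooth_pd smooth_Om pd_commute[OF smooth_Om, of k])
  qed
  then have "(\<Sum>k\<in>UNIV. pd k (pd k (Om i j)) x)
     = (\<Sum>k\<in>UNIV. pd i (pd k (Om k j)) x) - (\<Sum>k\<in>UNIV. pd j (pd k (Om k i)) x)"
    by (simp add: sum_subtractf)
  moreover have "(\<Sum>k\<in>UNIV. pd i (pd k (Om k j)) x) =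
     pd i (lamb j) x - pd i (pd j head) x" for i j
  proof -
    have "(\<lambda>y. \<Sum>k\<in>UNIV. pd k (Om k j) y) = (\<lambda>y. lamb j y - pd j head y)"
      by (simp add: grad_head)
    from arg_cong[OF this, of "\<lambda>f. pd i f x"] show ?thesis
      by (simp add: pd_sum pd_diff smooth_pd smooth_Om smooth_lamb smooth_head)
  qed
  ultimately have "(\<Sum>k\<in>UNIV. pd k (pd k (Om i j)) x) = pd i (lamb j) x - pd j (lamb i) x"
    by (simp add: pd_commute[OF smooth_head])
  then show ?thesis
    by (simp add: pd_diff smooth_pd smooth_Om smooth_flux_Om sum_subtractf partial_flux_Om)
qed

lemma curl_components:
  "curl v x $ 1 = Om 2 3 x" "curl v x $ 2 = Om 3 1 x" "curl v x $ 3 = Om 1 2 x"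
  by (simp_all add: curl_def Om_def)

lemma rho_squared: "rho x ^ 2 = (\<Sum>i\<in>UNIV. \<Sum>j\<in>UNIV. Om i j x * Om i j x) / 2"
proof -
  have "Om 3 2 x = - Om 2 3 x" "Om 1 3 x = - Om 3 1 x" "Om 2 1 x = - Om 1 2 x" "Om i i x = 0" for i
    by (simp_all add: Om_def)
  then show ?thesis
    by (simp add: rho_def norm_vec_def L2_set_def sum_3 curl_components power2_eq_square)
qed

text \<open>By \<open>V_lamb\<close> the Lamb part of \<open>grad_head\<close> drops out and - v_j
  d_i Om_ij remains. The product rule for the divergence of \<open>lamb\<close> gives the same term
  plus \<open>Om\<close> paired with the gradient of v, and that pairing is - |curl v|^2.\<close>

lemma V_grad_head: "(\<Sum>j\<in>UNIV. V j x * pd j head x) = (\<Sum>j\<in>UNIV. pd j (lamb j) x) + rho x ^ 2"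
proof -
  have 1: "(\<Sum>j\<in>UNIV. V j x * pd j head x) = - (\<Sum>j\<in>UNIV. V j x * (\<Sum>i\<in>UNIV. pd i (Om i j) x))"
    using V_lamb[of x] by (simp add: grad_head right_diff_distrib sum_subtractf)
  have 2: "pd j (lamb j) x = (\<Sum>i\<in>UNIV. V i x * pd j (Om i j) x + pd j (V i) x * Om i j x)" for j
    unfolding lamb_def[abs_def]
    by (subst pd_sum) (auto intro!: smooth_mult smooth_V smooth_Om simp: pd_prod smooth_V smooth_Om)
  have 3: "Om 3 2 x = - Om 2 3 x" "Om 1 3 x = - Om 3 1 x" "Om 2 1 x = - Om 1 2 x" "Om i i x = 0" for i
    by (simp_all add: Om_def)
  have 4: "pd k (Om 3 2) x = - pd k (Om 2 3) x" "pd k (Om 1 3) x = - pd k (Om 3 1) x"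
    "pd k (Om 2 1) x = - pd k (Om 1 2) x" "pd k (Om i i) x = 0" for i k
    by (simp_all add: partial_Om)
  have 5: "pd 2 (V 3) x = pd 3 (V 2) x + Om 2 3 x"
     "pd 3 (V 1) x = pd 1 (V 3) x + Om 3 1 x"
     "pd 1 (V 2) x = pd 2 (V 1) x + Om 1 2 x" by (simp_all add: Om_def)
  show ?thesis
    by (simp add: 1 2 sum_3 3 4 5 rho_squared algebra_simps)
qed

lemma abs_Om_le: "\<bar>Om i j x\<bar> \<le> rho x"
proof -
  have "\<bar>curl v x $ k\<bar> \<le> rho x" for k by (simp add: rho_def component_le_norm_cart)
  note c = this[of 1] this[of 2] this[of 3]
  have 3: "Om 3 2 x = - Om 2 3 x" "Om 1 3 x = - Om 3 1 x" "Om 2 1 x = - Om 1 2 x" "Om i i x = 0" for i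
    by (simp_all add: Om_def)
  have "0 \<le> rho x" by (simp add: rho_def)
  then show ?thesis using c exhaust_3[of i] exhaust_3[of j]
    by (auto simp: curl_components 3)
qed

lemma rho_le_Om: "rho x \<le> (\<Sum>i\<in>UNIV. \<Sum>j\<in>UNIV. \<bar>Om i j x\<bar>)"
proof -
  have "rho x \<le> (\<Sum>k\<in>UNIV. \<bar>curl v x $ k\<bar>)" unfolding rho_def by (rule norm_le_l1_cart)
  also have "\<dots> \<le> (\<Sum>i\<in>UNIV. \<Sum>j\<in>UNIV. \<bar>Om i j x\<bar>)"
    by (simp add: sum_3 curl_components)
  finally show ?thesis .
qed

lemma abs_lamb_le: "\<bar>lamb j x\<bar> \<le> 3 * (norm (v x) * rho x)"
proof -
  have "\<bar>lamb j x\<bar> \<le> (\<Sum>i\<in>UNIV. \<bar>V i x * Om i j x\<bar>)" unfolding lamb_def by (rule sum_abs)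
  also have "\<dots> \<le> (\<Sum>i\<in>(UNIV::3 set). norm (v x) * rho x)"
    by (intro sum_mono) (simp add: abs_mult mult_mono component_le_norm_cart abs_Om_le)
  finally show ?thesis by simp
qed

lemma abs_flux_Om_le: "\<bar>flux_Om i j k x\<bar> \<le> 6 * (norm (v x) * rho x)"
  using abs_lamb_le[of i x] abs_lamb_le[of j x] by (auto simp: flux_Om_def)

lemma continuous_rho: "continuous_on S rho"
proof -
  have "rho = (\<lambda>x. sqrt ((\<Sum>i\<in>UNIV. \<Sum>j\<in>UNIV. Om i j x * Om i j x) / 2))"
    by (metis rho_squared rho_def norm_ge_zero real_sqrt_unique)
  moreover have "continuous_on S (\<lambda>x. sqrt ((\<Sum>i\<in>UNIV. \<Sum>j\<in>UNIV. Om i j x * Om i j x) / 2))"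
    by (intro continuous_intros smooth_continuous_on smooth_Om) auto
  ultimately show ?thesis by simp
qed

lemma rho_nonneg: "0 \<le> rho x" by (simp add: rho_def)

end

section \<open>Averages and the divergence theorem\<close>

text \<open>The exponent is at least 2, so the kink at 0 disappears and the derivative is
  continuous. All bumps and truncations below rest on this.\<close>

lemma DERIV_max0_power:
  "((\<lambda>s::real. max 0 s ^ Suc (Suc n)) has_real_derivative real (Suc (Suc n)) * max 0 s ^ Suc n) (at s within S)"
proof -
  consider "s > 0" | "s < 0" | "s = 0" by linarith
  then have "((\<lambda>s::real. max 0 s ^ Suc (Suc n)) has_real_derivative real (Suc (Suc n)) * max 0 s ^ Suc n) (at s)"
  proof cases
    case 1
    have "((\<lambda>s::real. s ^ Suc (Suc n)) has_real_derivative real (Suc (Suc n)) * s ^ Suc n) (at s)"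
      using DERIV_pow[of "Suc (Suc n)" s] by simp
    then have "((\<lambda>s::real. max 0 s ^ Suc (Suc n)) has_real_derivative real (Suc (Suc n)) * s ^ Suc n) (at s)"
      by (rule has_field_derivative_transform_within_open[of _ _ _ "{0<..}"]) (use 1 in auto)
    then show ?thesis using 1 by (simp add: max_absorb2)
  next
    case 2
    have "((\<lambda>s::real. 0) has_real_derivative 0) (at s)" by simp
    then have "((\<lambda>s::real. max 0 s ^ Suc (Suc n)) has_real_derivative 0) (at s)"
      by (rule has_field_derivative_transform_within_open[of _ _ _ "{..<0}"]) (use 2 in auto)
    then show ?thesis using 2 by simp
  next
    case 3
    have "((\<lambda>h::real. max 0 h ^ Suc (Suc n) / h) \<longlongrightarrow> 0) (at 0)"
    proof (rule Lim_null_comparison)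
      have "norm (max 0 h ^ Suc (Suc n) / h) \<le> \<bar>h\<bar> ^ Suc n" for h :: real
      proof (cases "h > 0")
        case False
        then have "max 0 h ^ Suc (Suc n) / h = 0" by (simp add: max_absorb1)
        then show ?thesis by (simp only: norm_zero) (rule zero_le_power, simp)
      qed (simp add: max_absorb2)
      then show "\<forall>\<^sub>F h in at 0. norm (max 0 h ^ Suc (Suc n) / h) \<le> \<bar>h\<bar> ^ Suc n"
        by simp
      show "((\<lambda>h::real. \<bar>h\<bar> ^ Suc n) \<longlongrightarrow> 0) (at 0)"
        by (rule tendsto_eq_intros refl tendsto_rabs_zero | simp)+
    qed
    then show ?thesis by (simp add: 3 DERIV_def)
  qed
  then show ?thesis by (rule has_field_derivative_at_within)
qed

lemma integrable_continuous_support: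
  fixes f :: "'a::euclidean_space \<Rightarrow> real"
  assumes "continuous_on UNIV f" "\<And>x. norm x > R \<Longrightarrow> f x = 0"
  shows "integrable lborel f"
proof -
  have "integrable lborel (\<lambda>x. indicator (cball 0 R) x *\<^sub>R f x)"
    by (rule borel_integrable_compact) (auto intro: continuous_on_subset[OF assms(1)])
  moreover have "(\<lambda>x. indicator (cball 0 R) x *\<^sub>R f x) = f"
    using assms(2) by (force simp: indicator_def fun_eq_iff not_le)
  ultimately show ?thesis by simp
qed

lemma lborel_integral_translation:
  fixes f :: "'a::euclidean_space \<Rightarrow> real"
  assumes "f \<in> borel_measurable borel"
  shows "(LBINT x. f (x + c)) = (LBINT x. f x)"
proof -
  have "(LBINT x. f x) = (\<integral>x. f x \<partial>distr lborel borel ((+) c))"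
    by (simp add: lborel_distr_plus)
  also have "\<dots> = (LBINT x. f (c + x))"
    by (subst integral_distr) (use assms in auto)
  finally show ?thesis by (simp add: add.commute)
qed

lemma directional_derivative_support:
  fixes g :: "'a::real_normed_vector \<Rightarrow> real"
  assumes supp: "\<And>x. norm x > R \<Longrightarrow> g x = 0" and x: "norm x > R"
    and deriv: "((\<lambda>t. g (x + t *\<^sub>R e)) has_real_derivative g') (at 0)"
  shows "g' = 0"
proof -
  have "((\<lambda>t. norm (x + t *\<^sub>R e)) \<longlongrightarrow> norm (x + 0 *\<^sub>R e)) (at 0)"
    by (intro tendsto_intros)
  then have "\<forall>\<^sub>F t in at 0. norm (x + t *\<^sub>R e) > R"
    using x by (auto dest: order_tendstoD(1))
  then have "\<forall>\<^sub>F t in nhds 0. norm (x + t *\<^sub>R e) > R"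
    unfolding eventually_at_filter by eventually_elim (use x in auto)
  then have "\<forall>\<^sub>F t in nhds 0. g (x + t *\<^sub>R e) = 0"
    by eventually_elim (rule supp)
  then have "((\<lambda>t. g (x + t *\<^sub>R e)) has_real_derivative 0) (at 0)"
    by (subst DERIV_cong_ev[OF refl _ refl, where g="\<lambda>_. 0"]) auto
  then show ?thesis using deriv DERIV_unique by blast
qed

text \<open>The integrals of the difference quotients vanish by translation invariance.\<close>

lemma integral_directional_derivative_eq_0:
  fixes g g' :: "'a::euclidean_space \<Rightarrow> real"
  assumes cont: "continuous_on UNIV g" "continuous_on UNIV g'"
    and supp: "\<And>x. norm x > R \<Longrightarrow> g x = 0"
    and deriv: "\<And>x. ((\<lambda>t. g (x + t *\<^sub>R e)) has_real_derivative g' x) (at 0)"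
  shows "integrable lborel g'" "(LBINT x. g' x) = 0"
proof -
  have supp': "g' x = 0" if "norm x > R" for x
    by (rule directional_derivative_support[OF supp that deriv])
  show int': "integrable lborel g'"
    by (rule integrable_continuous_support[OF cont(2) supp'])
  have int: "integrable lborel g"
    by (rule integrable_continuous_support[OF cont(1) supp])
  have "bounded (g' ` cball 0 R)"
    by (intro compact_imp_bounded compact_continuous_image continuous_on_subset[OF cont(2)]) auto
  then obtain B0 where "\<And>x. x \<in> cball 0 R \<Longrightarrow> \<bar>g' x\<bar> \<le> B0"
    unfolding bounded_iff by fastforce
  then have B: "\<bar>g' x\<bar> \<le> max B0 0" for x
    using supp'[of x] by (cases "norm x > R") (auto simp: le_max_iff_disj)
  define B where "B = max B0 0"
  have deriv_at: "((\<lambda>t. g (x + t *\<^sub>R e)) has_real_derivative g' (x + t *\<^sub>R e)) (at t)" for x t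
    using DERIV_shift[of "\<lambda>s. g (x + s *\<^sub>R e)" "g' (x + t *\<^sub>R e)" 0 t]
      deriv[of "x + t *\<^sub>R e"] by (simp add: algebra_simps)
  have lip: "\<bar>g (x + t *\<^sub>R e) - g x\<bar> \<le> t * B" if "t > 0" for x t
  proof -
    from MVT2[OF that, of "\<lambda>t. g (x + t *\<^sub>R e)", OF deriv_at]
    obtain z where "g (x + t *\<^sub>R e) - g x = t * g' (x + z *\<^sub>R e)" by auto
    then show ?thesis using B[of "x + z *\<^sub>R e"] that by (auto simp: abs_mult B_def intro!: mult_left_mono)
  qed
  \<comment> \<open>Steps of length at most 1 keep all difference quotients supported in the one
    ball of radius \<open>R + norm e\<close>, where the constant \<open>B\<close> dominates
    them.\<close>
  define t where "t n = inverse (real (Suc n))" for n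
  have t: "0 < t n" "t n \<le> 1" for n by (auto simp: t_def inverse_le_1_iff)
  define q where "q n x = (g (x + t n *\<^sub>R e) - g x) / t n" for n x
  have gm: "g \<in> borel_measurable borel" "g' \<in> borel_measurable borel"
    using cont by (auto intro: borel_measurable_continuous_onI)
  have q0: "(LBINT x. q n x) = 0" for n
  proof -
    have "integrable lborel (\<lambda>x. g (x + t n *\<^sub>R e))"
    proof (rule integrable_continuous_support[of _ "R + norm e"])
      show "continuous_on UNIV (\<lambda>x. g (x + t n *\<^sub>R e))"
        by (intro continuous_on_compose2[OF cont(1)] continuous_intros) auto
      fix x :: 'a assume "norm x > R + norm e"
      moreover have "norm x \<le> norm (x + t n *\<^sub>R e) + t n * norm e"
        using norm_triangle_ineq4[of "x + t n *\<^sub>R e" "t n *\<^sub>R e"] t[of n] by simp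
      moreover have "t n * norm e \<le> norm e" using t[of n] by (simp add: mult_left_le_one_le)
      ultimately show "g (x + t n *\<^sub>R e) = 0" by (intro supp) linarith
    qed
    then show ?thesis using int
      by (simp add: q_def lborel_integral_translation[OF gm(1)])
  qed
  have "(\<lambda>n. LBINT x. q n x) \<longlonglongrightarrow> (LBINT x. g' x)"
  proof (rule integral_dominated_convergence)
    show "g' \<in> borel_measurable lborel" using gm by simp
    show "q n \<in> borel_measurable lborel" for n
      using gm(1) unfolding q_def by measurable
    show "integrable lborel (\<lambda>x. indicator (cball 0 (R + norm e)) x *\<^sub>R B)"
      by (rule borel_integrable_compact) auto
    show "AE x in lborel. (\<lambda>n. q n x) \<longlonglongrightarrow> g' x"
    proof (rule AE_I2)
      fix x
      have "((\<lambda>h. (g (x + h *\<^sub>R e) - g x) / h) \<longlongrightarrow> g' x) (at 0)"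
        using deriv[of x] by (simp add: DERIV_def)
      moreover have "filterlim t (at 0) sequentially"
        unfolding t_def[abs_def] filterlim_at
        using LIMSEQ_inverse_real_of_nat by auto
      ultimately show "(\<lambda>n. q n x) \<longlonglongrightarrow> g' x"
        unfolding q_def by (rule filterlim_compose)
    qed
    show "AE x in lborel. norm (q n x) \<le> indicator (cball 0 (R + norm e)) x *\<^sub>R B" for n
    proof (rule AE_I2)
      fix x
      show "norm (q n x) \<le> indicator (cball 0 (R + norm e)) x *\<^sub>R B"
      proof (cases "norm x \<le> R + norm e")
        case True
        then show ?thesis using lip[of "t n" x] t[of n] by (simp add: q_def field_simps)
      next
        case False
        have "norm x \<le> norm (x + t n *\<^sub>R e) + t n * norm e"
          using norm_triangle_ineq4[of "x + t n *\<^sub>R e" "t n *\<^sub>R e"] t[of n] by simp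
        moreover have "t n * norm e \<le> norm e" using t[of n] by (simp add: mult_left_le_one_le)
        ultimately have "g (x + t n *\<^sub>R e) = 0" using False by (intro supp) linarith
        moreover have "g x = 0" using False norm_ge_zero[of e] by (intro supp) linarith
        ultimately show ?thesis by (simp add: q_def B_def)
      qed
    qed
  qed
  then show "(LBINT x. g' x) = 0"
    by (simp add: q0 LIMSEQ_const_iff)
qed

text \<open>\<open>bump_pot\<close> is chosen so that its gradient is \<open>- bump z *\<^sub>R z\<close>; hence the radial derivative of a
  \<open>bump\<close> average of \<open>u\<close> only sees the Laplacian of \<open>u\<close>, and a field \<open>w\<close> with the same divergence as
  \<open>\<nabla>u\<close> may replace \<open>\<nabla>u\<close>. This stands in for the Newtonian kernel.\<close>

definition bump :: "real^'n \<Rightarrow> real" where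
  "bump z = max 0 (1 - z \<bullet> z) ^ 2"

definition bump_pot :: "real^'n \<Rightarrow> real" where
  "bump_pot z = max 0 (1 - z \<bullet> z) ^ 3 / 6"

lemma bump_eq_0: "1 \<le> norm z \<Longrightarrow> bump z = 0" "1 \<le> norm z \<Longrightarrow> bump_pot z = 0"
  using power_mono[of 1 "norm z" 2] by (simp_all add: bump_def bump_pot_def dot_square_norm max_absorb1)

lemma bump_bounds: "0 \<le> bump z" "bump z \<le> 1"
proof -
  show "bump z \<le> 1" unfolding bump_def by (rule power_le_one) auto
qed (simp add: bump_def)

lemma continuous_bump [continuous_intros]: "continuous_on S bump" "continuous_on S bump_pot"
  unfolding bump_def bump_pot_def by (intro continuous_intros | simp)+

lemma bump_pot_deriv:
  "((\<lambda>t. bump_pot (z + t *\<^sub>R axis i 1)) has_real_derivative - (bump z * z $ i)) (at 0)"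
proof -
  have eq: "(z + t *\<^sub>R axis i 1) \<bullet> (z + t *\<^sub>R axis i 1) = z \<bullet> z + 2 * t * z $ i + t * t" for t
    by (simp add: inner_add_left inner_add_right inner_axis inner_axis' algebra_simps)
  have "((\<lambda>t. max 0 (1 - (z \<bullet> z + 2 * t * z $ i + t * t)) ^ 3) has_real_derivative
      (3 * max 0 (1 - (z \<bullet> z + 2 * 0 * z $ i + 0 * 0)) ^ 2) * (- (2 * z $ i))) (at 0)"
    by (rule DERIV_chain2[where f="\<lambda>s. max 0 s ^ 3"])
      (use DERIV_max0_power[of 1] in \<open>auto intro!: derivative_eq_intros simp: numeral_3_eq_3 numeral_2_eq_2\<close>)
  from DERIV_cdivide[OF this, of 6] show ?thesis
    unfolding bump_pot_def eq by (simp add: bump_def)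
qed

lemma line_derivative_scaled:
  fixes f :: "real^'n \<Rightarrow> real"
  assumes "smooth f"
  shows "((\<lambda>t. f (x + r *\<^sub>R (z + t *\<^sub>R axis i 1))) has_real_derivative
    r * pd i f (x + r *\<^sub>R z)) (at 0)"
proof -
  have "(\<Sum>k\<in>UNIV. (r *\<^sub>R axis i 1 :: real^'n) $ k * pd k f (x + r *\<^sub>R z))
    = r * pd i f (x + r *\<^sub>R z)"
    by (simp add: axis_def if_distrib[of "\<lambda>c. _ * c"] if_distrib[of "\<lambda>c. c * _"] cong: if_cong)
  then show ?thesis using line_derivative[OF assms, of "x + r *\<^sub>R z" "r *\<^sub>R axis i 1" 0 UNIV]
    by (simp add: algebra_simps)
qed

text \<open>For \<open>w i = pd i u\<close> this is the derivative in \<open>r\<close> of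
  \<open>bump_mean u x r\<close>.\<close>

definition bump_flux :: "('n \<Rightarrow> real^'n \<Rightarrow> real) \<Rightarrow> real^'n \<Rightarrow> real \<Rightarrow> real" where
  "bump_flux w x r = (LBINT z. bump z * (\<Sum>i\<in>UNIV. z $ i * w i (x + r *\<^sub>R z)))"

lemma smooth_affine_continuous: "smooth f \<Longrightarrow> continuous_on UNIV (\<lambda>z. f (x + r *\<^sub>R z))"
  by (rule continuous_on_compose2[OF smooth_continuous_on[of f UNIV]]) (auto intro!: continuous_intros)

text \<open>The divergence of \<open>bump_pot z\<close> times g at \<open>x + r *\<^sub>R z\<close>
  integrates to 0. Since div g = 0, only the gradient of \<open>bump_pot\<close> contributes, and
  this is minus the integrand of the flux.\<close>

lemma bump_flux_eq_0:
  fixes g :: "'n::finite \<Rightarrow> real^'n \<Rightarrow> real"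
  assumes "\<And>i. smooth (g i)" and div: "\<And>x. (\<Sum>i\<in>UNIV. pd i (g i) x) = 0"
  shows "bump_flux g x r = 0"
proof -
  define G where "G i z = bump_pot z * (r * pd i (g i) (x + r *\<^sub>R z)) + - (bump z * z $ i) * g i (x + r *\<^sub>R z)" for i z
  have cG: "continuous_on UNIV (\<lambda>z. bump_pot z * g i (x + r *\<^sub>R z))" "continuous_on UNIV (G i)" for i
    unfolding G_def by (intro continuous_intros smooth_affine_continuous assms smooth_pd)+
  have dG: "((\<lambda>t. bump_pot (z + t *\<^sub>R axis i 1) * g i (x + r *\<^sub>R (z + t *\<^sub>R axis i 1))) has_real_derivative G i z) (at 0)" for i z
    using DERIV_mult[OF bump_pot_deriv[of z i] line_derivative_scaled[OF assms(1)[of i], of x r z i]]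
    by (simp add: G_def mult_ac)
  have sG: "bump_pot z * g i (x + r *\<^sub>R z) = 0" if "norm z > 1" for z i
    using that by (simp add: bump_eq_0)
  note 1 = integral_directional_derivative_eq_0[OF cG sG dG]
  have "0 = (LBINT z. (\<Sum>i\<in>UNIV. G i z))"
    using 1 by (subst Bochner_Integration.integral_sum) auto
  also have "(\<lambda>z. \<Sum>i\<in>UNIV. G i z) = (\<lambda>z. - (bump z * (\<Sum>i\<in>UNIV. z $ i * g i (x + r *\<^sub>R z))))"
  proof
    fix z
    have "(\<Sum>i\<in>UNIV. G i z) = bump_pot z * (r * (\<Sum>i\<in>UNIV. pd i (g i) (x + r *\<^sub>R z)))
        - (bump z * (\<Sum>i\<in>UNIV. z $ i * g i (x + r *\<^sub>R z)))"
      unfolding G_def sum.distrib by (simp add: sum_distrib_left sum_negf mult_ac)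
    then show "(\<Sum>i\<in>UNIV. G i z) = - (bump z * (\<Sum>i\<in>UNIV. z $ i * g i (x + r *\<^sub>R z)))" by (simp add: div)
  qed
  finally show ?thesis by (simp add: bump_flux_def)
qed

text \<open>The box contains the support of \<open>bump\<close>. As a gauge integral over a compact
  box the average falls under \<open>leibniz_rule_field_derivative\<close>, used in
  \<open>bump_average_deriv\<close>.\<close>

lemma bump_integral_eq_cbox:
  fixes f :: "real^'n \<Rightarrow> real"
  assumes "continuous_on UNIV f"
  shows "(LBINT z. bump z * f z) = integral (cbox (- One) One) (\<lambda>z. bump z * f z)"
    and "integrable lborel (\<lambda>z. bump z * f z)"
proof -
  show int: "integrable lborel (\<lambda>z. bump z * f z)"
    by (rule integrable_continuous_support[of _ 1]) (auto intro!: continuous_intros assms simp: bump_eq_0)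
  have "z \<in> cbox (- One) One" if "norm z < 1" for z :: "real^'n"
    using that Basis_le_norm[of _ z] by (force simp: mem_box)
  then have "integral UNIV (\<lambda>z. bump z * f z) = integral (cbox (- One) One) (\<lambda>z. bump z * f z)"
    using bump_eq_0(1) by (subst integral_restrict_UNIV[symmetric], intro integral_cong) (force simp: not_less[symmetric])
  then show "(LBINT z. bump z * f z) = integral (cbox (- One) One) (\<lambda>z. bump z * f z)"
    using integral_lborel[OF int] by simp
qed

text \<open>The general line \<open>A z + t *\<^sub>R L z\<close> covers both uses: dilation about a
  centre, with \<open>A z = x\<close> and \<open>L z = z\<close>, and motion of the centre, with
  \<open>A z = y + R *\<^sub>R z\<close> and \<open>L z = x - y\<close> in
  \<open>head_mean_shift\<close>.\<close>

lemma bump_average_deriv: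
  fixes u :: "real^'n \<Rightarrow> real" and A L :: "real^'n \<Rightarrow> real^'n"
  assumes u: "smooth u" and A: "continuous_on UNIV A" "continuous_on UNIV L"
  shows "((\<lambda>t. LBINT z. bump z * u (A z + t *\<^sub>R L z)) has_real_derivative
    (LBINT z. bump z * (\<Sum>i\<in>UNIV. L z $ i * pd i u (A z + t *\<^sub>R L z)))) (at t)"
proof -
  have c: "continuous_on UNIV (\<lambda>z. f (A z + t *\<^sub>R L z))" if "smooth f" for f :: "real^'n \<Rightarrow> real" and t
    by (intro continuous_on_compose2[OF smooth_continuous_on[OF that, of UNIV]] continuous_intros A) auto
  have A2: "continuous_on T (\<lambda>x. A (snd x))" "continuous_on T (\<lambda>x. L (snd x))" for T :: "(real \<times> (real^'n)) set"
    by (intro continuous_on_compose2[OF A(1)] continuous_on_compose2[OF A(2)] continuous_intros; simp)+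
  have c2: "continuous_on T (\<lambda>x. f (A (snd x) + fst x *\<^sub>R L (snd x)))" if "smooth f" for f :: "real^'n \<Rightarrow> real" and T
    by (intro continuous_on_compose2[OF smooth_continuous_on[OF that, of UNIV]] continuous_intros A2) auto
  have "((\<lambda>t. integral (cbox (- One) One) (\<lambda>z. bump z * u (A z + t *\<^sub>R L z))) has_field_derivative
     integral (cbox (- One) One) (\<lambda>z. bump z * (\<Sum>i\<in>UNIV. L z $ i * pd i u (A z + t *\<^sub>R L z)))) (at t within UNIV)"
  proof (rule leibniz_rule_field_derivative)
    show "((\<lambda>t. bump z * u (A z + t *\<^sub>R L z)) has_real_derivative
       bump z * (\<Sum>i\<in>UNIV. L z $ i * pd i u (A z + t *\<^sub>R L z))) (at t within UNIV)" for t z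
      by (intro DERIV_cmult line_derivative u)
    show "(\<lambda>z. bump z * u (A z + t *\<^sub>R L z)) integrable_on cbox (- One) One" for t
      by (intro integrable_continuous continuous_intros continuous_on_subset[OF c[OF u]]) auto
    show "continuous_on (UNIV \<times> cbox (- One) One)
       (\<lambda>(t, z). bump z * (\<Sum>i\<in>UNIV. L z $ i * pd i u (A z + t *\<^sub>R L z)))"
      unfolding split_beta
      by (intro continuous_intros c2 u A2 smooth_pd continuous_on_compose2[OF continuous_bump(1)[of UNIV]]) auto
  qed auto
  moreover have "continuous_on UNIV (\<lambda>z. \<Sum>i\<in>UNIV. L z $ i * pd i u (A z + t *\<^sub>R L z))"
    by (intro continuous_intros c u A smooth_pd)
  ultimately show ?thesis
    by (simp add: bump_integral_eq_cbox c[OF u])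
qed

section \<open>Means over balls and their radial derivatives\<close>

definition bump_mean :: "(real^'n \<Rightarrow> real) \<Rightarrow> real^'n \<Rightarrow> real \<Rightarrow> real" where
  "bump_mean u x r = (LBINT z. bump z * u (x + r *\<^sub>R z))"

text \<open>Like \<open>bump_mean\<close>, this is not normalised: a constant is multiplied by the
  mass of the weight. Integrating over the fixed unit ball makes radius 0 legitimate, where
  \<open>bump_mean\<close> returns a multiple of the value at the centre.\<close>

definition ball_mean :: "(real^'n \<Rightarrow> real) \<Rightarrow> real^'n \<Rightarrow> real \<Rightarrow> real" where
  "ball_mean f x r = (LBINT z. indicator (cball 0 1) z * f (x + r *\<^sub>R z))"

lemma ball_mean_integrable:
  fixes f :: "real^'n \<Rightarrow> real"
  assumes "continuous_on UNIV f"
  shows "integrable lborel (\<lambda>z. indicator (cball 0 1) z * f (x + r *\<^sub>R z))"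
proof -
  have "continuous_on UNIV (\<lambda>z. f (x + r *\<^sub>R z))"
    by (intro continuous_on_compose2[OF assms] continuous_intros) auto
  then show ?thesis
    using borel_integrable_compact[of "cball 0 1" "\<lambda>z. f (x + r *\<^sub>R z)"]
    by (auto intro: continuous_on_subset)
qed

lemma bump_integral_le_ball_mean:
  fixes f g :: "real^'n \<Rightarrow> real"
  assumes "continuous_on UNIV f" "continuous_on UNIV g"
    and "\<And>z. norm z \<le> 1 \<Longrightarrow> \<bar>f z\<bar> \<le> g (x + r *\<^sub>R z)"
  shows "\<bar>LBINT z. bump z * f z\<bar> \<le> ball_mean g x r"
proof -
  have "\<bar>LBINT z. bump z * f z\<bar> \<le> (LBINT z. \<bar>bump z * f z\<bar>)" by (rule integral_abs_bound)
  also have "\<dots> \<le> ball_mean g x r" unfolding ball_mean_def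
  proof (rule integral_mono)
    show "integrable lborel (\<lambda>z. \<bar>bump z * f z\<bar>)"
      by (intro integrable_abs bump_integral_eq_cbox assms)
    show "integrable lborel (\<lambda>z. indicator (cball 0 1) z * g (x + r *\<^sub>R z))"
      by (rule ball_mean_integrable[OF assms(2)])
    fix z :: "real^'n"
    have "bump z * \<bar>f z\<bar> \<le> 1 * g (x + r *\<^sub>R z)" if "norm z \<le> 1"
      using assms(3)[OF that] bump_bounds[of z] by (intro mult_mono) auto
    then show "\<bar>bump z * f z\<bar> \<le> indicator (cball 0 1) z * g (x + r *\<^sub>R z)"
      using bump_bounds[of z] by (cases "norm z \<le> 1") (auto simp: abs_mult bump_eq_0)
  qed
  finally show ?thesis .
qed

text \<open>This takes the place of a representation formula: the value \<open>u x\<close> is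
  reached from a mean at radius \<open>R\<close> by integrating the fluxes of w over the radii from
  0 to \<open>R\<close>.\<close>

lemma bump_mean_deriv:
  fixes u :: "real^'n \<Rightarrow> real"
  assumes u: "smooth u" and w: "\<And>i. smooth (w i)"
    and div: "\<And>x. (\<Sum>i\<in>UNIV. pd i (\<lambda>y. pd i u y - w i y) x) = 0"
  shows "(bump_mean u x has_real_derivative bump_flux w x r) (at r)"
proof -
  have 1: "(bump_mean u x has_real_derivative bump_flux (\<lambda>i. pd i u) x r) (at r)"
    unfolding bump_mean_def[abs_def] bump_flux_def
    using bump_average_deriv[OF u, of "\<lambda>z. x" "\<lambda>z. z"] by (simp add: continuous_intros)
  have "bump_flux (\<lambda>i y. pd i u y - w i y) x r = 0"
    by (rule bump_flux_eq_0) (auto intro!: smooth_diff smooth_pd u w div)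
  moreover have int: "integrable lborel (\<lambda>z. bump z * (\<Sum>i\<in>UNIV. z $ i * f i (x + r *\<^sub>R z)))" if "\<And>i. smooth (f i)" for f :: "'n \<Rightarrow> real^'n \<Rightarrow> real"
    by (intro bump_integral_eq_cbox continuous_intros smooth_affine_continuous that)
  ultimately show ?thesis
    using 1 Bochner_Integration.integral_diff[OF int[of "\<lambda>i. pd i u"] int[of w]] u w
    by (simp add: bump_flux_def right_diff_distrib sum_subtractf smooth_pd)
qed

lemma bump_mean_flux_bound:
  fixes w :: "'n::finite \<Rightarrow> real^'n \<Rightarrow> real"
  assumes w: "\<And>i. smooth (w i)" and g: "continuous_on UNIV g" "\<And>i x. \<bar>w i x\<bar> \<le> g x"
  shows "\<bar>bump_flux w x r\<bar> \<le> real CARD('n) * ball_mean g x r"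
proof -
  have "\<bar>bump_flux w x r\<bar> \<le> ball_mean (\<lambda>x. real CARD('n) * g x) x r"
    unfolding bump_flux_def
  proof (rule bump_integral_le_ball_mean)
    fix z :: "real^'n" assume z: "norm z \<le> 1"
    have "\<bar>\<Sum>i\<in>UNIV. z $ i * w i (x + r *\<^sub>R z)\<bar> \<le> (\<Sum>i\<in>UNIV. \<bar>z $ i * w i (x + r *\<^sub>R z)\<bar>)" by (rule sum_abs)
    also have "\<dots> \<le> (\<Sum>i\<in>(UNIV::'n set). 1 * g (x + r *\<^sub>R z))"
      unfolding abs_mult by (intro sum_mono mult_mono g) (use component_le_norm_cart[of z] z in \<open>auto intro: order_trans\<close>)
    finally show "\<bar>\<Sum>i\<in>UNIV. z $ i * w i (x + r *\<^sub>R z)\<bar> \<le> real CARD('n) * g (x + r *\<^sub>R z)" by simp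
  qed (intro continuous_intros smooth_affine_continuous w g)+
  also have "\<dots> = real CARD('n) * ball_mean g x r"
    by (simp add: ball_mean_def mult.left_commute)
  finally show ?thesis .
qed

text \<open>Both \<open>F - f\<close> and \<open>F + f\<close> are nondecreasing. An explicit
  antiderivative \<open>F\<close> stands in for the integral of the bound on
  \<open>f'\<close>.\<close>

lemma abs_diff_le_of_deriv_bound:
  fixes f F :: "real \<Rightarrow> real"
  assumes "a \<le> b"
    and "\<And>r. a \<le> r \<Longrightarrow> r \<le> b \<Longrightarrow> (f has_real_derivative f' r) (at r)"
    and "\<And>r. a \<le> r \<Longrightarrow> r \<le> b \<Longrightarrow> (F has_real_derivative F' r) (at r)"
    and "\<And>r. a \<le> r \<Longrightarrow> r \<le> b \<Longrightarrow> \<bar>f' r\<bar> \<le> F' r"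
  shows "\<bar>f b - f a\<bar> \<le> F b - F a"
proof -
  have "(\<lambda>r. F r - f r) a \<le> (\<lambda>r. F r - f r) b"
    by (rule DERIV_nonneg_imp_nondecreasing[OF assms(1)]) (use assms in \<open>fastforce intro!: derivative_eq_intros\<close>)
  moreover have "(\<lambda>r. F r + f r) a \<le> (\<lambda>r. F r + f r) b"
    by (rule DERIV_nonneg_imp_nondecreasing[OF assms(1)]) (use assms in \<open>fastforce intro!: derivative_eq_intros\<close>)
  ultimately show ?thesis by simp
qed

section \<open>Weak type bounds and convolutions\<close>

lemma weak_Lq_emeasure_bound:
  fixes f :: "'a::euclidean_space \<Rightarrow> 'b::real_normed_vector"
  assumes "f \<in> weak_Lq q UNIV" "q > 0"
  obtains K where "K \<ge> 0"
    "\<And>l. l > 0 \<Longrightarrow> emeasure lebesgue {x. norm (f x) > l} \<le> ennreal (K * l powr (- q))"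
proof -
  define N where "N = enn2real (weak_Lq_norm q UNIV f)"
  have N: "weak_Lq_norm q UNIV f = ennreal N" "N \<ge> 0"
    using assms(1) by (auto simp: weak_Lq_def N_def less_top)
  have "emeasure lebesgue {x. norm (f x) > l} \<le> ennreal (N powr q * l powr (- q))" if l: "l > 0" for l
  proof -
    define m where "m = emeasure lebesgue {x. norm (f x) > l}"
    have le: "ennreal l * ennreal_pos_powr m (1 / q) \<le> ennreal N"
      unfolding N(1)[symmetric] weak_Lq_norm_def m_def
      using l by (intro SUP_upper2[of l]) auto
    \<comment> \<open>A superlevel set of infinite measure would make the quasinorm infinite, by the
      convention in \<open>ennreal_pos_powr\<close>.\<close>
    have "m \<noteq> \<infinity>"
    proof
      assume "m = \<infinity>"
      then have "ennreal l * \<infinity> \<le> ennreal N" using le by (simp add: ennreal_pos_powr_def)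
      then show False using l by (simp add: ennreal_mult_top top_unique)
    qed
    then obtain a where a: "m = ennreal a" "a \<ge> 0" by (cases m) auto
    have "ennreal (l * a powr (1/q)) \<le> ennreal N"
      using le a l by (simp add: ennreal_pos_powr_def ennreal_mult)
    then have "l * a powr (1/q) \<le> N" using N(2) by simp
    then have "a powr (1/q) \<le> N / l" using l by (simp add: field_simps)
    then have "(a powr (1/q)) powr q \<le> (N / l) powr q"
      using assms(2) by (intro powr_mono2) auto
    then have "a \<le> N powr q * l powr (- q)"
      using assms(2) a l N by (simp add: powr_powr powr_divide powr_minus_divide)
    then show ?thesis using a by (simp add: m_def ennreal_leI)
  qed
  then show ?thesis using that[of "N powr q"] by simp
qed

text \<open>Layer-cake summation: \<open>F\<close> is at most the sum of \<open>a j\<close> times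
  the indicator of \<open>{x. g x > b j}\<close>, and the weak bound is applied to each
  layer.\<close>

lemma integrable_of_weak_type:
  fixes g F :: "'a::euclidean_space \<Rightarrow> real"
  assumes [measurable]: "F \<in> borel_measurable borel" "g \<in> borel_measurable borel"
    and F: "\<And>x. F x \<ge> 0" and K: "K \<ge> 0"
    and weak: "\<And>l. l > 0 \<Longrightarrow> emeasure lborel {x. g x > l} \<le> ennreal (K * l powr (- p))"
    and ab: "\<And>j. a j \<ge> 0" "\<And>j. b j > 0" and sum: "summable (\<lambda>j::nat. a j * b j powr (- p))"
    and dom: "\<And>x. F x \<noteq> 0 \<Longrightarrow> \<exists>j. F x \<le> a j \<and> g x > b j"
  shows "integrable lborel F"
proof (rule integrableI_nonneg)
  have "(\<integral>\<^sup>+x. ennreal (F x) \<partial>lborel) \<le> (\<integral>\<^sup>+x. (\<Sum>j. ennreal (a j) * indicator {x. g x > b j} x) \<partial>lborel)"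
  proof (rule nn_integral_mono)
    fix x
    show "ennreal (F x) \<le> (\<Sum>j. ennreal (a j) * indicator {x. g x > b j} x)"
    proof (cases "F x = 0")
      case False
      then obtain j where j: "F x \<le> a j" "g x > b j" using dom by blast
      have "ennreal (F x) \<le> (\<Sum>j\<in>{j}. ennreal (a j) * indicator {x. g x > b j} x)"
        using j by (simp add: ennreal_leI)
      also have "\<dots> \<le> (\<Sum>j. ennreal (a j) * indicator {x. g x > b j} x)"
        by (rule sum_le_suminf) auto
      finally show ?thesis .
    qed simp
  qed
  also have "\<dots> = (\<Sum>j. ennreal (a j) * emeasure lborel {x. g x > b j})"
    by (subst nn_integral_suminf) (auto simp: nn_integral_cmult_indicator)
  also have "\<dots> \<le> (\<Sum>j. ennreal (K * (a j * b j powr (- p))))"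
  proof (rule suminf_le)
    fix j
    have "ennreal (a j) * emeasure lborel {x. g x > b j} \<le> ennreal (a j) * ennreal (K * b j powr (- p))"
      by (intro mult_left_mono weak ab) auto
    also have "\<dots> = ennreal (K * (a j * b j powr (- p)))"
      using ab K by (simp add: ennreal_mult[symmetric] mult_ac)
    finally show "ennreal (a j) * emeasure lborel {x. g x > b j} \<le> ennreal (K * (a j * b j powr (- p)))" .
  qed auto
  also have "\<dots> = ennreal (\<Sum>j. K * (a j * b j powr (- p)))"
    using ab K by (intro suminf_ennreal2 summable_mult sum) auto
  also have "\<dots> < \<infinity>" by simp
  finally show "(\<integral>\<^sup>+x. ennreal (F x) \<partial>lborel) < \<infinity>" .
qed (use F in auto)

lemma integrable_powr_of_weak_type:
  fixes g :: "'a::euclidean_space \<Rightarrow> real"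
  assumes [measurable]: "g \<in> borel_measurable borel"
    and g: "\<And>x. 0 \<le> g x" "\<And>x. g x \<le> W" and K: "K \<ge> 0"
    and weak: "\<And>l. l > 0 \<Longrightarrow> emeasure lborel {x. g x > l} \<le> ennreal (K * l powr (- p))"
    and pq: "p < q" "0 < q"
  shows "integrable lborel (\<lambda>x. g x powr q)"
proof (cases "W > 0")
  case False
  then have "(\<lambda>x. g x powr q) = (\<lambda>x. 0)" using g by (force simp: fun_eq_iff intro: antisym order_trans)
  then show ?thesis by simp
next
  case W: True
  \<comment> \<open>Layers obtained by halving the upper bound \<open>W\<close>: if
    \<open>g x\<close> lies in the interval from \<open>b j\<close> to \<open>2 * b j\<close>, its
    power is at most \<open>a j\<close>. The series is geometric with ratio
    \<open>(1/2) powr (q - p) < 1\<close>.\<close>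
  define a where "a j = (W * (1/2) ^ j) powr q" for j :: nat
  define b where "b j = W * (1/2) ^ Suc j" for j :: nat
  show ?thesis
  proof (rule integrable_of_weak_type[OF _ assms(1) _ K weak])
    show "a j \<ge> 0" "b j > 0" for j using W by (auto simp: a_def b_def)
    have pw: "((1/2::real) ^ j) powr s = ((1/2) powr s) ^ j" for j s
      by (simp add: powr_realpow[symmetric] powr_powr mult.commute)
    have "a j * b j powr (- p) = (W powr q * (W/2) powr (- p)) * ((1/2) powr (q - p)) ^ j" for j
    proof -
      have "a j = W powr q * ((1/2) powr q) ^ j" using W by (simp add: a_def powr_mult pw del: power_one_over)
      moreover have "b j = (W/2) * (1/2) ^ j" by (simp add: b_def)
      then have "b j powr (- p) = (W/2) powr (- p) * ((1/2) powr (- p)) ^ j"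
        using W by (simp only: powr_mult pw) 
      moreover have "(1/2::real) powr (q - p) = (1/2) powr q * (1/2) powr (- p)"
        by (simp flip: powr_add)
      ultimately show ?thesis by (simp add: power_mult_distrib)
    qed
    moreover have "(1/2::real) powr (q - p) < 1"
      using pq powr_less_mono'[of "1/2" 0 "q - p"] by simp
    ultimately show "summable (\<lambda>j. a j * b j powr (- p))"
      by (auto intro!: summable_mult summable_geometric)
    fix x assume "g x powr q \<noteq> 0"
    then have gx: "g x > 0" using g(1)[of x] by (auto simp: less_le)
    obtain n where n: "W * (1/2)^n < g x"
      using real_arch_pow_inv[of "g x / W" "1/2"] W gx by (auto simp: field_simps)
    define m where "m = (LEAST n. W * (1/2)^n < g x)"
    have m: "W * (1/2)^m < g x" unfolding m_def by (rule LeastI[of _ n]) (rule n)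
    then have "m \<noteq> 0" using g(2)[of x] by (intro notI) simp
    then obtain j where j: "m = Suc j" by (cases m) auto
    then have "\<not> W * (1/2)^j < g x" using not_less_Least[of j "\<lambda>n. W * (1/2)^n < g x"] m_def by auto
    then show "\<exists>j. g x powr q \<le> a j \<and> g x > b j"
      using m pq gx by (intro exI[of _ j]) (auto simp: j a_def b_def intro!: powr_mono2)
  qed auto
qed

text \<open>Doubling layers upwards from 1, with ratio \<open>2 powr (1 - p)\<close>. No upper bound
  on \<open>g\<close> enters, so this applies to the vorticity before it is known to be
  bounded.\<close>

lemma integrable_large_part_of_weak_type:
  fixes g :: "'a::euclidean_space \<Rightarrow> real"
  assumes [measurable]: "g \<in> borel_measurable borel"
    and K: "K \<ge> 0" and weak: "\<And>l. l > 0 \<Longrightarrow> emeasure lborel {x. g x > l} \<le> ennreal (K * l powr (- p))"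
    and p: "p > 1"
  shows "integrable lborel (\<lambda>x. g x * indicator {x. g x > 1} x)"
proof (rule integrable_of_weak_type[OF _ assms(1) _ K weak])
  define a where "a j = (2::real) ^ Suc j" for j
  define b where "b j = (2::real) ^ j" for j
  show "a j \<ge> 0" "b j > 0" for j by (auto simp: a_def b_def)
  have "a j * b j powr (- p) = 2 * (2 powr (1 - p)) ^ j" for j
  proof -
    have "(2::real) ^ j * (2 ^ j) powr (- p) = (2 powr (1 - p)) ^ j"
      by (simp add: powr_realpow[symmetric] powr_powr powr_add[symmetric] algebra_simps)
    then show ?thesis by (simp add: a_def b_def)
  qed
  moreover have "(2::real) powr (1 - p) < 1" using p powr_less_mono[of "1 - p" 0 2] by simp
  ultimately show "summable (\<lambda>j. a j * b j powr (- p))"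
    by (auto intro!: summable_mult summable_geometric)
  fix x assume "g x * indicator {x. g x > 1} x \<noteq> 0"
  then have gx: "g x > 1" by (auto simp: indicator_def split: if_splits)
  obtain n where n: "g x < 2 ^ n" using real_arch_pow[of 2 "g x"] by auto
  define m where "m = (LEAST n. g x \<le> 2 ^ n)"
  have m: "g x \<le> 2 ^ m" unfolding m_def by (rule LeastI[of _ n]) (use n in simp)
  then have "m \<noteq> 0" using gx by (intro notI) simp
  then obtain j where j: "m = Suc j" by (cases m) auto
  then have "\<not> g x \<le> 2 ^ j" using not_less_Least[of j "\<lambda>n. g x \<le> 2 ^ n"] m_def by auto
  then show "\<exists>j. g x * indicator {x. g x > 1} x \<le> a j \<and> g x > b j"
    using m gx by (intro exI[of _ j]) (auto simp: j a_def b_def)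
qed (auto simp: indicator_def)

text \<open>The Japanese bracket to the power \<open>- 2 * a\<close>, a bounded counterpart of the
  Riesz kernel |z| to the power \<open>- 2 * a\<close>.\<close>

definition japanese :: "real \<Rightarrow> 'a::euclidean_space \<Rightarrow> real" where
  "japanese a z = (1 + z \<bullet> z) powr (- a)"

lemma japanese_bounds: "0 < japanese a z" "0 \<le> a \<Longrightarrow> japanese a z \<le> 1"
proof -
  have "0 < 1 + z \<bullet> z" using inner_ge_zero[of z] by linarith
  then show "0 < japanese a z" by (simp add: japanese_def)
  show "0 \<le> a \<Longrightarrow> japanese a z \<le> 1"
    using powr_mono[of "- a" 0 "1 + z \<bullet> z"] \<open>0 < 1 + z \<bullet> z\<close> by (simp add: japanese_def split: if_splits)
qed

lemma continuous_japanese [continuous_intros]: "continuous_on S (japanese a)"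
  unfolding japanese_def
  by (intro continuous_intros ballI) (metis add_pos_nonneg inner_ge_zero less_irrefl zero_less_one)

lemma japanese_measurable [measurable]: "japanese a \<in> borel_measurable borel"
  by (rule borel_measurable_continuous_onI) (rule continuous_japanese)

lemma japanese_mult: "japanese a z * japanese b z = japanese (a + b) z"
  by (simp add: japanese_def flip: powr_add)

lemma japanese_powr: "japanese a z powr b = japanese (a * b) z"
  by (simp add: japanese_def powr_powr)

text \<open>Superlevel sets lie in balls, which gives a weak bound with exponent
  \<open>DIM('a) / (2 * a)\<close>. As this is below 1, the first power of the bounded kernel is
  integrable.\<close>

lemma integrable_japanese:
  fixes a :: real
  assumes a: "2 * a > real DIM('a::euclidean_space)"
  shows "integrable lborel (japanese a :: 'a \<Rightarrow> real)"
proof -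
  have a0: "a > 0" using a by (smt (verit) of_nat_0_le_iff)
  define K where "K = unit_ball_vol (DIM('a))"
  have K: "K \<ge> 0" by (simp add: K_def)
  have "integrable lborel (\<lambda>x::'a. japanese a x powr 1)"
  proof (rule integrable_powr_of_weak_type[OF _ _ _ K])
    show "0 \<le> japanese a x" "japanese a x \<le> 1" for x :: 'a
      using japanese_bounds[of a x] a0 by auto
    fix l :: real assume l: "l > 0"
    define r where "r = l powr (- 1 / (2 * a))"
    have r: "r > 0" using l by (simp add: r_def)
    have "{x::'a. japanese a x > l} \<subseteq> ball 0 r"
    proof
      fix x :: 'a assume "x \<in> {x. japanese a x > l}"
      then have "(1 + x \<bullet> x) powr (- a) > l" by (simp add: japanese_def)
      then have "((1 + x \<bullet> x) powr (- a)) powr (- 1 / a) < l powr (- 1 / a)"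
        using a0 l by (intro powr_less_mono2_neg) auto
      moreover have "((1 + x \<bullet> x) powr (- a)) powr (- 1 / a) = 1 + x \<bullet> x"
        using a0 by (simp add: powr_powr add_nonneg_nonneg)
      moreover have "l powr (- 1 / a) = r ^ 2"
        using l a0 by (simp add: r_def power2_eq_square flip: powr_add)
      ultimately have "(norm x) ^ 2 < r ^ 2" by (simp add: dot_square_norm)
      then show "x \<in> ball 0 r" using r by (simp add: power_less_imp_less_base)
    qed
    then have "emeasure lborel {x::'a. japanese a x > l} \<le> emeasure lborel (ball (0::'a) r)"
      by (intro emeasure_mono) auto
    also have "\<dots> = ennreal (K * r ^ DIM('a))"
      using r by (simp add: emeasure_ball K_def)
    also have "r ^ DIM('a) = l powr (- (DIM('a) / (2 * a)))"
      using l by (simp add: r_def powr_realpow[symmetric] powr_powr)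
    finally show "emeasure lborel {x::'a. japanese a x > l} \<le> ennreal (K * l powr (- (DIM('a) / (2 * a))))" .
  qed (use a a0 in auto)
  moreover have "(\<lambda>x::'a. japanese a x powr 1) = japanese a"
    using japanese_bounds(1)[of a] by (simp add: fun_eq_iff abs_of_pos[OF japanese_bounds(1)])
  ultimately show ?thesis by simp
qed

text \<open>Hoelder's inequality up to the factor 2. Comparing f with a threshold t gives f <= t +
  t^(1 - c) f^c; this is integrated against \<open>w\<close> and then t is chosen.\<close>

lemma powr_jensen:
  fixes f w :: "'a \<Rightarrow> real"
  assumes int: "integrable M w" "integrable M (\<lambda>x. w x * f x)" "integrable M (\<lambda>x. w x * f x powr c)"
    and nonneg: "\<And>x. w x \<ge> 0" "\<And>x. f x \<ge> 0" and c: "c > 1"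
  shows "(\<integral>x. w x * f x \<partial>M) \<le> 2 * (\<integral>x. w x \<partial>M) powr (1 - 1 / c) * (\<integral>x. w x * f x powr c \<partial>M) powr (1 / c)"
proof -
  define m where "m = (\<integral>x. w x \<partial>M)"
  define J where "J = (\<integral>x. w x * f x powr c \<partial>M)"
  have m: "m \<ge> 0" and J: "J \<ge> 0" unfolding m_def J_def
    by (intro Bochner_Integration.integral_nonneg mult_nonneg_nonneg nonneg; simp)+
  have t: "(\<integral>x. w x * f x \<partial>M) \<le> t * m + t powr (1 - c) * J" if t: "t > 0" for t
  proof -
    have "f x \<le> t + t powr (1 - c) * f x powr c" for x
    proof (cases "f x \<le> t")
      case True
      then show ?thesis by (simp add: add_increasing2)
    next
      case False
      then have "f x powr (1 - c) \<le> t powr (1 - c)" using t c by (intro powr_mono2') auto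
      then have "f x powr (1 - c) * f x powr c \<le> t powr (1 - c) * f x powr c"
        by (rule mult_right_mono) auto
      then have "f x \<le> t powr (1 - c) * f x powr c" using False t by (simp flip: powr_add)
      then show ?thesis using t by simp
    qed
    from mult_left_mono[OF this nonneg(1)]
    have "(\<integral>x. w x * f x \<partial>M) \<le> (\<integral>x. t * w x + t powr (1 - c) * (w x * f x powr c) \<partial>M)"
      by (intro integral_mono int Bochner_Integration.integrable_add integrable_mult_right) (simp add: algebra_simps)
    also have "\<dots> = t * m + t powr (1 - c) * J" using int by (simp add: m_def J_def)
    finally show ?thesis .
  qed
  consider "m = 0" | "m > 0" "J = 0" | "m > 0" "J > 0" using m J by linarith
  then show ?thesis
  proof cases
    case 1
    have "AE x in M. w x = 0" using 1 integral_nonneg_eq_0_iff_AE[OF int(1)] nonneg by (simp add: m_def)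
    then have "(\<integral>x. w x * f x \<partial>M) = (\<integral>x. 0 \<partial>M)"
      by (intro integral_cong_AE) (use int in \<open>auto elim: eventually_mono dest: borel_measurable_integrable\<close>)
    then show ?thesis by simp
  next
    case 2
    have "(\<integral>x. w x * f x \<partial>M) \<le> e" if "e > 0" for e
      using t[of "e / m"] 2 that by simp
    then have "(\<integral>x. w x * f x \<partial>M) \<le> 0" by (rule dense_ge)
    then show ?thesis using 2 by (simp add: J_def)
  next
    case 3
    \<comment> \<open>This threshold makes the two terms equal, whence the factor 2.\<close>
    define s where "s = (J / m) powr (1 / c)"
    have s: "s > 0" using 3 by (simp add: s_def)
    have "s * m = m powr (1 - 1/c) * J powr (1/c)"
      using 3 by (simp add: s_def powr_divide powr_diff[of m])
    moreover have "s powr (1 - c) * J = m powr (1 - 1/c) * J powr (1/c)"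
    proof -
      have "s powr (1 - c) = (J / m) powr (1/c - 1)"
        using c by (simp add: s_def powr_powr diff_divide_distrib)
      then show ?thesis using 3 by (simp add: powr_divide powr_diff[of m] powr_diff[of J])
    qed
    ultimately show ?thesis using t[OF s] by (simp add: m_def J_def)
  qed
qed

lemma lborel_integral_affine:
  fixes f :: "'a::euclidean_space \<Rightarrow> real"
  assumes [measurable]: "f \<in> borel_measurable borel" and c: "c > 0"
  shows "(LBINT z. f (t + c *\<^sub>R z)) = (LBINT x. f x) / c ^ DIM('a)"
proof -
  have "(LBINT x. f x) = (\<integral>x. f x \<partial>density (distr lborel borel (\<lambda>x. t + c *\<^sub>R x)) (\<lambda>_. ennreal (\<bar>c\<bar> ^ DIM('a))))"
    using lborel_affine[of c t] c by simp
  also have "\<dots> = \<bar>c\<bar> ^ DIM('a) * (LBINT z. f (t + c *\<^sub>R z))"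
    by (subst integral_density) (auto simp: integral_distr)
  finally show ?thesis using c by (simp add: field_simps)
qed

lemma ball_mean_eq:
  fixes f :: "real^'n \<Rightarrow> real"
  assumes f: "continuous_on UNIV f" and r: "r > 0"
  shows "ball_mean f x r = (LBINT y. indicator (cball x r) y * f y) / r ^ CARD('n)"
proof -
  have fm: "f \<in> borel_measurable borel" using f by (rule borel_measurable_continuous_onI)
  have "(\<lambda>z. indicator (cball 0 1) z * f (x + r *\<^sub>R z)) = (\<lambda>z. indicator (cball x r) (x + r *\<^sub>R z) * f (x + r *\<^sub>R z))"
    using r by (auto simp: indicator_def dist_norm fun_eq_iff)
  moreover have m: "(\<lambda>y. indicator (cball x r) y * f y) \<in> borel_measurable borel"
    by (intro borel_measurable_times borel_measurable_indicator fm) auto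
  ultimately show ?thesis
    using lborel_integral_affine[OF m r, of x] by (simp add: ball_mean_def)
qed

lemma integrable_indicator_cball:
  fixes f :: "'a::euclidean_space \<Rightarrow> real"
  assumes "continuous_on UNIV f"
  shows "integrable lborel (\<lambda>y. indicator (cball x r) y * f y)"
  using borel_integrable_compact[of "cball x r" f] assms by (auto intro: continuous_on_subset)

lemma ball_mean_mono:
  fixes f g :: "real^'n \<Rightarrow> real"
  assumes "continuous_on UNIV f" "continuous_on UNIV g"
    and "\<And>y. dist x y \<le> \<bar>r\<bar> \<Longrightarrow> f y \<le> g y"
  shows "ball_mean f x r \<le> ball_mean g x r"
  unfolding ball_mean_def
proof (intro integral_mono ball_mean_integrable assms(1,2))
  fix z :: "real^'n"
  have "dist x (x + r *\<^sub>R z) \<le> \<bar>r\<bar>" if "norm z \<le> 1"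
    using that mult_left_mono[of "norm z" 1 "\<bar>r\<bar>"] by (simp add: dist_norm)
  then show "indicator (cball 0 1) z * f (x + r *\<^sub>R z) \<le> indicator (cball 0 1) z * g (x + r *\<^sub>R z)"
    using assms(3) by (auto simp: indicator_def)
qed

lemma ball_mean_const: "ball_mean (\<lambda>y::real^'n. c) x r = c * unit_ball_vol CARD('n)"
  unfolding ball_mean_def by (simp add: content_cball mult.commute)

lemma ball_mean_cmult: "ball_mean (\<lambda>y::real^'n. c * f y) x r = c * ball_mean f x r"
  unfolding ball_mean_def by (simp add: mult.left_commute)

lemma ball_mean_nonneg: "(\<And>y. f y \<ge> 0) \<Longrightarrow> 0 \<le> ball_mean f x r"
  unfolding ball_mean_def by (intro Bochner_Integration.integral_nonneg) (simp add: indicator_def)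

lemma ball_mean_powr_le:
  fixes f :: "real^'n \<Rightarrow> real"
  assumes f: "continuous_on UNIV f" "\<And>y. f y \<ge> 0" and c: "c > 1"
  shows "ball_mean f x r \<le> 2 * unit_ball_vol CARD('n) powr (1 - 1 / c) * ball_mean (\<lambda>y. f y powr c) x r powr (1 / c)"
proof -
  have cc: "continuous_on UNIV (\<lambda>y. f y powr c)"
    using f c by (intro continuous_on_powr' continuous_intros) auto
  have "(LBINT z. indicator (cball 0 1) z * f (x + r *\<^sub>R z)) \<le>
    2 * (LBINT z. indicator (cball (0::real^'n) 1) z) powr (1 - 1 / c) *
      (LBINT z. indicator (cball 0 1) z * f (x + r *\<^sub>R z) powr c) powr (1 / c)"
    by (rule powr_jensen[OF _ ball_mean_integrable[OF f(1)] ball_mean_integrable[OF cc]])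
      (use f(2) c in \<open>auto simp: emeasure_cball\<close>)
  then show ?thesis by (simp add: ball_mean_def content_cball)
qed

section \<open>Convolution of an integrable function with a kernel\<close>

definition conv :: "('a::euclidean_space \<Rightarrow> real) \<Rightarrow> ('a \<Rightarrow> real) \<Rightarrow> 'a \<Rightarrow> real" where
  "conv w k x = (LBINT y. w y * k (x - y))"

lemma conv_integrand_integrable:
  fixes w k :: "'a::euclidean_space \<Rightarrow> real"
  assumes w: "integrable lborel w" and [measurable]: "k \<in> borel_measurable borel"
    and k: "\<And>z. \<bar>k z\<bar> \<le> B"
  shows "integrable lborel (\<lambda>y. w y * k (x - y))"
proof (rule Bochner_Integration.integrable_bound[of _ "\<lambda>y. B * w y"])
  show "AE y in lborel. norm (w y * k (x - y)) \<le> norm (B * w y)"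
  proof (rule AE_I2)
    fix y
    have "\<bar>k (x - y)\<bar> \<le> \<bar>B\<bar>" using k[of "x - y"] by linarith
    from mult_left_mono[OF this abs_ge_zero[of "w y"]]
    show "norm (w y * k (x - y)) \<le> norm (B * w y)" by (simp add: abs_mult mult.commute)
  qed
qed (use w in auto)

text \<open>Dominated convergence with majorant \<open>B * \<bar>w y\<bar>\<close>, the common
  source of continuity, decay and differentiability of convolutions below.\<close>

lemma conv_sequential_limit:
  fixes w k :: "'a::euclidean_space \<Rightarrow> real"
  assumes w: "integrable lborel w" and [measurable]: "\<And>n. f n \<in> borel_measurable borel" "g \<in> borel_measurable borel"
    and k: "\<And>n y. \<bar>f n y\<bar> \<le> B" and lim: "\<And>y. (\<lambda>n. f n y) \<longlonglongrightarrow> g y"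
  shows "(\<lambda>n. LBINT y. w y * f n y) \<longlonglongrightarrow> (LBINT y. w y * g y)"
proof (rule integral_dominated_convergence[of _ _ _ "\<lambda>y. B * \<bar>w y\<bar>"])
  have [measurable]: "w \<in> borel_measurable borel" using w by auto
  show "(\<lambda>y. w y * g y) \<in> borel_measurable lborel" by simp
  show "(\<lambda>y. w y * f n y) \<in> borel_measurable lborel" for n by simp
  show "integrable lborel (\<lambda>y. B * \<bar>w y\<bar>)" using w by simp
  show "AE y in lborel. (\<lambda>n. w y * f n y) \<longlonglongrightarrow> w y * g y"
    by (intro AE_I2 tendsto_intros lim)
  show "AE y in lborel. norm (w y * f n y) \<le> B * \<bar>w y\<bar>" for n
    using mult_left_mono[OF k abs_ge_zero[of "w _"]] by (intro AE_I2) (simp add: abs_mult mult.commute)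
qed

lemma continuous_conv:
  fixes w k :: "'a::euclidean_space \<Rightarrow> real"
  assumes w: "integrable lborel w" and kc: "continuous_on UNIV k" and k: "\<And>z. \<bar>k z\<bar> \<le> B"
  shows "continuous_on S (conv w k)"
proof -
  have [measurable]: "k \<in> borel_measurable borel" using kc by (rule borel_measurable_continuous_onI)
  have "continuous_on UNIV (conv w k)"
    unfolding continuous_on_sequentially
  proof (intro ballI allI impI, elim conjE)
    fix X :: "nat \<Rightarrow> 'a" and a
    assume X: "X \<longlonglongrightarrow> a"
    have "isCont k z" for z using kc by (simp add: continuous_on_eq_continuous_at)
    then show "(conv w k \<circ> X) \<longlonglongrightarrow> conv w k a"
      unfolding conv_def comp_def
      by (intro conv_sequential_limit[OF w _ _ k]) (auto intro!: isCont_tendsto_compose[where g=k] tendsto_intros X)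
  qed
  then show ?thesis by (rule continuous_on_subset) simp
qed

lemma conv_tendsto_0:
  fixes w k :: "'a::euclidean_space \<Rightarrow> real"
  assumes w: "integrable lborel w" and kc: "continuous_on UNIV k" and k: "\<And>z. \<bar>k z\<bar> \<le> B"
    and k0: "(k \<longlongrightarrow> 0) at_infinity"
  shows "(conv w k \<longlongrightarrow> 0) at_infinity"
proof (rule ccontr)
  have [measurable]: "k \<in> borel_measurable borel" using kc by (rule borel_measurable_continuous_onI)
  assume "\<not> ?thesis"
  then obtain e where e: "e > 0" "\<And>b. \<exists>x. norm x \<ge> b \<and> \<not> \<bar>conv w k x\<bar> < e"
    unfolding Lim_at_infinity by (auto simp: dist_real_def)
  then have "\<exists>X. \<forall>n::nat. norm (X n) \<ge> real n \<and> \<not> \<bar>conv w k (X n)\<bar> < e"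
    by (intro choice) blast
  then obtain X where X: "\<And>n::nat. norm (X n) \<ge> real n" "\<And>n. \<not> \<bar>conv w k (X n)\<bar> < e"
    by blast
  have inf: "filterlim (\<lambda>n. X n - y) at_infinity sequentially" for y
    unfolding filterlim_at_infinity_conv_norm_at_top
  proof (rule filterlim_at_top_mono)
    show "filterlim (\<lambda>n. real n - norm y) at_top sequentially"
      using filterlim_tendsto_add_at_top[OF tendsto_const[of "- norm y"] filterlim_real_sequentially] by simp
    show "\<forall>\<^sub>F n in sequentially. real n - norm y \<le> norm (X n - y)"
      using X(1) norm_triangle_ineq2[of "X _" y] by (intro always_eventually allI) (smt (verit))
  qed
  have "(\<lambda>n. LBINT y. w y * k (X n - y)) \<longlonglongrightarrow> (LBINT y. w y * 0)"
    by (intro conv_sequential_limit[OF w _ _ k] filterlim_compose[OF k0 inf]) auto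
  then have "(\<lambda>n. conv w k (X n)) \<longlonglongrightarrow> 0" by (simp add: conv_def)
  then have "\<forall>\<^sub>F n in sequentially. \<bar>conv w k (X n)\<bar> < e"
    using e(1) by (auto simp: tendsto_iff dist_real_def)
  then show False using X(2) by (auto simp: eventually_sequentially)
qed

lemma conv_directional_derivative:
  fixes w k k' :: "'a::euclidean_space \<Rightarrow> real"
  assumes w: "integrable lborel w" and kc: "continuous_on UNIV k" "continuous_on UNIV k'"
    and k: "\<And>z. \<bar>k z\<bar> \<le> B" and k': "\<And>z. \<bar>k' z\<bar> \<le> B'"
    and deriv: "\<And>z t. ((\<lambda>t. k (z + t *\<^sub>R e)) has_real_derivative k' (z + t *\<^sub>R e)) (at t)"
  shows "((\<lambda>t. conv w k (x + t *\<^sub>R e)) has_real_derivative conv w k' x) (at 0)"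
proof -
  have [measurable]: "k \<in> borel_measurable borel" "k' \<in> borel_measurable borel"
    using kc by (auto intro: borel_measurable_continuous_onI)
  have lip: "\<bar>(k (z + t *\<^sub>R e) - k z) / t\<bar> \<le> B'" if "t \<noteq> 0" for z t
  proof -
    have "\<exists>s. k (z + t *\<^sub>R e) - k (z + 0 *\<^sub>R e) = (t - 0) * k' (z + s *\<^sub>R e)"
    proof (cases "t > 0")
      case True
      then show ?thesis using MVT2[of 0 t "\<lambda>t. k (z + t *\<^sub>R e)", OF _ deriv] by blast
    next
      case False
      then obtain s where "k (z + 0 *\<^sub>R e) - k (z + t *\<^sub>R e) = (0 - t) * k' (z + s *\<^sub>R e)"
        using MVT2[of t 0 "\<lambda>t. k (z + t *\<^sub>R e)", OF _ deriv] \<open>t \<noteq> 0\<close> by force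
      then show ?thesis by (intro exI[of _ s]) (simp add: algebra_simps)
    qed
    then obtain s where "k (z + t *\<^sub>R e) - k z = t * k' (z + s *\<^sub>R e)" by auto
    then show ?thesis using k' that by simp
  qed
  have "((\<lambda>t. (conv w k (x + t *\<^sub>R e) - conv w k x) / t) \<longlongrightarrow> conv w k' x) (at 0)"
    unfolding tendsto_at_iff_sequentially
  proof (intro allI impI)
    fix T :: "nat \<Rightarrow> real" assume T0: "\<forall>n. T n \<in> UNIV - {0}" and T: "T \<longlonglongrightarrow> 0"
    then have T1: "filterlim T (at 0) sequentially" by (simp add: filterlim_at)
    have "(\<lambda>n. LBINT y. w y * ((k (x - y + T n *\<^sub>R e) - k (x - y)) / T n)) \<longlonglongrightarrow> (LBINT y. w y * k' (x - y))"
    proof (rule conv_sequential_limit[OF w])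
      show "\<bar>(k (x - y + T n *\<^sub>R e) - k (x - y)) / T n\<bar> \<le> B'" for n y
        using T0 by (intro lip) auto
      show "(\<lambda>n. (k (x - y + T n *\<^sub>R e) - k (x - y)) / T n) \<longlonglongrightarrow> k' (x - y)" for y
        using deriv[of "x - y" 0] by (intro filterlim_compose[OF _ T1]) (simp add: DERIV_def)
    qed auto
    moreover have "(LBINT y. w y * ((k (x - y + T n *\<^sub>R e) - k (x - y)) / T n))
        = (conv w k (x + T n *\<^sub>R e) - conv w k x) / T n" for n
    proof -
      have 1: "conv w k (x + T n *\<^sub>R e) - conv w k x = (LBINT y. w y * k (x + T n *\<^sub>R e - y) - w y * k (x - y))"
        unfolding conv_def by (subst Bochner_Integration.integral_diff) (auto intro!: conv_integrand_integrable[OF w _ k])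
      have 2: "(\<lambda>y. w y * ((k (x - y + T n *\<^sub>R e) - k (x - y)) / T n)) = (\<lambda>y. (w y * k (x + T n *\<^sub>R e - y) - w y * k (x - y)) / T n)"
        by (simp add: fun_eq_iff algebra_simps diff_divide_distrib)
      show ?thesis unfolding 1 2 by (rule integral_divide_zero)
    qed
    ultimately show "((\<lambda>t. (conv w k (x + t *\<^sub>R e) - conv w k x) / t) \<circ> T) \<longlonglongrightarrow> conv w k' x"
      by (simp only: conv_def[of w k'] comp_def)
  qed
  then show ?thesis by (simp add: DERIV_def)
qed

text \<open>Tonelli's theorem and translation invariance: Young's inequality for two integrable
  factors.\<close>

lemma integrable_conv:
  fixes w k :: "'a::euclidean_space \<Rightarrow> real"
  assumes w: "integrable lborel w" and k: "integrable lborel k"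
  shows "integrable lborel (conv w k)"
proof -
  have [measurable]: "w \<in> borel_measurable borel" "k \<in> borel_measurable borel" using w k by auto
  have shift: "(\<integral>\<^sup>+x. f (x - y) \<partial>lborel) = (\<integral>\<^sup>+x. f x \<partial>lborel)" if [measurable]: "f \<in> borel_measurable borel" for f :: "'a \<Rightarrow> ennreal" and y
  proof -
    have "(\<integral>\<^sup>+x. f x \<partial>lborel) = (\<integral>\<^sup>+x. f x \<partial>distr lborel borel ((+) (- y)))"
      by (simp add: lborel_distr_plus)
    also have "\<dots> = (\<integral>\<^sup>+x. f (- y + x) \<partial>lborel)" by (subst nn_integral_distr) auto
    finally show ?thesis by simp
  qed
  have "integrable (lborel \<Otimes>\<^sub>M lborel) (\<lambda>(x, y). w y * k (x - y))"
  proof (rule integrableI_bounded)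
    have "(\<integral>\<^sup>+z. ennreal (norm (case z of (x, y) \<Rightarrow> w y * k (x - y))) \<partial>(lborel \<Otimes>\<^sub>M lborel))
      = (\<integral>\<^sup>+y. (\<integral>\<^sup>+x. ennreal (norm (w y)) * ennreal (norm (k (x - y))) \<partial>lborel) \<partial>lborel)"
      by (subst lborel_pair.nn_integral_snd[symmetric]) (auto simp: abs_mult ennreal_mult)
    also have "\<dots> = (\<integral>\<^sup>+y. ennreal (norm (w y)) * (\<integral>\<^sup>+x. ennreal (norm (k x)) \<partial>lborel) \<partial>lborel)"
      by (simp add: nn_integral_cmult shift[of "\<lambda>x. ennreal (norm (k x))", simplified])
    also have "\<dots> = (\<integral>\<^sup>+y. ennreal (norm (w y)) \<partial>lborel) * (\<integral>\<^sup>+x. ennreal (norm (k x)) \<partial>lborel)"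
      by (simp add: nn_integral_multc)
    also have "\<dots> < \<infinity>" using w k by (simp add: integrable_iff_bounded ennreal_mult_less_top)
    finally show "(\<integral>\<^sup>+z. ennreal (norm (case z of (x, y) \<Rightarrow> w y * k (x - y))) \<partial>(lborel \<Otimes>\<^sub>M lborel)) < \<infinity>" .
  qed auto
  from lborel_pair.integrable_fst'[OF this] show ?thesis by (simp add: conv_def[abs_def])
qed

lemma conv_nonneg: "(\<And>y. w y \<ge> 0) \<Longrightarrow> (\<And>z. k z \<ge> 0) \<Longrightarrow> 0 \<le> conv w k x"
  unfolding conv_def by (intro Bochner_Integration.integral_nonneg mult_nonneg_nonneg)

section \<open>Pointwise bounds for the vorticity\<close>

lemma bump_integral_pos: "0 < (LBINT z. bump (z::real^'n))"
proof -
  have int: "integrable lborel (bump :: real^'n \<Rightarrow> real)"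
    using bump_integral_eq_cbox(2)[of "\<lambda>z::real^'n. 1"] by simp
  have "(LBINT z. indicator (cball 0 (1/2)) (z::real^'n) * (1/4::real)) \<le> (LBINT z. bump (z::real^'n))"
  proof (rule integral_mono[OF _ int])
    fix z :: "real^'n"
    show "indicator (cball 0 (1/2)) z * (1/4) \<le> bump z"
    proof (cases "norm z \<le> 1/2")
      case True
      then have "z \<bullet> z \<le> 1/4" using power_mono[of "norm z" "1/2" 2] by (simp add: dot_square_norm power2_eq_square)
      then have "(1/2)^2 \<le> max 0 (1 - z \<bullet> z)^2" by (intro power_mono) auto
      then show ?thesis using True by (simp add: bump_def power2_eq_square)
    qed (simp add: bump_bounds)
  qed (use integrable_indicator_cball[of "\<lambda>_. 1/4" "0::real^'n" "1/2"] in simp)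
  moreover have "0 < (LBINT z. indicator (cball 0 (1/2)) (z::real^'n) * (1/4::real))"
    by (simp add: content_cball)
  ultimately show ?thesis by linarith
qed

definition bump_mass :: "'n::finite itself \<Rightarrow> real" where
  "bump_mass _ = (LBINT z. bump (z::real^'n))"

lemma bump_mean_0: "bump_mean u x 0 = bump_mass TYPE('n) * u (x::real^'n)"
  by (simp add: bump_mean_def bump_mass_def)

lemma bump_mass_pos: "0 < bump_mass TYPE('n::finite)"
  by (simp add: bump_mass_def bump_integral_pos)

lemma abs_bump_mean_le:
  fixes u g :: "real^'n \<Rightarrow> real"
  assumes "continuous_on UNIV u" "continuous_on UNIV g" "\<And>y. \<bar>u y\<bar> \<le> g y"
  shows "\<bar>bump_mean u x r\<bar> \<le> ball_mean g x r"
  unfolding bump_mean_def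
  by (rule bump_integral_le_ball_mean)
    (auto intro!: continuous_on_compose2[OF assms(1)] continuous_intros assms)

text \<open>For every z other than 0 the points x + r z escape to infinity, so dominated convergence
  applies. This fixes the value at infinity from which \<open>V_tail\<close> starts.\<close>

lemma bump_mean_tendsto_0:
  fixes u :: "real^'n \<Rightarrow> real"
  assumes u: "continuous_on UNIV u" and b: "\<And>y. \<bar>u y\<bar> \<le> B" and lim: "(u \<longlongrightarrow> 0) at_infinity"
  shows "(bump_mean u x \<longlongrightarrow> 0) at_top"
proof -
  have um [measurable]: "u \<in> borel_measurable borel" using u by (rule borel_measurable_continuous_onI)
  have bm [measurable]: "bump \<in> borel_measurable (borel :: (real^'n) measure)"
    by (rule borel_measurable_continuous_onI) (rule continuous_bump)
  have int: "integrable lborel (bump :: real^'n \<Rightarrow> real)"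
    using bump_integral_eq_cbox(2)[of "\<lambda>z::real^'n. 1"] by simp
  have "((\<lambda>r. LBINT z. bump z * u (x + r *\<^sub>R z)) \<longlongrightarrow> (\<integral>z. (0::real) \<partial>(lborel :: (real^'n) measure))) at_top"
  proof (rule integral_dominated_convergence_at_top[where w="\<lambda>z. B * bump z"])
    show "\<forall>\<^sub>F r in at_top. AE z in lborel. norm (bump z * u (x + r *\<^sub>R z)) \<le> B * bump z"
      using b bump_bounds mult_left_mono[OF b bump_bounds(1)]
      by (intro always_eventually allI AE_I2) (simp add: abs_mult abs_of_nonneg[OF bump_bounds(1)] mult.commute)
    have "AE z in lborel. z \<noteq> (0::real^'n)" using AE_lborel_singleton by blast
    then show "AE z in lborel. ((\<lambda>r. bump z * u (x + r *\<^sub>R z)) \<longlongrightarrow> 0) at_top"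
    proof eventually_elim
      fix z :: "real^'n" assume z: "z \<noteq> 0"
      have "filterlim (\<lambda>r. x + r *\<^sub>R z) at_infinity at_top"
        unfolding filterlim_at_infinity_conv_norm_at_top
      proof (rule filterlim_at_top_mono)
        have "filterlim (\<lambda>r. norm z * r) at_top at_top"
          using z by (intro filterlim_tendsto_pos_mult_at_top[OF tendsto_const] filterlim_ident) auto
        then show "filterlim (\<lambda>r. - norm x + norm z * r) at_top at_top"
          by (rule filterlim_tendsto_add_at_top[OF tendsto_const])
        show "\<forall>\<^sub>F r in at_top. - norm x + norm z * r \<le> norm (x + r *\<^sub>R z)"
          using eventually_ge_at_top[of 0]
        proof eventually_elim
          case (elim r)
          then show ?case using norm_diff_ineq[of "r *\<^sub>R z" x] by (simp add: add.commute mult.commute)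
        qed
      qed
      then have "((\<lambda>r. u (x + r *\<^sub>R z)) \<longlongrightarrow> 0) at_top" by (rule filterlim_compose[OF lim])
      then show "((\<lambda>r. bump z * u (x + r *\<^sub>R z)) \<longlongrightarrow> 0) at_top" by (rule tendsto_mult_right_zero)
    qed
  qed (use int in simp_all)
  then show ?thesis by (simp add: bump_mean_def[abs_def])
qed

lemma ball_mean_le_ball_integral:
  fixes f :: "real^'n \<Rightarrow> real"
  assumes f: "continuous_on UNIV f" "\<And>y. f y \<ge> 0" and r: "r > 0" "s > 0" "dist x y + r \<le> s"
  shows "ball_mean f x r \<le> ball_mean f y s * s ^ CARD('n) / r ^ CARD('n)"
proof -
  have "(LBINT z. indicator (cball x r) z * f z) \<le> (LBINT z. indicator (cball y s) z * f z)"
  proof (intro integral_mono integrable_indicator_cball f)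
    fix z
    have "dist y z \<le> dist x y + dist x z" by metric
    then show "indicator (cball x r) z * f z \<le> indicator (cball y s) z * f z"
      using r f(2)[of z] by (auto simp: indicator_def)
  qed
  then show ?thesis using r by (simp add: ball_mean_eq f divide_right_mono)
qed

locale weak_vorticity_flow = stationary_navier_stokes +
  assumes decay: "(v \<longlongrightarrow> 0) at_infinity"
    and weak_curl: "curl v \<in> weak_Lq (9/5) UNIV"
begin

lemma continuous_v: "continuous_on S v"
  by (rule smooth_continuous_on[OF smooth_v])

lemma v_bounded: "\<exists>V0>0. \<forall>x. norm (v x) \<le> V0"
proof -
  obtain b where b: "\<And>x. norm x \<ge> b \<Longrightarrow> norm (v x) < 1"
    using decay unfolding Lim_at_infinity by (metis dist_0_norm dist_commute zero_less_one)
  have "bounded (v ` cball 0 b)"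
    by (intro compact_imp_bounded compact_continuous_image continuous_v) auto
  then obtain B where "\<forall>x\<in>cball 0 b. norm (v x) \<le> B"
    by (auto simp: bounded_iff)
  then have B: "norm (v x) \<le> B" if "norm x \<le> b" for x using that by simp
  have "norm (v x) \<le> max B 1" for x
    using b[of x] B[of x] by (cases "norm x \<le> b") auto
  then show ?thesis by (intro exI[of _ "max B 1"]) auto
qed

lemma rho_measurable [measurable]: "rho \<in> borel_measurable borel"
  by (rule borel_measurable_continuous_onI) (rule continuous_rho)

lemma rho_weak: "\<exists>K\<ge>0. \<forall>l>0. emeasure lborel {x. rho x > l} \<le> ennreal (K * l powr (- (9/5)))"
proof -
  obtain K where K: "K \<ge> 0" "\<And>l. l > 0 \<Longrightarrow> emeasure lebesgue {x. norm (curl v x) > l} \<le> ennreal (K * l powr (- (9/5)))"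
    using weak_Lq_emeasure_bound[OF weak_curl] by auto
  have "{x. rho x > l} \<in> sets lborel" for l by simp
  then have "emeasure lebesgue {x. rho x > l} = emeasure lborel {x. rho x > l}" for l
    by simp
  then show ?thesis using K by (auto simp: rho_def)
qed

text \<open>\<open>rho\<close> is at most 1 plus its part above level 1, and that part is integrable
  over the whole space because 9/5 > 1. Hence the bound does not depend on the centre.\<close>

lemma rho_ball_integral_bounded: "\<exists>C\<ge>0. \<forall>x. ball_mean rho x 1 \<le> C"
proof -
  obtain K where "K \<ge> 0" "\<forall>l>0. emeasure lborel {x. rho x > l} \<le> ennreal (K * l powr (- (9/5)))"
    using rho_weak by blast
  then have int: "integrable lborel (\<lambda>x. rho x * indicator {x. rho x > 1} x)"
    by (intro integrable_large_part_of_weak_type[of _ K "9/5"]) auto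
  define C where "C = unit_ball_vol 3 + (LBINT x. rho x * indicator {x. rho x > 1} x)"
  have "ball_mean rho x 1 \<le> C" for x
  proof -
    have i1: "integrable lborel (\<lambda>y. indicator (cball x 1) y * 1 :: real)"
      by (rule integrable_indicator_cball) simp
    have "ball_mean rho x 1 = (LBINT y. indicator (cball x 1) y * rho y)"
      by (subst ball_mean_eq) (simp_all add: continuous_rho)
    also have "\<dots> \<le> (LBINT y. indicator (cball x 1) y * 1 + rho y * indicator {x. rho x > 1} y)"
      by (intro integral_mono integrable_indicator_cball continuous_rho Bochner_Integration.integrable_add int i1)
        (auto simp: indicator_def rho_nonneg)
    also have "\<dots> = C" using i1 int by (simp add: C_def content_cball)
    finally show ?thesis .
  qed
  then show ?thesis
    by (intro exI[of _ C]) (auto simp: C_def intro!: add_nonneg_nonneg Bochner_Integration.integral_nonneg simp: rho_nonneg indicator_def)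
qed

text \<open>Radial integration of the vorticity equation. The flux is of size \<open>V0 * S\<close>,
  so the error carries a factor \<open>r\<close> and can be absorbed for small radii. Here 18 = 3 *
  6 comes from the dimension and \<open>abs_flux_Om_le\<close>, and 162 = 9 * 18 from the nine
  entries of \<open>Om\<close>.\<close>

lemma rho_mean_estimate:
  assumes V0: "\<And>x. norm (v x) \<le> V0" and r: "r > 0" and S: "\<And>y. dist x y \<le> r \<Longrightarrow> rho y \<le> S"
  shows "bump_mass TYPE(3) * rho x \<le> 9 * ball_mean rho x r + 162 * V0 * unit_ball_vol 3 * r * S"
proof -
  have S0: "S \<ge> 0" using S[of x] rho_nonneg[of x] r by simp
  have V00: "V0 \<ge> 0" using V0[of 0] norm_ge_zero[of "v 0"] by linarith
  have Om: "bump_mass TYPE(3) * \<bar>Om i j x\<bar> \<le> ball_mean rho x r + 18 * V0 * unit_ball_vol 3 * r * S" for i j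
  proof -
    have "\<bar>bump_mean (Om i j) x r - bump_mean (Om i j) x 0\<bar> \<le> (18 * V0 * unit_ball_vol 3 * S) * r - (18 * V0 * unit_ball_vol 3 * S) * 0"
    proof (rule abs_diff_le_of_deriv_bound)
      fix s assume s: "0 \<le> s" "s \<le> r"
      show "(bump_mean (Om i j) x has_real_derivative bump_flux (flux_Om i j) x s) (at s)"
        by (rule bump_mean_deriv[OF smooth_Om smooth_flux_Om laplace_Om])
      have "\<bar>bump_flux (flux_Om i j) x s\<bar> \<le> real CARD(3) * ball_mean (\<lambda>y. 6 * V0 * rho y) x s"
      proof (rule bump_mean_flux_bound[OF smooth_flux_Om])
        fix k y
        have "\<bar>flux_Om i j k y\<bar> \<le> 6 * (norm (v y) * rho y)" by (rule abs_flux_Om_le)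
        also have "\<dots> \<le> 6 * (V0 * rho y)"
          by (intro mult_left_mono mult_right_mono V0 rho_nonneg) auto
        finally show "\<bar>flux_Om i j k y\<bar> \<le> 6 * V0 * rho y" by simp
      qed (intro continuous_intros continuous_rho)
      also have "ball_mean (\<lambda>y. 6 * V0 * rho y) x s \<le> ball_mean (\<lambda>y. 6 * V0 * S) x s"
        by (intro ball_mean_mono continuous_intros continuous_rho mult_left_mono S) (use s V00 in auto)
      finally show "\<bar>bump_flux (flux_Om i j) x s\<bar> \<le> 18 * V0 * unit_ball_vol 3 * S"
        by (simp add: ball_mean_const mult_ac)
    qed (use r in \<open>auto intro!: derivative_eq_intros\<close>)
    moreover have "\<bar>bump_mean (Om i j) x r\<bar> \<le> ball_mean rho x r"
      by (intro abs_bump_mean_le smooth_continuous_on[OF smooth_Om] continuous_rho abs_Om_le)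
    moreover have "\<bar>bump_mean (Om i j) x 0\<bar> = bump_mass TYPE(3) * \<bar>Om i j x\<bar>"
      using bump_mass_pos[where 'n=3] by (simp add: bump_mean_0 abs_mult)
    ultimately show ?thesis by (simp add: mult_ac)
  qed
  have "bump_mass TYPE(3) * rho x \<le> bump_mass TYPE(3) * (\<Sum>i\<in>UNIV. \<Sum>j\<in>UNIV. \<bar>Om i j x\<bar>)"
    using bump_mass_pos[where 'n=3] by (intro mult_left_mono rho_le_Om) auto
  also have "\<dots> \<le> (\<Sum>i\<in>(UNIV::3 set). \<Sum>j\<in>(UNIV::3 set). ball_mean rho x r + 18 * V0 * unit_ball_vol 3 * r * S)"
    unfolding sum_distrib_left by (intro sum_mono Om)
  finally show ?thesis by simp
qed

text \<open>Local boundedness for the vorticity equation with bounded drift: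
  \<open>rho_mean_estimate\<close> is used at a maximum point of a weighted vorticity, with radius
  proportional to the distance \<open>d\<close> from the unit sphere about
  \<open>x0\<close>.\<close>

lemma rho_le_ball_mean: "\<exists>C>0. \<forall>x. rho x \<le> C * ball_mean rho x 1"
proof -
  obtain V0 where V0: "V0 > 0" "\<And>x. norm (v x) \<le> V0" using v_bounded by blast
  define m where "m = bump_mass TYPE(3)"
  have m: "m > 0" by (simp add: m_def bump_mass_pos)
  \<comment> \<open>1296 = 162 * 8, where 8 accounts for the cubic weight when the distance to the
    sphere is halved. The choice of \<open>e\<close> keeps the radius below \<open>d / 2\<close> and
    makes the error at most half of the left side.\<close>
  define A where "A = 1296 * V0 * unit_ball_vol 3"
  have A: "A > 0" using V0 by (simp add: A_def)
  define e where "e = min (1/2) (m / (2 * A))"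
  have e: "e > 0" "e \<le> 1/2" "A * e \<le> m / 2" using m A by (auto simp: e_def min_def field_simps)
  define C where "C = 18 / (e ^ 3 * m)"
  have "rho x0 \<le> C * ball_mean rho x0 1" for x0
  proof -
    \<comment> \<open>The weight makes the local supremum finite a priori, so that it can be absorbed.\<close>
    define F where "F y = (1 - dist x0 y) ^ 3 * rho y" for y
    have "continuous_on (cball x0 1) F"
      unfolding F_def by (intro continuous_intros continuous_rho)
    then obtain y where y: "dist x0 y \<le> 1" "\<And>z. dist x0 z \<le> 1 \<Longrightarrow> F z \<le> F y"
      using continuous_attains_sup[of "cball x0 1" F] by (auto simp: Ball_def)
    define S where "S = F y"
    have x0: "rho x0 \<le> S" using y(2)[of x0] by (simp add: S_def F_def)
    show ?thesis
    proof (cases "S \<le> 0")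
      case True
      moreover have "0 \<le> C * ball_mean rho x0 1"
        using m e by (intro mult_nonneg_nonneg ball_mean_nonneg rho_nonneg) (simp add: C_def)
      ultimately show ?thesis using x0 by linarith
    next
      case False
      define d where "d = 1 - dist x0 y"
      have d: "d > 0" "d \<le> 1" using False y(1) by (auto simp: S_def F_def d_def less_le)
      define r where "r = e * d"
      have r: "r > 0" "r \<le> d / 2" using e d mult_right_mono[OF e(2), of d] by (auto simp: r_def)
      have Sd: "S = d ^ 3 * rho y" by (simp add: S_def F_def d_def)
      have "rho z \<le> 8 * S / d ^ 3" if "dist y z \<le> r" for z
      proof -
        have z: "dist x0 z \<le> dist x0 y + dist y z" by (rule dist_triangle)
        then have "d / 2 \<le> 1 - dist x0 z" using r that by (simp add: d_def)
        then have "(d / 2) ^ 3 * rho z \<le> F z"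
          unfolding F_def using d by (intro mult_right_mono power_mono rho_nonneg) auto
        also have "\<dots> \<le> S" using y(2)[of z] \<open>d / 2 \<le> 1 - dist x0 z\<close> d by (simp add: S_def)
        finally show ?thesis using d by (simp add: field_simps power3_eq_cube)
      qed
      from rho_mean_estimate[OF V0(2) r(1) this, of y]
      have 1: "m * rho y \<le> 9 * ball_mean rho y r + 162 * V0 * unit_ball_vol 3 * r * (8 * S / d ^ 3)"
        by (simp add: m_def)
      have "ball_mean rho y r \<le> ball_mean rho x0 1 * 1 ^ CARD(3) / r ^ CARD(3)"
        by (rule ball_mean_le_ball_integral) (use r d in \<open>auto simp: continuous_rho rho_nonneg dist_commute d_def\<close>)
      then have 2: "ball_mean rho y r \<le> ball_mean rho x0 1 / (e ^ 3 * d ^ 3)"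
        by (simp add: r_def power_mult_distrib)
      have "m * S = d ^ 3 * (m * rho y)" by (simp add: Sd)
      also have "\<dots> \<le> d ^ 3 * (9 * (ball_mean rho x0 1 / (e ^ 3 * d ^ 3)) + 162 * V0 * unit_ball_vol 3 * r * (8 * S / d ^ 3))"
        using 1 2 d by (intro mult_left_mono) auto
      also have "\<dots> = 9 * ball_mean rho x0 1 / e ^ 3 + A * e * d * S"
        using d e by (simp add: A_def r_def distrib_left)
      finally have 3: "m * S \<le> 9 * ball_mean rho x0 1 / e ^ 3 + A * e * d * S" .
      have "A * e * d * S \<le> (m / 2) * 1 * S"
        using e d m False A by (intro mult_right_mono mult_mono) auto
      with 3 have "m * S \<le> 18 * ball_mean rho x0 1 / e ^ 3" by simp
      then have "S \<le> C * ball_mean rho x0 1" using m e by (simp add: C_def field_simps)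
      then show ?thesis using x0 by linarith
    qed
  qed
  moreover have "C > 0" using e m by (simp add: C_def)
  ultimately show ?thesis by blast
qed

lemma rho_bounded: "\<exists>W>0. \<forall>x. rho x \<le> W"
proof -
  obtain C1 where C1: "C1 \<ge> 0" "\<And>x. ball_mean rho x 1 \<le> C1" using rho_ball_integral_bounded by blast
  obtain C where C: "C > 0" "\<And>x. rho x \<le> C * ball_mean rho x 1" using rho_le_ball_mean by blast
  have "rho x \<le> C * C1 + 1" for x
    using C(2)[of x] mult_left_mono[OF C1(2)[of x], of C] C(1) by linarith
  then show ?thesis using C C1 by (intro exI[of _ "C * C1 + 1"]) (auto intro: add_nonneg_pos)
qed

section \<open>The integrable weight and its convolution \<open>kap\<close>\<close>

definition wt :: "real^3 \<Rightarrow> real" where "wt x = rho x powr (11/6)"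

lemma wt_nonneg: "wt x \<ge> 0" by (simp add: wt_def)

lemma continuous_wt: "continuous_on S wt"
  unfolding wt_def[abs_def] using rho_nonneg
  by (intro continuous_on_powr' continuous_intros continuous_rho) auto

lemma integrable_wt: "integrable lborel wt"
proof -
  obtain W where W: "\<And>x. rho x \<le> W" using rho_bounded by blast
  obtain K where K: "K \<ge> 0" "\<forall>l>0. emeasure lborel {x. rho x > l} \<le> ennreal (K * l powr (- (9/5)))"
    using rho_weak by blast
  show ?thesis unfolding wt_def[abs_def]
    by (rule integrable_powr_of_weak_type[OF rho_measurable rho_nonneg W K(1)]) (use K in auto)
qed

lemma integrable_rho_squared: "integrable lborel (\<lambda>x. rho x ^ 2)"
proof -
  obtain W where W: "W > 0" "\<And>x. rho x \<le> W" using rho_bounded by blast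
  show ?thesis
  proof (rule Bochner_Integration.integrable_bound)
    show "integrable lborel (\<lambda>x. W powr (1/6) * wt x)" using integrable_wt by simp
    show "AE x in lborel. norm (rho x ^ 2) \<le> norm (W powr (1/6) * wt x)"
    proof (rule AE_I2)
      fix x
      have "rho x ^ 2 = rho x powr (1/6) * rho x powr (11/6)"
        using rho_nonneg[of x] by (cases "rho x = 0") (simp_all add: powr_add[symmetric] powr_numeral)
      also have "\<dots> \<le> W powr (1/6) * rho x powr (11/6)"
        by (intro mult_right_mono powr_mono2 W rho_nonneg) auto
      finally show "norm (rho x ^ 2) \<le> norm (W powr (1/6) * wt x)" by (simp add: wt_def abs_mult)
    qed
  qed simp
qed

definition mass :: real where "mass = (LBINT x. wt x)"

definition kap :: "real^3 \<Rightarrow> real" where "kap = conv wt (japanese (7/10))"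

lemma japanese_abs: "a \<ge> 0 \<Longrightarrow> \<bar>japanese a z\<bar> \<le> 1"
  using japanese_bounds[of a z] by simp

lemma wt_japanese_integrable: "a \<ge> 0 \<Longrightarrow> integrable lborel (\<lambda>y. wt y * japanese a (x - y))"
  by (rule conv_integrand_integrable[OF integrable_wt _ japanese_abs]) auto

lemma mass_nonneg: "mass \<ge> 0"
  unfolding mass_def by (intro Bochner_Integration.integral_nonneg wt_nonneg)

lemma kap_nonneg: "kap x \<ge> 0"
  unfolding kap_def by (intro conv_nonneg wt_nonneg less_imp_le[OF japanese_bounds(1)])

lemma kap_le_mass: "kap x \<le> mass"
  unfolding kap_def conv_def mass_def
  using mult_left_mono[OF japanese_bounds(2)[of "7/10"] wt_nonneg]
  by (intro integral_mono wt_japanese_integrable integrable_wt) auto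

lemma ball_mean_wt_le_mass: "r > 0 \<Longrightarrow> ball_mean wt x r \<le> mass / r ^ 3"
  by (simp add: ball_mean_eq[OF continuous_wt] mass_def)
    (intro divide_right_mono integral_mono integrable_indicator_cball continuous_wt integrable_wt;
      simp add: indicator_def wt_nonneg)

text \<open>On the ball of radius \<open>r\<close> about \<open>x\<close> the kernel of
  \<open>kap\<close> is at least \<open>(1 + r ^ 2) powr (- (7/10))\<close>.\<close>

lemma ball_mean_wt_le_kap:
  assumes r: "r > 0"
  shows "ball_mean wt x r \<le> (1 + r ^ 2) powr (7/10) * kap x / r ^ 3"
proof -
  have "(LBINT y. indicator (cball x r) y * wt y) \<le> (LBINT y. (1 + r ^ 2) powr (7/10) * (wt y * japanese (7/10) (x - y)))"
  proof (intro integral_mono integrable_indicator_cball continuous_wt integrable_mult_right wt_japanese_integrable)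
    fix y
    show "indicator (cball x r) y * wt y \<le> (1 + r ^ 2) powr (7/10) * (wt y * japanese (7/10) (x - y))"
    proof (cases "dist x y \<le> r")
      case True
      have "(x - y) \<bullet> (x - y) \<le> r ^ 2"
        using power_mono[OF True, of 2] by (simp add: dist_norm dot_square_norm)
      then have "(1 + r ^ 2) powr (- (7/10)) \<le> japanese (7/10) (x - y)"
        unfolding japanese_def by (intro powr_mono2') (auto simp: add_pos_nonneg)
      then have "(1 + r ^ 2) powr (7/10) * (1 + r ^ 2) powr (- (7/10)) \<le> (1 + r ^ 2) powr (7/10) * japanese (7/10) (x - y)"
        by (intro mult_left_mono) auto
      moreover have "(1 + r ^ 2) powr (7/10) * (1 + r ^ 2) powr (- (7/10)) = 1"
        using add_pos_nonneg[OF zero_less_one zero_le_power2[of r]] by (simp flip: powr_add)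
      ultimately show ?thesis using True mult_right_mono[OF _ wt_nonneg[of y]] by (fastforce simp: mult_ac)
    qed (use japanese_bounds(1)[of "7/10" "x - y"] wt_nonneg[of y] in simp)
  qed simp
  also have "\<dots> = (1 + r ^ 2) powr (7/10) * kap x" by (simp add: kap_def conv_def)
  finally show ?thesis using r by (simp add: ball_mean_eq[OF continuous_wt] divide_right_mono)
qed

lemma ball_mean_rho_le: "ball_mean rho x r \<le> 2 * unit_ball_vol 3 powr (5/11) * ball_mean wt x r powr (6/11)"
  using ball_mean_powr_le[OF continuous_rho rho_nonneg, of "11/6" x r] by (simp add: wt_def[abs_def])

text \<open>The local bound followed by Jensen's inequality. Admitting every \<open>y\<close> within
  1 of \<open>x\<close> serves \<open>V_le_kap\<close>, which needs one constant on a whole unit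
  ball.\<close>

lemma rho_le_kap: "\<exists>C>0. \<forall>x y. dist x y \<le> 1 \<longrightarrow> rho y \<le> C * kap x powr (6/11)"
proof -
  obtain C where C: "C > 0" "\<And>x. rho x \<le> C * ball_mean rho x 1" using rho_le_ball_mean by blast
  define D where "D = C * (2 * unit_ball_vol 3 powr (5/11) * (5 powr (7/10)) powr (6/11))"
  have "rho y \<le> D * kap x powr (6/11)" if xy: "dist x y \<le> 1" for x y
  proof -
    \<comment> \<open>The unit ball about \<open>y\<close> lies in the ball of radius 2 about
      \<open>x\<close>, which brings in 5 = 1 + 2^2 from \<open>ball_mean_wt_le_kap\<close>.\<close>
    have "ball_mean wt y 1 \<le> ball_mean wt x 2 * 2 ^ CARD(3) / 1 ^ CARD(3)"
      using xy by (intro ball_mean_le_ball_integral continuous_wt wt_nonneg) (auto simp: dist_commute)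
    also have "\<dots> \<le> 5 powr (7/10) * kap x"
      using ball_mean_wt_le_kap[of 2 x] by simp
    finally have "ball_mean wt y 1 powr (6/11) \<le> (5 powr (7/10) * kap x) powr (6/11)"
      by (intro powr_mono2 ball_mean_nonneg wt_nonneg) auto
    then have "ball_mean wt y 1 powr (6/11) \<le> (5 powr (7/10)) powr (6/11) * kap x powr (6/11)"
      by (simp add: powr_mult kap_nonneg)
    then have "C * (2 * unit_ball_vol 3 powr (5/11) * ball_mean wt y 1 powr (6/11)) \<le>
       C * (2 * unit_ball_vol 3 powr (5/11) * ((5 powr (7/10)) powr (6/11) * kap x powr (6/11)))"
      using C by (intro mult_left_mono) auto
    moreover have "rho y \<le> C * (2 * unit_ball_vol 3 powr (5/11) * ball_mean wt y 1 powr (6/11))"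
      using C(2)[of y] mult_left_mono[OF ball_mean_rho_le[of y 1], of C] C(1) by linarith
    ultimately show ?thesis by (simp add: D_def mult_ac)
  qed
  moreover have "unit_ball_vol 3 \<noteq> (0::real)" using unit_ball_vol_pos[of 3] by linarith
  then have "D > 0" using C by (simp add: D_def)
  ultimately show ?thesis by blast
qed

end

section \<open>Bounds for the velocity and the head\<close>

lemma powr_increment_bound:
  fixes f :: "real \<Rightarrow> real"
  assumes ab: "0 < a" "a \<le> b" and b: "\<beta> \<noteq> 1"
    and f: "\<And>r. a \<le> r \<Longrightarrow> r \<le> b \<Longrightarrow> (f has_real_derivative f' r) (at r)"
    and f': "\<And>r. a \<le> r \<Longrightarrow> r \<le> b \<Longrightarrow> \<bar>f' r\<bar> \<le> K * r powr (- \<beta>)"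
  shows "\<bar>f b - f a\<bar> \<le> K / (1 - \<beta>) * (b powr (1 - \<beta>) - a powr (1 - \<beta>))"
proof -
  have "\<bar>f b - f a\<bar> \<le> K / (1 - \<beta>) * b powr (1 - \<beta>) - K / (1 - \<beta>) * a powr (1 - \<beta>)"
  proof (rule abs_diff_le_of_deriv_bound[OF ab(2) f _ f'])
    fix r assume r: "a \<le> r" "r \<le> b"
    have "((\<lambda>r. K / (1 - \<beta>) * r powr (1 - \<beta>)) has_real_derivative K / (1 - \<beta>) * ((1 - \<beta>) * r powr (1 - \<beta> - 1))) (at r)"
      using r ab by (intro DERIV_cmult has_real_derivative_powr) auto
    then show "((\<lambda>r. K / (1 - \<beta>) * r powr (1 - \<beta>)) has_real_derivative K * r powr (- \<beta>)) (at r)"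
      using b by simp
  qed
  then show ?thesis by (simp add: right_diff_distrib)
qed

lemma bump_deriv:
  "((\<lambda>t. bump (z + t *\<^sub>R axis i 1)) has_real_derivative - (4 * max 0 (1 - z \<bullet> z) * z $ i)) (at 0)"
proof -
  have eq: "(z + t *\<^sub>R axis i 1) \<bullet> (z + t *\<^sub>R axis i 1) = z \<bullet> z + 2 * t * z $ i + t * t" for t
    by (simp add: inner_add_left inner_add_right inner_axis inner_axis' algebra_simps)
  have "((\<lambda>t. max 0 (1 - (z \<bullet> z + 2 * t * z $ i + t * t)) ^ 2) has_real_derivative
      (2 * max 0 (1 - (z \<bullet> z + 2 * 0 * z $ i + 0 * 0))) * (- (2 * z $ i))) (at 0)"
    by (rule DERIV_chain2[where f="\<lambda>s. max 0 s ^ 2"])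
      (use DERIV_max0_power[of 0] in \<open>auto intro!: derivative_eq_intros simp: numeral_2_eq_2\<close>)
  then show ?thesis
    unfolding bump_def eq by (simp add: mult.assoc)
qed

text \<open>Integration by parts moves the derivative onto \<open>bump\<close>, whose partial
  derivatives are at most 4 in modulus; the rescaling produces the factor
  \<open>1 / r\<close>.\<close>

lemma bump_partial_bound:
  fixes u g :: "real^'n \<Rightarrow> real"
  assumes u: "smooth u" and g: "continuous_on UNIV g" "\<And>y. \<bar>u y\<bar> \<le> g y" and r: "r > 0"
  shows "\<bar>LBINT z. bump z * pd i u (x + r *\<^sub>R z)\<bar> \<le> 4 / r * ball_mean g x r"
proof -
  define q where "q z = 4 * max 0 (1 - z \<bullet> z) * z $ i" for z :: "real^'n"
  have cq: "continuous_on UNIV q" unfolding q_def by (intro continuous_intros)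
  have c: "continuous_on UNIV (\<lambda>z. f (x + r *\<^sub>R z))" if "continuous_on UNIV f" for f :: "real^'n \<Rightarrow> real"
    by (intro continuous_on_compose2[OF that] continuous_intros) auto
  have cu: "continuous_on UNIV u" by (rule smooth_continuous_on[OF u])
  define G where "G z = bump z * (r * pd i u (x + r *\<^sub>R z)) + - q z * u (x + r *\<^sub>R z)" for z
  have G: "(LBINT z. G z) = 0"
  proof (rule integral_directional_derivative_eq_0(2))
    show "continuous_on UNIV (\<lambda>z. bump z * u (x + r *\<^sub>R z))"
      by (intro continuous_intros c cu)
    show "continuous_on UNIV G" unfolding G_def
      by (intro continuous_intros c cu cq smooth_continuous_on[OF smooth_pd[OF u]])
    show "bump z * u (x + r *\<^sub>R z) = 0" if "norm z > 1" for z using that by (simp add: bump_eq_0)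
    fix z :: "real^'n"
    show "((\<lambda>t. bump (z + t *\<^sub>R axis i 1) * u (x + r *\<^sub>R (z + t *\<^sub>R axis i 1))) has_real_derivative G z) (at 0)"
      using DERIV_mult[OF bump_deriv[of z i] line_derivative_scaled[OF u, of x r z i]]
      by (simp add: G_def q_def mult_ac)
  qed
  have q0: "q z = 0" if "norm z > 1" for z
    using power_mono[of 1 "norm z" 2] that by (simp add: q_def dot_square_norm max_absorb1)
  have i1: "integrable lborel (\<lambda>z. bump z * (r * pd i u (x + r *\<^sub>R z)))"
    by (intro bump_integral_eq_cbox continuous_intros c smooth_continuous_on[OF smooth_pd[OF u]])
  have i2: "integrable lborel (\<lambda>z. q z * u (x + r *\<^sub>R z))"
    by (rule integrable_continuous_support[of _ 1]) (auto intro!: continuous_intros c cu cq simp: q0)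
  have "r * (LBINT z. bump z * pd i u (x + r *\<^sub>R z)) = (LBINT z. q z * u (x + r *\<^sub>R z))"
    using G i1 i2 by (simp add: G_def mult.left_commute[of _ r])
  moreover have "\<bar>LBINT z. q z * u (x + r *\<^sub>R z)\<bar> \<le> ball_mean (\<lambda>y. 4 * g y) x r"
  proof -
    have "\<bar>LBINT z. q z * u (x + r *\<^sub>R z)\<bar> \<le> (LBINT z. \<bar>q z * u (x + r *\<^sub>R z)\<bar>)" by (rule integral_abs_bound)
    also have "\<dots> \<le> ball_mean (\<lambda>y. 4 * g y) x r"
      unfolding ball_mean_def
    proof (intro integral_mono integrable_abs i2 ball_mean_integrable continuous_intros g)
      fix z :: "real^'n"
      show "\<bar>q z * u (x + r *\<^sub>R z)\<bar> \<le> indicator (cball 0 1) z * (4 * g (x + r *\<^sub>R z))"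
      proof (cases "norm z \<le> 1")
        case True
        have "\<bar>q z\<bar> \<le> 4 * 1 * 1" unfolding q_def abs_mult
          using component_le_norm_cart[of z i] True by (intro mult_mono) auto
        then have "\<bar>q z\<bar> * \<bar>u (x + r *\<^sub>R z)\<bar> \<le> 4 * g (x + r *\<^sub>R z)"
          by (intro mult_mono g) auto
        then show ?thesis using True by (simp add: abs_mult)
      qed (simp add: q0)
    qed
    finally show ?thesis .
  qed
  ultimately have "\<bar>r * (LBINT z. bump z * pd i u (x + r *\<^sub>R z))\<bar> \<le> 4 * ball_mean g x r"
    by (simp add: ball_mean_cmult)
  then show ?thesis using r by (simp add: abs_mult field_simps)
qed

context weak_vorticity_flow
begin

definition mean_const :: real where "mean_const = 2 * unit_ball_vol 3 powr (5/11)"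

lemma mean_const_pos: "mean_const > 0"
  using unit_ball_vol_pos[of 3] unfolding mean_const_def by (simp add: less_imp_neq[symmetric])

lemma ball_mean_rho_le_mass:
  assumes "r > 0"
  shows "ball_mean rho x r \<le> mean_const * mass powr (6/11) * r powr (- (18/11))"
proof -
  have "ball_mean wt x r powr (6/11) \<le> (mass / r ^ 3) powr (6/11)"
    using assms by (intro powr_mono2 ball_mean_nonneg wt_nonneg ball_mean_wt_le_mass) auto
  also have "\<dots> = (mass * r powr (- 3)) powr (6/11)"
    using assms by (simp add: powr_minus_divide powr_numeral)
  also have "\<dots> = mass powr (6/11) * r powr (- (18/11))"
    using mass_nonneg by (simp add: powr_mult powr_powr)
  finally have "mean_const * ball_mean wt x r powr (6/11) \<le> mean_const * (mass powr (6/11) * r powr (- (18/11)))"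
    using mean_const_pos by (intro mult_left_mono) auto
  then show ?thesis using ball_mean_rho_le[of x r] by (simp add: mean_const_def mult_ac)
qed

text \<open>Means of \<open>wt\<close> decay with exponent 8/5 = 3 - 7/5, and 48/55 is 6/11 of it.
  This is below 1, so its primitive grows with the radius; the bound by \<open>mass\<close> decays
  with exponent 18/11 > 1 but does not see \<open>kap x\<close>. \<open>V_le_kap\<close> combines
  the two.\<close>

lemma ball_mean_rho_le_kap:
  assumes r: "r \<ge> 1"
  shows "ball_mean rho x r \<le> 2 * mean_const * kap x powr (6/11) * r powr (- (48/55))"
proof -
  have "(1 + r ^ 2) powr (7/10) \<le> (2 * r ^ 2) powr (7/10)"
    using r by (intro powr_mono2) (auto simp: add_pos_nonneg one_le_power)
  also have "\<dots> = 2 powr (7/10) * (r powr 2) powr (7/10)"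
    using r by (simp add: powr_mult powr_numeral)
  also have "\<dots> = 2 powr (7/10) * r powr (7/5)" by (simp add: powr_powr)
  finally have "(1 + r ^ 2) powr (7/10) * kap x / r ^ 3 \<le> 2 powr (7/10) * r powr (7/5) * kap x / r ^ 3"
    using r kap_nonneg by (intro divide_right_mono mult_right_mono) auto
  also have "\<dots> = 2 powr (7/10) * kap x * (r powr (7/5) * r powr (- 3))"
    using r by (simp add: powr_minus_divide powr_numeral)
  also have "\<dots> = 2 powr (7/10) * kap x * r powr (- (8/5))"
    by (simp flip: powr_add)
  finally have "ball_mean wt x r \<le> 2 powr (7/10) * kap x * r powr (- (8/5))"
    using ball_mean_wt_le_kap[of r x] r by simp
  then have "ball_mean wt x r powr (6/11) \<le> (2 powr (7/10) * kap x * r powr (- (8/5))) powr (6/11)"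
    by (intro powr_mono2 ball_mean_nonneg wt_nonneg) auto
  also have "\<dots> = 2 powr (21/55) * kap x powr (6/11) * r powr (- (48/55))"
    using kap_nonneg by (simp add: powr_mult powr_powr)
  also have "\<dots> \<le> 2 powr 1 * kap x powr (6/11) * r powr (- (48/55))"
    by (intro mult_right_mono powr_mono) auto
  finally have "mean_const * ball_mean wt x r powr (6/11) \<le> mean_const * (2 powr 1 * kap x powr (6/11) * r powr (- (48/55)))"
    using mean_const_pos by (intro mult_left_mono) auto
  then show ?thesis using ball_mean_rho_le[of x r] by (simp add: mean_const_def mult_ac)
qed

lemma rho_eq_0_of_mass: "mass = 0 \<Longrightarrow> rho x = 0"
proof -
  assume "mass = 0"
  then have "ball_mean rho x 1 \<le> 0" using ball_mean_rho_le_mass[of 1 x] by simp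
  moreover obtain C where "C > 0" "rho x \<le> C * ball_mean rho x 1" using rho_le_ball_mean by blast
  ultimately have "rho x \<le> 0" by (smt (verit) mult_nonneg_nonpos)
  then show "rho x = 0" using rho_nonneg[of x] by linarith
qed

lemma kap_pos: "mass > 0 \<Longrightarrow> kap x > 0"
proof (rule ccontr)
  assume m: "mass > 0" and "\<not> kap x > 0"
  then have "kap x = 0" using kap_nonneg[of x] by linarith
  then have "AE y in lborel. wt y * japanese (7/10) (x - y) = 0"
    unfolding kap_def conv_def
    by (subst (asm) integral_nonneg_eq_0_iff_AE) (auto intro!: wt_japanese_integrable mult_nonneg_nonneg wt_nonneg less_imp_le[OF japanese_bounds(1)])
  then have "AE y in lborel. wt y = 0"
    by eventually_elim (use japanese_bounds(1) in \<open>metis less_irrefl mult_eq_0_iff\<close>)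
  then have "mass = 0" unfolding mass_def by (rule integral_eq_zero_AE)
  then show False using m by simp
qed

section \<open>The velocity bound\<close>

lemma V_mean_deriv: "(bump_mean (V j) x has_real_derivative bump_flux (\<lambda>i. Om i j) x r) (at r)"
  by (rule bump_mean_deriv[OF smooth_V smooth_Om laplace_V])

lemma V_flux_le: "\<bar>bump_flux (\<lambda>i. Om i j) x r\<bar> \<le> 3 * ball_mean rho x r"
  using bump_mean_flux_bound[of "\<lambda>i. Om i j" rho x r, OF smooth_Om continuous_rho abs_Om_le] by simp

lemma V_mean_tendsto_0: "(bump_mean (V j) x \<longlongrightarrow> 0) at_top"
proof -
  obtain V0 where V0: "\<And>x. norm (v x) \<le> V0" using v_bounded by blast
  show ?thesis
  proof (rule bump_mean_tendsto_0)
    show "continuous_on UNIV (V j)" by (rule smooth_continuous_on[OF smooth_V])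
    show "\<bar>V j y\<bar> \<le> V0" for y using component_le_norm_cart[of "v y" j] V0[of y] by linarith
    show "(V j \<longlongrightarrow> 0) at_infinity" using tendsto_vec_nth[OF decay, of j] by simp
  qed
qed

text \<open>Radial integration from \<open>r\<close> to infinity, where the mean vanishes. The
  constant is 33/7 = 3 * 11/7 with 11/7 the inverse of 18/11 - 1.\<close>

lemma V_tail:
  assumes r: "r > 0"
  shows "\<bar>bump_mean (V j) x r\<bar> \<le> 33/7 * mean_const * mass powr (6/11) * r powr (- (7/11))"
proof -
  define K where "K = 3 * (mean_const * mass powr (6/11))"
  have K: "K \<ge> 0" using mean_const_pos by (simp add: K_def)
  have le: "\<bar>bump_mean (V j) x R - bump_mean (V j) x r\<bar> \<le> 11/7 * K * r powr (- (7/11))" if "R \<ge> r" for R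
  proof -
    have "\<bar>bump_mean (V j) x R - bump_mean (V j) x r\<bar> \<le> K / (1 - 18/11) * (R powr (1 - 18/11) - r powr (1 - 18/11))"
    proof (rule powr_increment_bound[OF r that _ V_mean_deriv])
      fix s assume "r \<le> s" "s \<le> R"
      then show "\<bar>bump_flux (\<lambda>i. Om i j) x s\<bar> \<le> K * s powr (- (18/11))"
        using V_flux_le[of j x s] ball_mean_rho_le_mass[of s x] r by (simp add: K_def mult_ac)
    qed simp
    also have "\<dots> = 11/7 * K * r powr (- (7/11)) - 11/7 * K * R powr (- (7/11))" by (simp add: field_simps)
    also have "\<dots> \<le> 11/7 * K * r powr (- (7/11))" using K by simp
    finally show ?thesis .
  qed
  have "((\<lambda>R. \<bar>bump_mean (V j) x R - bump_mean (V j) x r\<bar>) \<longlongrightarrow> \<bar>0 - bump_mean (V j) x r\<bar>) at_top"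
    by (intro tendsto_intros V_mean_tendsto_0)
  then have "\<bar>0 - bump_mean (V j) x r\<bar> \<le> 11/7 * K * r powr (- (7/11))"
    by (rule tendsto_upperbound[OF _ eventually_mono[OF eventually_ge_at_top[of r] le]]) simp_all
  then show ?thesis by (simp add: K_def)
qed

lemma v_eq_0_of_mass: "mass = 0 \<Longrightarrow> v x = 0"
proof -
  assume m: "mass = 0"
  have "\<bar>bump_mean (V j) x 1 - bump_mean (V j) x 0\<bar> \<le> 0 - 0" for j
    by (rule abs_diff_le_of_deriv_bound[OF _ V_mean_deriv, of 0 1 "\<lambda>_. 0" "\<lambda>_. 0"])
      (use V_flux_le[of j x] rho_eq_0_of_mass[OF m] in \<open>auto simp: ball_mean_def\<close>)
  moreover have "bump_mean (V j) x 1 = 0" for j using V_tail[of 1 j x] m by simp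
  ultimately have "bump_mass TYPE(3) * V j x = 0" for j by (simp add: bump_mean_0)
  then have "V j x = 0" for j using bump_mass_pos[where 'n=3] by (metis less_irrefl mult_eq_0_iff)
  then show "v x = 0" by (simp add: vec_eq_iff)
qed

text \<open>Hedberg's interpolation. The change of the mean is controlled by
  \<open>rho_le_kap\<close> up to radius 1, by \<open>ball_mean_rho_le_kap\<close> up to
  \<open>r0\<close>, and the rest by \<open>V_tail\<close>. The tail has exponent - 7/11 in
  \<open>r0\<close>, and \<open>r0\<close> has exponent - 5/7 in \<open>kap x\<close>, which yields
  5/11.\<close>

lemma V_le_kap: "\<exists>C>0. \<forall>x j. \<bar>V j x\<bar> \<le> C * kap x powr (5/11)"
proof (cases "mass = 0")
  case True
  then show ?thesis by (intro exI[of _ 1]) (simp add: v_eq_0_of_mass)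
next
  case False
  then have m: "mass > 0" using mass_nonneg by linarith
  obtain C1 where C1: "C1 > 0" "\<And>x y. dist x y \<le> 1 \<Longrightarrow> rho y \<le> C1 * kap x powr (6/11)"
    using rho_le_kap by blast
  define C where "C = 3 * unit_ball_vol 3 * C1 * mass powr (1/11) + 330/7 * mean_const * mass powr (1/11) + 33/7 * mean_const * mass powr (1/11)"
  have "bump_mass TYPE(3) * \<bar>V j x\<bar> \<le> C * kap x powr (5/11)" for x j
  proof -
    define k where "k = kap x"
    have k: "0 < k" "k \<le> mass" using kap_pos[OF m] kap_le_mass by (auto simp: k_def)
    \<comment> \<open>The radius at which the bounds by \<open>kap x\<close> and by \<open>mass\<close> balance.\<close>
    define r0 where "r0 = (k / mass) powr (- (5/7))"
    have r0: "r0 \<ge> 1"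
      using k m powr_mono2'[of "- (5/7)" "k / mass" 1] by (simp add: r0_def)
    \<comment> \<open>The radii below \<open>r0\<close> produce the power 6/11 of \<open>k\<close>;
      near the centre the surplus 1/11 is absorbed through \<open>k \<le> mass\<close>.\<close>
    have split: "k powr (6/11) = k powr (5/11) * k powr (1/11)" by (simp flip: powr_add)
    have k11: "k powr (1/11) \<le> mass powr (1/11)" using k by (intro powr_mono2) auto
    have 1: "\<bar>bump_mean (V j) x 1 - bump_mean (V j) x 0\<bar> \<le> 3 * unit_ball_vol 3 * C1 * mass powr (1/11) * k powr (5/11)"
    proof -
      define B where "B = 3 * unit_ball_vol 3 * C1 * k powr (6/11)"
      have "\<bar>bump_mean (V j) x 1 - bump_mean (V j) x 0\<bar> \<le> B * 1 - B * 0"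
      proof (rule abs_diff_le_of_deriv_bound[OF _ V_mean_deriv])
        fix r :: real assume r: "0 \<le> r" "r \<le> 1"
        have "ball_mean rho x r \<le> ball_mean (\<lambda>y. C1 * k powr (6/11)) x r"
          using r by (intro ball_mean_mono continuous_rho continuous_intros) (auto simp: k_def intro!: C1)
        then show "\<bar>bump_flux (\<lambda>i. Om i j) x r\<bar> \<le> B"
          using V_flux_le[of j x r] by (simp add: ball_mean_const B_def mult_ac)
      qed (auto intro!: derivative_eq_intros)
      also have "\<dots> = 3 * unit_ball_vol 3 * C1 * k powr (5/11) * k powr (1/11)"
        by (simp add: B_def split)
      also have "\<dots> \<le> 3 * unit_ball_vol 3 * C1 * k powr (5/11) * mass powr (1/11)"
        using C1 k11 by (intro mult_left_mono) auto
      finally show ?thesis by (simp add: mult_ac)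
    qed
    have 2: "\<bar>bump_mean (V j) x r0 - bump_mean (V j) x 1\<bar> \<le> 330/7 * mean_const * mass powr (1/11) * k powr (5/11)"
    proof -
      define K where "K = 3 * (2 * mean_const * k powr (6/11))"
      have "\<bar>bump_mean (V j) x r0 - bump_mean (V j) x 1\<bar> \<le> K / (1 - 48/55) * (r0 powr (1 - 48/55) - 1 powr (1 - 48/55))"
      proof (rule powr_increment_bound[OF _ r0 _ V_mean_deriv])
        fix s assume "1 \<le> s" "s \<le> r0"
        then show "\<bar>bump_flux (\<lambda>i. Om i j) x s\<bar> \<le> K * s powr (- (48/55))"
          using V_flux_le[of j x s] ball_mean_rho_le_kap[of s x] by (simp add: K_def k_def mult_ac)
      qed auto
      also have "\<dots> = 55/7 * K * r0 powr (7/55) - 55/7 * K" by (simp add: field_simps)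
      also have "\<dots> \<le> 55/7 * K * r0 powr (7/55)" using mean_const_pos by (simp add: K_def)
      also have "r0 powr (7/55) = (k / mass) powr (- (1/11))" by (simp add: r0_def powr_powr)
      also have "(k / mass) powr (- (1/11)) = k powr (- (1/11)) * mass powr (1/11)"
        using k m by (simp add: powr_divide powr_minus field_simps)
      also have "55/7 * K * (k powr (- (1/11)) * mass powr (1/11)) = 330/7 * mean_const * mass powr (1/11) * (k powr (6/11) * k powr (- (1/11)))"
        by (simp add: K_def)
      also have "k powr (6/11) * k powr (- (1/11)) = k powr (5/11)" by (simp flip: powr_add)
      finally show ?thesis .
    qed
    have 3: "\<bar>bump_mean (V j) x r0\<bar> \<le> 33/7 * mean_const * mass powr (1/11) * k powr (5/11)"
    proof -
      have "r0 powr (- (7/11)) = (k / mass) powr (5/11)" by (simp add: r0_def powr_powr)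
      also have "\<dots> = k powr (5/11) * mass powr (- (5/11))" using k m by (simp add: powr_divide powr_minus field_simps)
      finally have "33/7 * mean_const * mass powr (6/11) * r0 powr (- (7/11)) = 33/7 * mean_const * (mass powr (6/11) * mass powr (- (5/11))) * k powr (5/11)"
        by simp
      also have "mass powr (6/11) * mass powr (- (5/11)) = mass powr (1/11)" by (simp flip: powr_add)
      finally have eq: "33/7 * mean_const * mass powr (6/11) * r0 powr (- (7/11)) = 33/7 * mean_const * mass powr (1/11) * k powr (5/11)" .
      show ?thesis using V_tail[of r0 j x] r0 unfolding eq by linarith
    qed
    have "bump_mass TYPE(3) * \<bar>V j x\<bar> = \<bar>bump_mean (V j) x 0\<bar>"
      using bump_mass_pos[where 'n=3] by (simp add: bump_mean_0 abs_mult)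
    then have "bump_mass TYPE(3) * \<bar>V j x\<bar> \<le> 3 * unit_ball_vol 3 * C1 * mass powr (1/11) * k powr (5/11)
        + 330/7 * mean_const * mass powr (1/11) * k powr (5/11) + 33/7 * mean_const * mass powr (1/11) * k powr (5/11)"
      using 1 2 3 by linarith
    then show ?thesis by (simp only: C_def distrib_right k_def)
  qed
  then have "\<bar>V j x\<bar> \<le> (C / bump_mass TYPE(3)) * kap x powr (5/11)" for x j
    using bump_mass_pos[where 'n=3] by (simp add: field_simps)
  moreover have "C / bump_mass TYPE(3) > 0"
    unfolding C_def using bump_mass_pos[where 'n=3] mean_const_pos C1 m by (intro divide_pos_pos add_nonneg_pos) auto
  ultimately show ?thesis by blast
qed

section \<open>Existence of the limit of the head at infinity\<close>

lemma head_mean_deriv: "(bump_mean head x has_real_derivative bump_flux lamb x r) (at r)"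
  by (rule bump_mean_deriv[OF smooth_head smooth_lamb laplace_head])

lemma head_flux_le:
  assumes r: "0 \<le> r" and v: "\<And>y. dist x y \<le> r \<Longrightarrow> norm (v y) \<le> d"
  shows "\<bar>bump_flux lamb x r\<bar> \<le> 9 * d * ball_mean rho x r"
proof -
  have "\<bar>bump_flux lamb x r\<bar> \<le> 3 * ball_mean (\<lambda>y. 3 * (norm (v y) * rho y)) x r"
    using bump_mean_flux_bound[of lamb "\<lambda>y. 3 * (norm (v y) * rho y)" x r, OF smooth_lamb _ abs_lamb_le]
    by (simp add: continuous_intros continuous_rho continuous_v)
  also have "\<dots> \<le> 3 * ball_mean (\<lambda>y. (3 * d) * rho y) x r"
    by (intro mult_left_mono ball_mean_mono continuous_intros continuous_v continuous_rho)
      (use r in \<open>auto intro!: mult_right_mono v rho_nonneg\<close>)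
  finally show ?thesis by (subst (asm) ball_mean_cmult) simp
qed

text \<open>The derivative of the mean in its centre decays. By \<open>grad_head\<close> it consists
  of a Lamb part, at most \<open>3 * V0\<close> times a mean of \<open>rho\<close>, and of three
  partials of \<open>Om\<close>, each at most 4 times such a mean when the radius is at least
  1.\<close>

lemma head_mean_shift: "((\<lambda>R. bump_mean head x R - bump_mean head y R) \<longlongrightarrow> 0) at_top"
proof -
  obtain V0 where V0: "V0 > 0" "\<And>x. norm (v x) \<le> V0" using v_bounded by blast
  define K where "K = 3 * norm (x - y) * ((3 * V0 + 12) * (mean_const * mass powr (6/11)))"
  have pb: "\<bar>LBINT z. bump z * pd i head (q + R *\<^sub>R z)\<bar> \<le> (3 * V0 + 12) * (mean_const * mass powr (6/11)) * R powr (- (18/11))"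
    if R: "R \<ge> 1" for i q R
  proof -
    have int: "integrable lborel (\<lambda>z. bump z * f (q + R *\<^sub>R z))" if "smooth f" for f :: "real^3 \<Rightarrow> real"
      by (intro bump_integral_eq_cbox smooth_affine_continuous that)
    have i2: "integrable lborel (\<lambda>z. bump z * pd k (Om k i) (q + R *\<^sub>R z))" for k
      by (intro int smooth_pd smooth_Om)
    have "(LBINT z. bump z * pd i head (q + R *\<^sub>R z)) =
      (LBINT z. bump z * lamb i (q + R *\<^sub>R z)) - (\<Sum>k\<in>UNIV. LBINT z. bump z * pd k (Om k i) (q + R *\<^sub>R z))"
      using int[OF smooth_lamb] i2 by (simp add: grad_head right_diff_distrib sum_distrib_left)
    moreover have "\<bar>LBINT z. bump z * lamb i (q + R *\<^sub>R z)\<bar> \<le> 3 * V0 * ball_mean rho q R"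
    proof -
      have "\<bar>LBINT z. bump z * lamb i (q + R *\<^sub>R z)\<bar> \<le> ball_mean (\<lambda>y. (3 * V0) * rho y) q R"
      proof (rule bump_integral_le_ball_mean)
        fix z :: "real^3"
        show "\<bar>lamb i (q + R *\<^sub>R z)\<bar> \<le> (3 * V0) * rho (q + R *\<^sub>R z)"
          using abs_lamb_le[of i "q + R *\<^sub>R z"] mult_right_mono[OF V0(2) rho_nonneg, of "q + R *\<^sub>R z" "q + R *\<^sub>R z"] by linarith
      qed (intro smooth_affine_continuous smooth_lamb continuous_intros continuous_rho)+
      then show ?thesis by (subst (asm) ball_mean_cmult)
    qed
    moreover have "\<bar>\<Sum>k\<in>UNIV. LBINT z. bump z * pd k (Om k i) (q + R *\<^sub>R z)\<bar> \<le> 12 * ball_mean rho q R"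
    proof -
      have b0: "ball_mean rho q R \<ge> 0" by (intro ball_mean_nonneg rho_nonneg)
      have "\<bar>LBINT z. bump z * pd k (Om k i) (q + R *\<^sub>R z)\<bar> \<le> 4 * ball_mean rho q R" for k
      proof -
        have "\<bar>LBINT z. bump z * pd k (Om k i) (q + R *\<^sub>R z)\<bar> \<le> 4 / R * ball_mean rho q R"
          by (rule bump_partial_bound[OF smooth_Om continuous_rho abs_Om_le]) (use R in simp)
        also have "\<dots> \<le> 4 * ball_mean rho q R" using R b0 by (intro mult_right_mono) (auto simp: field_simps)
        finally show ?thesis .
      qed
      then have "(\<Sum>k\<in>UNIV. \<bar>LBINT z. bump z * pd k (Om k i) (q + R *\<^sub>R z)\<bar>) \<le> (\<Sum>k\<in>(UNIV::3 set). 4 * ball_mean rho q R)"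
        by (intro sum_mono)
      then show ?thesis using sum_abs[of "\<lambda>k. LBINT z. bump z * pd k (Om k i) (q + R *\<^sub>R z)" "UNIV :: 3 set"]
        by (simp del: sum_abs)
    qed
    ultimately have "\<bar>LBINT z. bump z * pd i head (q + R *\<^sub>R z)\<bar> \<le> (3 * V0 + 12) * ball_mean rho q R"
      by (simp add: distrib_right)
    also have "\<dots> \<le> (3 * V0 + 12) * (mean_const * mass powr (6/11) * R powr (- (18/11)))"
      using V0 R by (intro mult_left_mono ball_mean_rho_le_mass) auto
    finally show ?thesis by (simp add: mult_ac)
  qed
  have bound: "\<bar>bump_mean head x R - bump_mean head y R\<bar> \<le> K * R powr (- (18/11))" if R: "R \<ge> 1" for R
  proof -
    define f where "f t = (LBINT z. bump z * head ((y + R *\<^sub>R z) + t *\<^sub>R (x - y)))" for t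
    define f' where "f' t = (LBINT z. bump z * (\<Sum>i\<in>UNIV. (x - y) $ i * pd i head ((y + R *\<^sub>R z) + t *\<^sub>R (x - y))))" for t
    have "\<bar>f 1 - f 0\<bar> \<le> K * R powr (- (18/11)) * 1 - K * R powr (- (18/11)) * 0"
    proof (rule abs_diff_le_of_deriv_bound)
      fix t :: real
      show "(f has_real_derivative f' t) (at t)"
        unfolding f_def[abs_def] f'_def by (intro bump_average_deriv smooth_head continuous_intros)
      have c: "continuous_on UNIV (\<lambda>z. pd i head ((y + t *\<^sub>R (x - y)) + R *\<^sub>R z))" for i
        by (intro smooth_affine_continuous smooth_pd smooth_head)
      have f'_eq: "f' t = (\<Sum>i\<in>UNIV. (x - y) $ i * (LBINT z. bump z * pd i head ((y + t *\<^sub>R (x - y)) + R *\<^sub>R z)))"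
      proof -
        have "f' t = (LBINT z. (\<Sum>i\<in>UNIV. (x - y) $ i * (bump z * pd i head ((y + t *\<^sub>R (x - y)) + R *\<^sub>R z))))"
          unfolding f'_def by (simp add: sum_distrib_left mult_ac add_ac)
        then show ?thesis
          using bump_integral_eq_cbox(2)[OF c] by simp
      qed
      have "\<bar>f' t\<bar> \<le> (\<Sum>i\<in>UNIV. \<bar>(x - y) $ i * (LBINT z. bump z * pd i head ((y + t *\<^sub>R (x - y)) + R *\<^sub>R z))\<bar>)"
        unfolding f'_eq by (rule sum_abs)
      also have "\<dots> \<le> (\<Sum>i\<in>(UNIV::3 set). norm (x - y) * ((3 * V0 + 12) * (mean_const * mass powr (6/11)) * R powr (- (18/11))))"
        unfolding abs_mult by (intro sum_mono mult_mono pb R component_le_norm_cart) auto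
      finally show "\<bar>f' t\<bar> \<le> K * R powr (- (18/11))" by (simp add: K_def mult_ac)
    qed (auto intro!: derivative_eq_intros)
    moreover have "f 1 = bump_mean head x R" "f 0 = bump_mean head y R"
      by (simp_all add: f_def bump_mean_def algebra_simps)
    ultimately show ?thesis by simp
  qed
  have "((\<lambda>R::real. K * R powr (- (18/11))) \<longlongrightarrow> 0) at_top"
    by (intro tendsto_mult_right_zero tendsto_neg_powr filterlim_ident) auto
  then show ?thesis
    by (rule Lim_null_comparison[OF eventually_mono[OF eventually_ge_at_top[of 1]], rotated]) (use bound in simp)
qed

text \<open>Up to radius \<open>norm x / 2\<close> the ball stays far from the origin, where the
  velocity is small; at larger radii the velocity is only bounded, but the radial integral of the
  vorticity means has a small tail.\<close>

lemma head_mean_approx: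
  assumes e: "e > 0"
  shows "\<exists>B. \<forall>x R. norm x \<ge> B \<longrightarrow> R \<ge> norm x / 2 \<longrightarrow> \<bar>bump_mean head x R - bump_mean head x 0\<bar> \<le> e"
proof -
  obtain V0 where V0: "V0 > 0" "\<And>x. norm (v x) \<le> V0" using v_bounded by blast
  obtain W where W: "W > 0" "\<And>x. rho x \<le> W" using rho_bounded by blast
  define G where "G = mean_const * mass powr (6/11)"
  have G: "G \<ge> 0" using mean_const_pos by (simp add: G_def)
  \<comment> \<open>\<open>P\<close> collects the coefficients of \<open>d\<close> from the radii up
    to \<open>s\<close>, which contribute \<open>d * P = e / 2\<close>; the choice of
    \<open>s0\<close> leaves the other half to the radii beyond.\<close>
  define P where "P = 9 * unit_ball_vol 3 * W + 9 * G * (11/7)"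
  have P: "P > 0" unfolding P_def using W G by (intro add_pos_nonneg) auto
  define d where "d = e / (2 * P)"
  have d: "d > 0" using e P by (simp add: d_def)
  obtain b where b: "\<And>x. norm x \<ge> b \<Longrightarrow> norm (v x) \<le> d"
    using decay d unfolding Lim_at_infinity by (metis dist_0_norm dist_commute less_imp_le)
  have "((\<lambda>s::real. 9 * V0 * G * (11/7) * s powr (- (7/11))) \<longlongrightarrow> 0) at_top"
    by (intro tendsto_mult_right_zero tendsto_neg_powr filterlim_ident) auto
  from order_tendstoD(2)[OF this, of "e / 2"]
  have "\<forall>\<^sub>F s in at_top. 9 * V0 * G * (11/7) * s powr (- (7/11)) < e / 2"
    using e by simp
  then obtain s0 where s0: "\<And>s. s \<ge> s0 \<Longrightarrow> 9 * V0 * G * (11/7) * s powr (- (7/11)) < e / 2"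
    by (auto simp: eventually_at_top_linorder)
  show ?thesis
  proof (intro exI[of _ "2 * max 1 (max b s0)"] allI impI)
    fix x :: "real^3" and R assume x: "2 * max 1 (max b s0) \<le> norm x" and R: "norm x / 2 \<le> R"
    define s where "s = norm x / 2"
    have s: "s \<ge> 1" "s \<ge> b" "s \<ge> s0" "R \<ge> s" using x R by (auto simp: s_def)
    have near: "norm (v y) \<le> d" if "dist x y \<le> s" for y
    proof (rule b)
      have "norm x \<le> norm y + dist x y" by (metis dist_norm norm_triangle_sub)
      then show "b \<le> norm y" using that s by (simp add: s_def)
    qed
    have 1: "\<bar>bump_mean head x 1 - bump_mean head x 0\<bar> \<le> 9 * d * (unit_ball_vol 3 * W) * 1 - 9 * d * (unit_ball_vol 3 * W) * 0"
    proof (rule abs_diff_le_of_deriv_bound[OF _ head_mean_deriv])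
      fix r :: real assume r: "0 \<le> r" "r \<le> 1"
      have "\<bar>bump_flux lamb x r\<bar> \<le> 9 * d * ball_mean rho x r"
        using r s near by (intro head_flux_le) auto
      also have "\<dots> \<le> 9 * d * ball_mean (\<lambda>y. W) x r"
        using d by (intro mult_left_mono ball_mean_mono continuous_rho continuous_intros W) auto
      finally show "\<bar>bump_flux lamb x r\<bar> \<le> 9 * d * (unit_ball_vol 3 * W)" by (simp add: ball_mean_const mult_ac)
    qed (auto intro!: derivative_eq_intros)
    have 2: "\<bar>bump_mean head x s - bump_mean head x 1\<bar> \<le> 9 * d * G / (1 - 18/11) * (s powr (1 - 18/11) - 1 powr (1 - 18/11))"
    proof (rule powr_increment_bound[OF _ s(1) _ head_mean_deriv])
      fix r assume r: "1 \<le> r" "r \<le> s"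
      have "\<bar>bump_flux lamb x r\<bar> \<le> 9 * d * ball_mean rho x r"
        using r s near by (intro head_flux_le) auto
      also have "\<dots> \<le> 9 * d * (mean_const * mass powr (6/11) * r powr (- (18/11)))"
        using d r by (intro mult_left_mono ball_mean_rho_le_mass) auto
      finally show "\<bar>bump_flux lamb x r\<bar> \<le> 9 * d * G * r powr (- (18/11))" by (simp add: G_def mult_ac)
    qed auto
    have 3: "\<bar>bump_mean head x R - bump_mean head x s\<bar> \<le> 9 * V0 * G / (1 - 18/11) * (R powr (1 - 18/11) - s powr (1 - 18/11))"
    proof (rule powr_increment_bound[OF _ s(4) _ head_mean_deriv])
      fix r assume r: "s \<le> r" "r \<le> R"
      have "\<bar>bump_flux lamb x r\<bar> \<le> 9 * V0 * ball_mean rho x r"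
        using r s V0 by (intro head_flux_le) auto
      also have "\<dots> \<le> 9 * V0 * (mean_const * mass powr (6/11) * r powr (- (18/11)))"
        using V0 r s by (intro mult_left_mono ball_mean_rho_le_mass) auto
      finally show "\<bar>bump_flux lamb x r\<bar> \<le> 9 * V0 * G * r powr (- (18/11))" by (simp add: G_def mult_ac)
    qed (use s in auto)
    have "9 * d * G / (1 - 18/11) * (s powr (1 - 18/11) - 1 powr (1 - 18/11)) \<le> 9 * d * G * (11/7)"
      using d G by (simp add: field_simps)
    moreover have "9 * V0 * G / (1 - 18/11) * (R powr (1 - 18/11) - s powr (1 - 18/11)) \<le> 9 * V0 * G * (11/7) * s powr (- (7/11))"
      using V0 G by (simp add: field_simps)
    moreover have "9 * d * (unit_ball_vol 3 * W) + 9 * d * G * (11/7) = d * P" by (simp add: P_def algebra_simps)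
    moreover have "d * P = e / 2" using P by (simp add: d_def)
    ultimately show "\<bar>bump_mean head x R - bump_mean head x 0\<bar> \<le> e"
      using 1 2 3 s0[OF s(3)] by linarith
  qed
qed

text \<open>Cauchy's criterion at infinity: the values at two far points are compared with their
  means over one large radius, and these means approach each other by
  \<open>head_mean_shift\<close>.\<close>

lemma head_limit: "\<exists>c. (head \<longlongrightarrow> c) at_infinity"
proof -
  have cauchy: "\<exists>B. \<forall>x y. norm x \<ge> B \<longrightarrow> norm y \<ge> B \<longrightarrow> \<bar>head x - head y\<bar> \<le> e" if e: "e > 0" for e
  proof -
    define m where "m = bump_mass TYPE(3)"
    have m: "m > 0" by (simp add: m_def bump_mass_pos)
    obtain B where B: "\<And>x R. norm x \<ge> B \<Longrightarrow> R \<ge> norm x / 2 \<Longrightarrow> \<bar>bump_mean head x R - bump_mean head x 0\<bar> \<le> e * m / 2"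
      using head_mean_approx[of "e * m / 2"] e m by auto
    have "\<bar>head x - head y\<bar> \<le> e" if xy: "norm x \<ge> B" "norm y \<ge> B" for x y
    proof -
      have "((\<lambda>R. \<bar>(bump_mean head x R - bump_mean head y R) - (bump_mean head x 0 - bump_mean head y 0)\<bar>)
          \<longlongrightarrow> \<bar>0 - (bump_mean head x 0 - bump_mean head y 0)\<bar>) at_top"
        by (intro tendsto_intros head_mean_shift)
      then have "\<bar>0 - (bump_mean head x 0 - bump_mean head y 0)\<bar> \<le> e * m"
      proof (rule tendsto_upperbound)
        show "\<forall>\<^sub>F R in at_top. \<bar>(bump_mean head x R - bump_mean head y R) - (bump_mean head x 0 - bump_mean head y 0)\<bar> \<le> e * m"
          using eventually_ge_at_top[of "norm x / 2"] eventually_ge_at_top[of "norm y / 2"]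
        proof eventually_elim
          case (elim R)
          then show ?case using B[OF xy(1) elim(1)] B[OF xy(2) elim(2)] by linarith
        qed
      qed simp
      then have "m * \<bar>head x - head y\<bar> \<le> e * m"
        using m by (simp add: bump_mean_0 m_def[symmetric] abs_mult flip: right_diff_distrib)
      then show ?thesis using m by simp
    qed
    then show ?thesis by blast
  qed
  \<comment> \<open>A ray suffices to produce the limit; the Cauchy condition carries it over to all
    directions.\<close>
  define X where "X n = head (real n *\<^sub>R axis 1 1)" for n :: nat
  have nX: "norm (real n *\<^sub>R axis 1 (1::real) :: real^3) = real n" for n by simp
  have "Cauchy X"
  proof (rule metric_CauchyI)
    fix e :: real assume "e > 0"
    then obtain B where B: "\<forall>x y. norm x \<ge> B \<longrightarrow> norm y \<ge> B \<longrightarrow> \<bar>head x - head y\<bar> \<le> e / 2"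
      using cauchy[of "e / 2"] by auto
    obtain N :: nat where N: "real N \<ge> B" using real_arch_simple by blast
    show "\<exists>M. \<forall>m\<ge>M. \<forall>n\<ge>M. dist (X m) (X n) < e"
    proof (intro exI[of _ N] allI impI)
      fix m n assume "N \<le> m" "N \<le> n"
      then have "real m \<ge> B" "real n \<ge> B" using N by linarith+
      then have "\<bar>X m - X n\<bar> \<le> e / 2" using B nX unfolding X_def by metis
      then show "dist (X m) (X n) < e" using \<open>e > 0\<close> by (simp add: dist_real_def)
    qed
  qed
  then obtain c where c: "X \<longlonglongrightarrow> c" using Cauchy_convergent convergent_def by blast
  have "(head \<longlongrightarrow> c) at_infinity"
    unfolding Lim_at_infinity
  proof (intro allI impI)
    fix e :: real assume e: "e > 0"
    then obtain B where B: "\<And>x y. norm x \<ge> B \<Longrightarrow> norm y \<ge> B \<Longrightarrow> \<bar>head x - head y\<bar> \<le> e / 2"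
      using cauchy[of "e / 2"] by auto
    obtain N :: nat where N: "real N \<ge> B" using real_arch_simple by blast
    show "\<exists>b. \<forall>x. norm x \<ge> b \<longrightarrow> dist (head x) c < e"
    proof (intro exI[of _ B] allI impI)
      fix x :: "real^3" assume x: "B \<le> norm x"
      have "(\<lambda>n. \<bar>head x - X n\<bar>) \<longlonglongrightarrow> \<bar>head x - c\<bar>" by (intro tendsto_intros c)
      then have "\<bar>head x - c\<bar> \<le> e / 2"
      proof (rule tendsto_upperbound)
        show "\<forall>\<^sub>F n in sequentially. \<bar>head x - X n\<bar> \<le> e / 2"
          using eventually_ge_at_top[of N]
        proof eventually_elim
          case (elim n)
          then have "real n \<ge> B" using N by linarith
          then show ?case unfolding X_def by (intro B x) (simp add: nX)
        qed
      qed simp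
      then show "dist (head x) c < e" using e by (simp add: dist_real_def)
    qed
  qed
  then show ?thesis by blast
qed

end

section \<open>The comparison function\<close>

definition japanese_partial :: "real \<Rightarrow> 'n \<Rightarrow> real^'n \<Rightarrow> real" where
  "japanese_partial a i z = - (2 * a) * z $ i * japanese (a + 1) z"

lemma continuous_japanese_partial: "continuous_on S (japanese_partial a i)"
  unfolding japanese_partial_def[abs_def] by (intro continuous_intros)

lemma japanese_deriv:
  "((\<lambda>t. japanese a (z + t *\<^sub>R axis i 1)) has_real_derivative japanese_partial a i (z + t *\<^sub>R axis i 1)) (at t)"
proof -
  have eq: "1 + (z + t *\<^sub>R axis i 1) \<bullet> (z + t *\<^sub>R axis i 1) = 1 + z \<bullet> z + 2 * t * z $ i + t * t" for t
    by (simp add: inner_add_left inner_add_right inner_axis inner_axis' algebra_simps)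
  have pos: "0 < 1 + z \<bullet> z + 2 * t * z $ i + t * t"
    unfolding eq[symmetric] by (simp add: add_pos_nonneg)
  have "((\<lambda>s. 1 + z \<bullet> z + 2 * s * z $ i + s * s) has_real_derivative 2 * (z + t *\<^sub>R axis i 1) $ i) (at t)"
    by (auto intro!: derivative_eq_intros)
  from DERIV_chain2[OF has_real_derivative_powr[OF pos, of "- a"] this]
  show ?thesis
    unfolding japanese_def japanese_partial_def eq by (simp add: mult_ac)
qed

lemma abs_japanese_partial_le:
  assumes "a \<ge> 0"
  shows "\<bar>japanese_partial a i z\<bar> \<le> 2 * a * japanese (a + 1/2) z"
proof -
  have "0 < 1 + z \<bullet> z" using inner_ge_zero[of z] by linarith
  have "\<bar>z $ i\<bar> \<le> norm z" by (rule component_le_norm_cart)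
  also have "\<dots> \<le> sqrt (1 + z \<bullet> z)" by (simp add: norm_eq_sqrt_inner)
  also have "\<dots> = (1 + z \<bullet> z) powr (1/2)" using \<open>0 < 1 + z \<bullet> z\<close> by (simp add: powr_half_sqrt)
  finally have "\<bar>z $ i\<bar> * japanese (a + 1) z \<le> (1 + z \<bullet> z) powr (1/2) * japanese (a + 1) z"
    using japanese_bounds(1)[of "a + 1" z] by (intro mult_right_mono) auto
  also have "\<dots> = japanese (a + 1/2) z" unfolding japanese_def powr_add[symmetric] by (rule arg_cong[where f="\<lambda>s. (1 + z \<bullet> z) powr s"]) simp
  finally have "2 * a * (\<bar>z $ i\<bar> * japanese (a + 1) z) \<le> 2 * a * japanese (a + 1/2) z"
    using assms by (intro mult_left_mono) auto
  then show ?thesis using assms japanese_bounds(1)[of "a + 1" z]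
    by (simp add: japanese_partial_def abs_mult mult_ac)
qed

lemma japanese_tendsto_0: "a > 0 \<Longrightarrow> (japanese a \<longlongrightarrow> 0) (at_infinity :: 'a::euclidean_space filter)"
proof -
  assume a: "a > 0"
  have "filterlim (\<lambda>z::'a. 1 + norm z ^ 2) at_top at_infinity"
    by (intro filterlim_tendsto_add_at_top[OF tendsto_const] filterlim_pow_at_top filterlim_norm_at_top) auto
  then have "((\<lambda>z::'a. (1 + norm z ^ 2) powr (- a)) \<longlongrightarrow> 0) at_infinity"
    using a by (intro tendsto_neg_powr) auto
  then show ?thesis by (simp add: japanese_def[abs_def] dot_square_norm)
qed

text \<open>Split 2 = 11/6 + 1/6. The power 1/6 of the hypothesis supplies
  \<open>k powr (1/11)\<close>, which cancels the negative power exactly.\<close>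

lemma powr_le_of_mult_le:
  fixes k :: real
  assumes "0 < r" "0 < k" "0 < C" "r \<le> C * k powr (6/11)"
  shows "r ^ 2 * k powr (- (1/11)) \<le> C powr (1/6) * r powr (11/6)"
proof -
  have "r powr (1/6) \<le> (C * k powr (6/11)) powr (1/6)"
    using assms by (intro powr_mono2) auto
  also have "\<dots> = C powr (1/6) * k powr (1/11)" using assms by (simp add: powr_mult powr_powr)
  finally have "r powr (1/6) * k powr (- (1/11)) \<le> C powr (1/6) * k powr (1/11) * k powr (- (1/11))"
    by (intro mult_right_mono) auto
  also have "\<dots> = C powr (1/6)" using assms by (simp add: mult.assoc flip: powr_add)
  finally have "r powr (11/6) * (r powr (1/6) * k powr (- (1/11))) \<le> r powr (11/6) * C powr (1/6)"
    by (intro mult_left_mono) auto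
  moreover have "r ^ 2 = r powr (11/6) * r powr (1/6)"
    using assms by (simp add: powr_numeral flip: powr_add)
  ultimately show ?thesis by (simp only: mult.assoc mult.commute[of _ "C powr (1/6)"])
qed

context weak_vorticity_flow
begin

definition kap_partial :: "3 \<Rightarrow> real^3 \<Rightarrow> real" where
  "kap_partial i = conv wt (japanese_partial (7/10) i)"

text \<open>A majorant for the gradient of \<open>kap\<close>: differentiating the kernel gains one
  power of decay, and 6/5 = 7/10 + 1/2.\<close>

definition kap1 :: "real^3 \<Rightarrow> real" where "kap1 = conv wt (japanese (6/5))"

lemma continuous_conv_wt: "a \<ge> 0 \<Longrightarrow> continuous_on S (conv wt (japanese a))"
  by (rule continuous_conv[OF integrable_wt continuous_japanese japanese_abs])

lemma continuous_kap: "continuous_on S kap"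
  unfolding kap_def by (rule continuous_conv_wt) simp

lemma japanese_partial_bounded: "\<bar>japanese_partial (7/10) i z\<bar> \<le> 7/5"
  using abs_japanese_partial_le[of "7/10" i z] japanese_bounds(2)[of "6/5" z] by simp

lemma continuous_kap_partial: "continuous_on S (kap_partial i)"
  unfolding kap_partial_def
  by (rule continuous_conv[OF integrable_wt continuous_japanese_partial japanese_partial_bounded])

lemma kap_deriv: "((\<lambda>t. kap (x + t *\<^sub>R axis i 1)) has_real_derivative kap_partial i x) (at 0)"
  unfolding kap_def kap_partial_def
  by (rule conv_directional_derivative[OF integrable_wt continuous_japanese continuous_japanese_partial
      japanese_abs japanese_partial_bounded japanese_deriv]) simp

lemma kap_tendsto_0: "(kap \<longlongrightarrow> 0) at_infinity"
  unfolding kap_def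
  by (rule conv_tendsto_0[OF integrable_wt continuous_japanese japanese_abs japanese_tendsto_0]) simp_all

lemma kap1_nonneg: "kap1 x \<ge> 0"
  unfolding kap1_def by (intro conv_nonneg wt_nonneg less_imp_le[OF japanese_bounds(1)])

lemma abs_kap_partial_le: "\<bar>kap_partial i x\<bar> \<le> 7/5 * kap1 x"
proof -
  have m: "japanese_partial (7/10) i \<in> borel_measurable borel"
    by (rule borel_measurable_continuous_onI[OF continuous_japanese_partial])
  have "\<bar>kap_partial i x\<bar> \<le> (LBINT y. \<bar>wt y * japanese_partial (7/10) i (x - y)\<bar>)"
    unfolding kap_partial_def conv_def by (rule integral_abs_bound)
  also have "\<dots> \<le> (LBINT y. 7/5 * (wt y * japanese (6/5) (x - y)))"
  proof (intro integral_mono integrable_abs conv_integrand_integrable[OF integrable_wt m japanese_partial_bounded]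
      integrable_mult_right wt_japanese_integrable)
    fix y
    have "wt y * \<bar>japanese_partial (7/10) i (x - y)\<bar> \<le> wt y * (7/5 * japanese (6/5) (x - y))"
      using abs_japanese_partial_le[of "7/10" i "x - y"] by (intro mult_left_mono wt_nonneg) auto
    then show "\<bar>wt y * japanese_partial (7/10) i (x - y)\<bar> \<le> 7/5 * (wt y * japanese (6/5) (x - y))"
      by (simp add: abs_mult wt_nonneg)
  qed auto
  also have "\<dots> = 7/5 * kap1 x" by (simp add: kap1_def conv_def)
  finally show ?thesis .
qed

text \<open>Cauchy--Schwarz for the weight \<open>wt\<close>, as 2 * 6/5 = 7/10 + 17/10, obtained
  from the arithmetic-geometric mean inequality with a parameter. The second factor is integrable
  because 17/10 > 3/2, which makes |grad kap|^2/kap integrable.\<close>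

lemma kap1_squared_le: "kap1 x ^ 2 \<le> kap x * conv wt (japanese (17/10)) x"
proof -
  define k2 where "k2 = conv wt (japanese (17/10)) x"
  have k2: "k2 \<ge> 0" unfolding k2_def by (intro conv_nonneg wt_nonneg less_imp_le[OF japanese_bounds(1)])
  have le: "2 * kap1 x \<le> t * kap x + k2 / t" if t: "t > 0" for t
  proof -
    have "2 * kap1 x = (LBINT y. 2 * (wt y * japanese (6/5) (x - y)))" by (simp add: kap1_def conv_def)
    also have "\<dots> \<le> (LBINT y. t * (wt y * japanese (7/10) (x - y)) + (wt y * japanese (17/10) (x - y)) / t)"
    proof (intro integral_mono Bochner_Integration.integrable_add integrable_mult_right integrable_divide wt_japanese_integrable)
      fix y
      define A where "A = japanese (7/10) (x - y)"
      define B where "B = japanese (17/10) (x - y)"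
      define D where "D = japanese (6/5) (x - y)"
      have D: "D * D = A * B" by (simp add: A_def B_def D_def japanese_mult)
      have AB: "A > 0" "B > 0" by (simp_all add: A_def B_def japanese_bounds)
      have "(2 * t * D) ^ 2 \<le> (t * t * A + B) ^ 2"
      proof -
        have "(t * t * A + B) ^ 2 - (2 * t * D) ^ 2 = (t * t * A - B) ^ 2"
          using D by (simp add: power2_eq_square algebra_simps)
        then show ?thesis by (smt (verit) zero_le_power2)
      qed
      then have "2 * t * D \<le> t * t * A + B" by (rule power2_le_imp_le) (use AB t in simp)
      then have "2 * D \<le> t * A + B / t" using t by (simp add: field_simps)
      then have "wt y * (2 * D) \<le> wt y * (t * A + B / t)" by (intro mult_left_mono wt_nonneg)
      then show "2 * (wt y * D) \<le> t * (wt y * A) + wt y * B / t" by (simp add: algebra_simps)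
    qed auto
    also have "\<dots> = t * kap x + k2 / t"
      using wt_japanese_integrable[of "7/10" x] wt_japanese_integrable[of "17/10" x]
      by (simp add: kap_def k2_def conv_def)
    finally show ?thesis .
  qed
  show ?thesis
  proof (cases "kap1 x = 0")
    case True
    then show ?thesis using kap_nonneg k2 by (simp add: k2_def[symmetric])
  next
    case False
    then have k1: "kap1 x > 0" using kap1_nonneg[of x] by linarith
    have m: "mass > 0"
    proof (rule ccontr)
      assume "\<not> mass > 0"
      then have "mass = 0" using mass_nonneg by linarith
      then have "wt y = 0" for y using rho_eq_0_of_mass by (simp add: wt_def)
      then show False using k1 by (simp add: kap1_def conv_def)
    qed
    note k = kap_pos[OF m, of x]
    \<comment> \<open>With this parameter the first term on the right equals \<open>kap1 x\<close>
      and is absorbed on the left.\<close>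
    have "2 * kap1 x \<le> (kap1 x / kap x) * kap x + k2 / (kap1 x / kap x)"
      by (rule le) (use k k1 in simp)
    then have "kap1 x \<le> k2 * kap x / kap1 x" using k by simp
    then show ?thesis using k1 by (simp add: k2_def[symmetric] field_simps power2_eq_square)
  qed
qed

lemma integrable_conv_wt: "a > 3/2 \<Longrightarrow> integrable lborel (conv wt (japanese a))"
  by (intro integrable_conv integrable_wt integrable_japanese) simp

text \<open>Jensen's inequality raises the kernel to the power 11/5, and 77/50 = 7/10 * 11/5 exceeds
  3/2. Hence this power of \<open>kap\<close> is integrable.\<close>

lemma kap_powr_le: "kap x powr (11/5) \<le> (2 * mass powr (6/11)) powr (11/5) * conv wt (japanese (77/50)) x"
proof -
  have jp: "japanese (7/10) z powr (11/5) = japanese (77/50) z" for z :: "real^3" by (simp add: japanese_powr)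
  have "(LBINT y. wt y * japanese (7/10) (x - y))
     \<le> 2 * (LBINT y. wt y) powr (1 - 1 / (11/5)) * (LBINT y. wt y * japanese (7/10) (x - y) powr (11/5)) powr (1 / (11/5))"
    by (rule powr_jensen) (auto simp: jp integrable_wt wt_nonneg less_imp_le[OF japanese_bounds(1)] intro!: wt_japanese_integrable)
  then have "kap x \<le> (2 * mass powr (6/11)) * conv wt (japanese (77/50)) x powr (5/11)"
    by (simp add: kap_def conv_def mass_def jp)
  then have "kap x powr (11/5) \<le> ((2 * mass powr (6/11)) * conv wt (japanese (77/50)) x powr (5/11)) powr (11/5)"
    by (intro powr_mono2 kap_nonneg) auto
  also have "\<dots> = (2 * mass powr (6/11)) powr (11/5) * conv wt (japanese (77/50)) x"
    using conv_nonneg[of wt "japanese (77/50)" x, OF wt_nonneg less_imp_le[OF japanese_bounds(1)]]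
    by (simp add: powr_mult powr_powr)
  finally show ?thesis .
qed

text \<open>Here the margin of 167/165 over 1 is spent: Young's inequality under the integral sign
  has to leave two kernels whose exponents 77/50 and 121/80 both exceed 3/2.\<close>

lemma integrable_kap_kap1: "integrable lborel (\<lambda>x. kap x powr (5/11) * kap1 x)"
proof (rule Bochner_Integration.integrable_bound)
  define D where "D = (2 * mass powr (6/11)) powr (11/5)"
  show "integrable lborel (\<lambda>x. mass * (D * conv wt (japanese (77/50)) x) + conv wt (japanese (121/80)) x)"
    by (intro Bochner_Integration.integrable_add integrable_mult_right integrable_conv_wt) auto
  show "AE x in lborel. norm (kap x powr (5/11) * kap1 x) \<le> norm (mass * (D * conv wt (japanese (77/50)) x) + conv wt (japanese (121/80)) x)"
  proof (rule AE_I2)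
    fix x
    have "kap x powr (5/11) * kap1 x = (LBINT y. wt y * (kap x powr (5/11) * japanese (6/5) (x - y)))"
      by (simp add: kap1_def conv_def mult.left_commute[of "wt _"])
    also have "\<dots> \<le> (LBINT y. kap x powr (11/5) * wt y + wt y * japanese (121/80) (x - y))"
    proof (intro integral_mono Bochner_Integration.integrable_add integrable_mult_right integrable_wt wt_japanese_integrable)
      show "integrable lborel (\<lambda>y. wt y * (kap x powr (5/11) * japanese (6/5) (x - y)))"
        using integrable_mult_right[OF wt_japanese_integrable[of "6/5" x], of "kap x powr (5/11)"] by (simp add: mult.left_commute)
      fix y
      define J where "J = japanese (6/5) (x - y)"
      have J: "J > 0" by (simp add: J_def japanese_bounds)
      \<comment> \<open>The exponents are conjugate, 25/121 + 96/121 = 1. The first turns 5/11 into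
        the 11/5 of \<open>kap_powr_le\<close>, the second turns 6/5 into 121/80.\<close>
      have "kap x powr (5/11) * J \<le> (kap x powr (5/11)) powr (121/25) / (121/25) + J powr (121/96) / (121/96)"
        using J by (intro Youngs_inequality) auto
      also have "(kap x powr (5/11)) powr (121/25) = kap x powr (11/5)" by (simp add: powr_powr)
      also have "J powr (121/96) = japanese (121/80) (x - y)" by (simp add: J_def japanese_powr)
      finally have "kap x powr (5/11) * J \<le> kap x powr (11/5) / (121/25) + japanese (121/80) (x - y) / (121/96)" .
      moreover have "X \<le> a / (121/25) + b / (121/96) \<Longrightarrow> 0 \<le> a \<Longrightarrow> 0 < b \<Longrightarrow> X \<le> a + b" for X a b :: real
        by (simp add: field_simps)
      ultimately have "kap x powr (5/11) * J \<le> kap x powr (11/5) + japanese (121/80) (x - y)"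
        using powr_ge_zero[of "kap x" "11/5"] japanese_bounds(1)[of "121/80" "x - y"] by blast
      from mult_left_mono[OF this wt_nonneg[of y]]
      show "wt y * (kap x powr (5/11) * J) \<le> kap x powr (11/5) * wt y + wt y * japanese (121/80) (x - y)"
        by (simp add: algebra_simps)
    qed auto
    also have "\<dots> = mass * kap x powr (11/5) + conv wt (japanese (121/80)) x"
      using integrable_wt wt_japanese_integrable[of "121/80" x] by (simp add: mass_def conv_def)
    also have "\<dots> \<le> mass * (D * conv wt (japanese (77/50)) x) + conv wt (japanese (121/80)) x"
      unfolding D_def by (intro add_right_mono mult_left_mono kap_powr_le mass_nonneg)
    finally show "norm (kap x powr (5/11) * kap1 x) \<le> norm (mass * (D * conv wt (japanese (77/50)) x) + conv wt (japanese (121/80)) x)"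
      using kap1_nonneg[of x] by (simp add: abs_mult)
  qed
  show "(\<lambda>x. kap x powr (5/11) * kap1 x) \<in> borel_measurable lborel"
  proof -
    have "kap \<in> borel_measurable borel" "kap1 \<in> borel_measurable borel"
      unfolding kap1_def by (auto intro!: borel_measurable_continuous_onI continuous_kap continuous_conv_wt)
    then show ?thesis by simp
  qed
qed

lemma V_kap_partial_le: "\<exists>C>0. \<forall>x i. \<bar>V i x * kap_partial i x\<bar> \<le> C * (kap x powr (5/11) * kap1 x)"
proof -
  obtain C where C: "C > 0" "\<And>x j. \<bar>V j x\<bar> \<le> C * kap x powr (5/11)" using V_le_kap by blast
  have "\<bar>V i x * kap_partial i x\<bar> \<le> (C * (7/5)) * (kap x powr (5/11) * kap1 x)" for x i
    using mult_mono[OF C(2)[where x=x and j=i] abs_kap_partial_le[of i x]] C(1) by (simp add: abs_mult mult_ac kap_nonneg)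
  then show ?thesis using C by (intro exI[of _ "C * (7/5)"]) auto
qed

lemma kap_partial_squared_le: "kap_partial i x ^ 2 \<le> 2 * (kap x * conv wt (japanese (17/10)) x)"
proof -
  have "kap_partial i x ^ 2 \<le> (7/5 * kap1 x) ^ 2"
    using abs_kap_partial_le[of i x] by (metis abs_ge_zero power2_abs power_mono)
  also have "\<dots> = 49/25 * kap1 x ^ 2" by (simp add: power2_eq_square)
  also have "\<dots> \<le> 2 * kap1 x ^ 2" by (intro mult_right_mono) auto
  also have "\<dots> \<le> 2 * (kap x * conv wt (japanese (17/10)) x)" using kap1_squared_le[of x] by simp
  finally show ?thesis .
qed

text \<open>The velocity bound gives the power 10/11 of \<open>kap x\<close> times
  \<open>rho x ^ 2\<close>; \<open>rho_le_kap\<close> trades the surplus 1/6 in the power of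
  \<open>rho x\<close> for the missing 1/11.\<close>

lemma lamb_squared_le: "\<exists>C>0. \<forall>x i. lamb i x ^ 2 \<le> C * (kap x * wt x)"
proof -
  obtain C where C: "C > 0" "\<And>x j. \<bar>V j x\<bar> \<le> C * kap x powr (5/11)" using V_le_kap by blast
  obtain C1 where C1: "C1 > 0" "\<And>x y. dist x y \<le> 1 \<Longrightarrow> rho y \<le> C1 * kap x powr (6/11)"
    using rho_le_kap by blast
  define D where "D = 81 * C ^ 2 * C1 powr (1/6)"
  have "lamb i x ^ 2 \<le> D * (kap x * wt x)" for x i
  proof (cases "rho x = 0")
    case True
    then have "lamb i x = 0" using abs_lamb_le[of i x] by simp
    then show ?thesis using C C1 kap_nonneg wt_nonneg by (simp add: D_def)
  next
    case False
    then have r: "rho x > 0" using rho_nonneg[of x] by linarith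
    have "mass \<noteq> 0" using False rho_eq_0_of_mass by blast
    then have k: "kap x > 0" using kap_pos mass_nonneg by (simp add: less_le)
    have "norm (v x) \<le> (\<Sum>j\<in>UNIV. \<bar>V j x\<bar>)" by (rule norm_le_l1_cart)
    also have "\<dots> \<le> (\<Sum>j\<in>(UNIV::3 set). C * kap x powr (5/11))" by (intro sum_mono C)
    finally have "norm (v x) \<le> 3 * (C * kap x powr (5/11))" by simp
    from mult_right_mono[OF this, of "rho x"]
    have "\<bar>lamb i x\<bar> \<le> 9 * (C * kap x powr (5/11) * rho x)"
      using abs_lamb_le[of i x] r by (simp only: mult.assoc) linarith
    then have "\<bar>lamb i x\<bar> \<le> 9 * C * kap x powr (5/11) * rho x" by (simp only: mult.assoc)
    then have "lamb i x ^ 2 \<le> (9 * C * kap x powr (5/11) * rho x) ^ 2"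
      by (metis abs_ge_zero power2_abs power_mono)
    also have "\<dots> = 81 * C ^ 2 * (kap x powr (10/11) * rho x ^ 2)"
      by (simp add: power2_eq_square mult_ac flip: powr_add)
    also have "kap x powr (10/11) = kap x * kap x powr (- (1/11))"
      using k powr_add[of "kap x" 1 "- (1/11)"] by simp
    also have "81 * C ^ 2 * (kap x * kap x powr (- (1/11)) * rho x ^ 2) = 81 * C ^ 2 * kap x * (rho x ^ 2 * kap x powr (- (1/11)))"
      by simp
    also have "\<dots> \<le> 81 * C ^ 2 * kap x * (C1 powr (1/6) * rho x powr (11/6))"
      using k C C1(1) by (intro mult_left_mono powr_le_of_mult_le r C1) auto
    finally show ?thesis by (simp add: D_def wt_def mult_ac)
  qed
  moreover have "D > 0" using C C1 by (simp add: D_def)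
  ultimately show ?thesis by blast
qed

end

section \<open>Testing with compactly supported functions\<close>

text \<open>The test functions are truncations and only continuously differentiable, so
  \<open>smooth\<close> does not fit. The partial derivatives are carried along as data, and the
  chain rule then names them explicitly.\<close>

definition C1_fun :: "(real^'n \<Rightarrow> real) \<Rightarrow> ('n \<Rightarrow> real^'n \<Rightarrow> real) \<Rightarrow> bool" where
  "C1_fun g g' \<longleftrightarrow> continuous_on UNIV g \<and> (\<forall>i. continuous_on UNIV (g' i)) \<and>
    (\<forall>i x. ((\<lambda>t. g (x + t *\<^sub>R axis i 1)) has_real_derivative g' i x) (at 0))"

lemma C1_fun_smooth: "smooth u \<Longrightarrow> C1_fun u (\<lambda>i. pd i u)"
  using axis_derivative[of u _ _ 0] by (auto simp: C1_fun_def smooth_continuous_on smooth_pd)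

lemma C1_fun_add: "C1_fun f f' \<Longrightarrow> C1_fun g g' \<Longrightarrow> C1_fun (\<lambda>x. f x + g x) (\<lambda>i x. f' i x + g' i x)"
  unfolding C1_fun_def by (auto intro!: continuous_intros derivative_intros)

lemma C1_fun_cmult: "C1_fun g g' \<Longrightarrow> C1_fun (\<lambda>x. c * g x) (\<lambda>i x. c * g' i x)"
  unfolding C1_fun_def by (auto intro!: continuous_intros DERIV_cmult)

lemma C1_fun_compose:
  assumes H: "C1_fun H H'" and S: "\<And>x. H x \<in> S"
    and f: "\<And>t. t \<in> S \<Longrightarrow> (f has_real_derivative f' t) (at t)" and f': "continuous_on S f'"
  shows "C1_fun (\<lambda>x. f (H x)) (\<lambda>i x. f' (H x) * H' i x)"
proof -
  have "continuous_on S f"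
    by (rule DERIV_continuous_on[where D=f']) (use f has_field_derivative_at_within in blast)
  then have "continuous_on UNIV (\<lambda>x. f (H x))" "continuous_on UNIV (\<lambda>x. f' (H x))"
    using H S f' by (auto simp: C1_fun_def intro: continuous_on_compose2)
  moreover have "((\<lambda>t. f (H (x + t *\<^sub>R axis i 1))) has_real_derivative f' (H x) * H' i x) (at 0)" for i x
    using H S by (intro DERIV_chain2[where f=f]) (auto simp: C1_fun_def intro!: f)
  ultimately show ?thesis using H by (auto simp: C1_fun_def intro!: continuous_intros)
qed

lemma C1_fun_support: "C1_fun g g' \<Longrightarrow> (\<And>x. norm x > R \<Longrightarrow> g x = 0) \<Longrightarrow> norm x > R \<Longrightarrow> g' i x = 0"
  unfolding C1_fun_def using directional_derivative_support by blast

lemma integral_by_parts_divergence: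
  fixes w :: "'n::finite \<Rightarrow> real^'n \<Rightarrow> real"
  assumes g: "C1_fun g g'" and supp: "\<And>x. norm x > R \<Longrightarrow> g x = 0" and w: "\<And>i. smooth (w i)"
  shows "(LBINT x. (\<Sum>i\<in>UNIV. g' i x * w i x)) = - (LBINT x. g x * (\<Sum>i\<in>UNIV. pd i (w i) x))"
proof -
  have c: "continuous_on UNIV g" "continuous_on UNIV (g' i)" for i using g by (auto simp: C1_fun_def)
  have cw: "continuous_on UNIV (w i)" "continuous_on UNIV (pd i (w i))" for i
    by (intro smooth_continuous_on smooth_pd w)+
  define G where "G i x = g' i x * w i x + pd i (w i) x * g x" for i x
  have cG: "continuous_on UNIV (\<lambda>x. g x * w i x)" "continuous_on UNIV (G i)" for i
    unfolding G_def by (intro continuous_intros c cw)+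
  have dG: "((\<lambda>t. g (x + t *\<^sub>R axis i 1) * w i (x + t *\<^sub>R axis i 1)) has_real_derivative G i x) (at 0)" for i x
    using DERIV_mult[of "\<lambda>t. g (x + t *\<^sub>R axis i 1)" "g' i x" 0 UNIV "\<lambda>t. w i (x + t *\<^sub>R axis i 1)"]
      g axis_derivative[OF w[of i], of x i 0 UNIV] by (simp add: C1_fun_def G_def)
  have sG: "g x * w i x = 0" if "norm x > R" for x i using supp[OF that] by simp
  note 1 = integral_directional_derivative_eq_0[OF cG sG dG]
  have i1: "integrable lborel (\<lambda>x. \<Sum>i\<in>UNIV. g' i x * w i x)"
    by (rule integrable_continuous_support[of _ R])
      (auto intro!: continuous_intros c cw simp: C1_fun_support[OF g supp])
  have i2: "integrable lborel (\<lambda>x. g x * (\<Sum>i\<in>UNIV. pd i (w i) x))"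
    by (rule integrable_continuous_support[of _ R]) (auto intro!: continuous_intros c cw simp: supp)
  have "0 = (LBINT x. (\<Sum>i\<in>UNIV. G i x))"
    using 1 by (subst Bochner_Integration.integral_sum) auto
  also have "(\<lambda>x. \<Sum>i\<in>UNIV. G i x) = (\<lambda>x. (\<Sum>i\<in>UNIV. g' i x * w i x) + g x * (\<Sum>i\<in>UNIV. pd i (w i) x))"
    by (simp add: G_def sum.distrib sum_distrib_left mult.commute)
  finally show ?thesis using i1 i2 by simp
qed

lemma continuous_integral_eq_0:
  fixes f :: "real^'n \<Rightarrow> real"
  assumes f: "continuous_on UNIV f" "\<And>x. f x \<ge> 0" "integrable lborel f" "(LBINT x. f x) = 0"
  shows "f x = 0"
proof (rule ccontr)
  assume "f x \<noteq> 0"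
  then have d: "f x > 0" using f(2)[of x] by linarith
  have "isCont f x" using f(1) by (simp add: continuous_on_eq_continuous_at)
  then obtain r where r: "r > 0" "\<And>y. dist y x < r \<Longrightarrow> dist (f y) (f x) < f x / 2"
    using d unfolding continuous_at_eps_delta by (metis half_gt_zero)
  have "(LBINT y. indicator (cball x (r/2)) y * (f x / 2)) \<le> (LBINT y. f y)"
  proof (intro integral_mono integrable_indicator_cball f continuous_intros)
    fix y
    have "f x / 2 \<le> f y" if "dist x y \<le> r / 2"
    proof -
      have "dist y x < r" using that r(1) by (simp add: dist_commute)
      from r(2)[OF this] show ?thesis unfolding dist_real_def by linarith
    qed
    then show "indicator (cball x (r/2)) y * (f x / 2) \<le> f y" using f(2)[of y] by (auto simp: indicator_def)
  qed
  moreover have "0 < (LBINT y. indicator (cball x (r/2)) y * (f x / 2))"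
    using d r by (simp add: content_cball)
  ultimately show False using f(4) by simp
qed

text \<open>A power with small \<open>a\<close> acts as a logarithmic cutoff: it tends to 1 at each
  positive level, while its derivative is of size \<open>a / t\<close>. Subtracting \<eta> and
  squaring the positive part gives a C1 function that vanishes near 0.\<close>

definition cutoff :: "real \<Rightarrow> real \<Rightarrow> real \<Rightarrow> real" where
  "cutoff a \<eta> t = max 0 (t powr a - \<eta>) ^ 2"

definition cutoff_deriv :: "real \<Rightarrow> real \<Rightarrow> real \<Rightarrow> real" where
  "cutoff_deriv a \<eta> t = 2 * max 0 (t powr a - \<eta>) * (a * t powr (a - 1))"

lemma cutoff_has_derivative: "t > 0 \<Longrightarrow> (cutoff a \<eta> has_real_derivative cutoff_deriv a \<eta> t) (at t)"
proof -
  assume t: "t > 0"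
  have "((\<lambda>t. t powr a - \<eta>) has_real_derivative a * t powr (a - 1)) (at t)"
    using DERIV_diff[OF has_real_derivative_powr[OF t] DERIV_const] by simp
  from DERIV_chain2[OF DERIV_max0_power[of 0, where S=UNIV] this]
  show ?thesis unfolding cutoff_def[abs_def] cutoff_deriv_def by (simp add: numeral_2_eq_2)
qed

lemma continuous_cut_deriv: "continuous_on {0<..} (cutoff_deriv a \<eta>)"
  unfolding cutoff_deriv_def[abs_def] by (intro continuous_intros) auto

lemma cutoff_bounds:
  assumes "0 < a" "a \<le> 1" "0 \<le> \<eta>" "0 < t" "t \<le> T" "1 \<le> T"
  shows "0 \<le> cutoff a \<eta> t" "cutoff a \<eta> t \<le> T ^ 2" "0 \<le> cutoff_deriv a \<eta> t" "cutoff_deriv a \<eta> t \<le> 2 * a * T ^ 2 / t"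
proof -
  have "t powr a \<le> T powr a" using assms by (intro powr_mono2) auto
  also have "\<dots> \<le> T powr 1" using assms by (intro powr_mono) auto
  finally have tT: "t powr a \<le> T" using assms by simp
  then have m: "max 0 (t powr a - \<eta>) \<le> T" using assms by simp
  show "0 \<le> cutoff a \<eta> t" by (simp add: cutoff_def)
  show "cutoff a \<eta> t \<le> T ^ 2" unfolding cutoff_def using m by (intro power_mono) auto
  show "0 \<le> cutoff_deriv a \<eta> t" using assms by (simp add: cutoff_deriv_def)
  have "cutoff_deriv a \<eta> t = 2 * a * (max 0 (t powr a - \<eta>) * t powr a) / t"
    using assms by (simp add: cutoff_deriv_def powr_diff)
  also have "\<dots> \<le> 2 * a * (T * T) / t"
    using assms m tT by (intro divide_right_mono mult_left_mono mult_mono) auto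
  finally show "cutoff_deriv a \<eta> t \<le> 2 * a * T ^ 2 / t" by (simp add: power2_eq_square)
qed

lemma cutoff_eq_0:
  assumes "0 < a" "0 < \<eta>" "0 \<le> t" "t \<le> \<eta> powr (1/a)"
  shows "cutoff a \<eta> t = 0"
proof -
  have "t powr a \<le> (\<eta> powr (1/a)) powr a" using assms by (intro powr_mono2) auto
  then have "t powr a \<le> \<eta>" using assms by (simp add: powr_powr)
  then show ?thesis by (simp add: cutoff_def)
qed

text \<open>The primitive is taken from 0 so that it vanishes at low levels; composed with a
  positive function that tends to 0 at infinity it has compact support, as
  \<open>transport_identity\<close> requires.\<close>

lemma cutoff_antiderivative:
  assumes "0 < a" "0 < \<eta>"
  obtains F where "\<And>t. t > 0 \<Longrightarrow> (F has_real_derivative cutoff a \<eta> t) (at t)"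
    "\<And>t. 0 < t \<Longrightarrow> t \<le> \<eta> powr (1/a) \<Longrightarrow> F t = 0"
proof -
  define F where "F t = integral {0..t} (cutoff a \<eta>)" for t
  have c: "continuous_on {0..b} (cutoff a \<eta>)" for b
    unfolding cutoff_def[abs_def] using assms by (intro continuous_intros continuous_on_powr') auto
  show ?thesis
  proof (rule that)
    fix t :: real assume t: "t > 0"
    have "(F has_real_derivative cutoff a \<eta> t) (at t within {0..t+1})"
      unfolding F_def[abs_def] using t by (intro integral_has_real_derivative c) auto
    then show "(F has_real_derivative cutoff a \<eta> t) (at t)"
      using t by (simp add: at_within_Icc_at)
  next
    fix t assume t: "0 < t" "t \<le> \<eta> powr (1/a)"
    have "integral {0..t} (cutoff a \<eta>) = integral {0..t} (\<lambda>s. 0)"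
      by (rule integral_cong) (use t assms in \<open>auto intro!: cutoff_eq_0\<close>)
    then show "F t = 0" by (simp add: F_def)
  qed
qed

lemma cutoff_tendsto_1:
  assumes "t > 0"
  shows "(\<lambda>n. cutoff (inverse (real (Suc n))) (exp (- real (Suc n))) t) \<longlonglongrightarrow> 1"
proof -
  have "(\<lambda>n. t powr inverse (real (Suc n))) \<longlonglongrightarrow> t powr 0"
    using assms by (intro tendsto_powr tendsto_const LIMSEQ_inverse_real_of_nat) auto
  moreover have "(\<lambda>n. exp (- real (Suc n))) \<longlonglongrightarrow> 0"
    by (rule filterlim_compose[OF exp_at_bot])
      (use filterlim_compose[OF filterlim_real_sequentially filterlim_Suc] in \<open>simp add: filterlim_uminus_at_bot add.commute\<close>)
  ultimately have "(\<lambda>n. max 0 (t powr inverse (real (Suc n)) - exp (- real (Suc n))) ^ 2) \<longlonglongrightarrow> max 0 (t powr 0 - 0) ^ 2"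
    by (intro tendsto_power tendsto_max tendsto_const tendsto_diff)
  then show ?thesis using assms by (simp add: cutoff_def)
qed

section \<open>Integral identities for the flow and the sign of the head\<close>

context weak_vorticity_flow
begin

lemma energy_identity:
  assumes g: "C1_fun g g'" and supp: "\<And>x. norm x > R \<Longrightarrow> g x = 0"
  shows "(LBINT x. g x * rho x ^ 2) = (LBINT x. g x * (\<Sum>j\<in>UNIV. V j x * pd j head x))
    + (LBINT x. (\<Sum>j\<in>UNIV. g' j x * lamb j x))"
proof -
  have c: "continuous_on UNIV g" using g by (auto simp: C1_fun_def)
  have cl: "continuous_on UNIV (pd j (lamb j))" for j
    by (intro smooth_continuous_on smooth_pd smooth_lamb)
  have "integrable lborel (\<lambda>x. g x * rho x ^ 2)"
    by (rule integrable_continuous_support[of _ R]) (auto intro!: continuous_intros c continuous_rho simp: supp)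
  moreover have "integrable lborel (\<lambda>x. g x * (\<Sum>j\<in>UNIV. pd j (lamb j) x))"
    by (rule integrable_continuous_support[of _ R]) (auto intro!: continuous_intros c cl simp: supp)
  ultimately show ?thesis
    by (simp add: V_grad_head distrib_left integral_by_parts_divergence[OF g supp smooth_lamb])
qed

lemma head_lamb_orthogonal:
  assumes g: "C1_fun g g'" and supp: "\<And>x. norm x > R \<Longrightarrow> g x = 0"
  shows "(LBINT x. (\<Sum>j\<in>UNIV. g' j x * (pd j head x - lamb j x))) = 0"
  using integral_by_parts_divergence[OF g supp, where w="\<lambda>j x. pd j head x - lamb j x"]
  by (simp add: laplace_head smooth_diff smooth_pd smooth_head smooth_lamb)

text \<open>The integrand is the divergence of F(H) v, because F' = f and div v = 0. This is why
  cutoffs are taken as functions of \<open>H\<close>.\<close>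

lemma transport_identity:
  assumes H: "C1_fun H H'" and S: "\<And>x. H x \<in> S"
    and F: "\<And>t. t \<in> S \<Longrightarrow> (F has_real_derivative f t) (at t)" and f: "continuous_on S f"
    and supp: "\<And>x. norm x > R \<Longrightarrow> F (H x) = 0"
  shows "(LBINT x. f (H x) * (\<Sum>j\<in>UNIV. V j x * H' j x)) = 0"
proof -
  have "(LBINT x. (\<Sum>j\<in>UNIV. (f (H x) * H' j x) * V j x)) = - (LBINT x. F (H x) * (\<Sum>j\<in>UNIV. pd j (V j) x))"
    by (rule integral_by_parts_divergence[OF C1_fun_compose[OF H S F f] supp smooth_V])
  then show ?thesis by (simp add: divergence_V sum_distrib_left mult_ac)
qed

definition head0 :: "real^3 \<Rightarrow> real" where "head0 x = head x - Lim at_infinity head"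

lemma head0_tendsto_0: "(head0 \<longlongrightarrow> 0) at_infinity"
proof -
  obtain c where c: "(head \<longlongrightarrow> c) at_infinity" using head_limit by blast
  then have "Lim at_infinity head = c" by (intro tendsto_Lim trivial_limit_at_infinity)
  then show ?thesis using tendsto_diff[OF c tendsto_const[of c]] by (simp add: head0_def[abs_def])
qed

lemma C1_fun_head0: "C1_fun head0 (\<lambda>i. pd i head)"
  using C1_fun_smooth[OF smooth_head] unfolding C1_fun_def head0_def
  by (auto intro!: continuous_intros derivative_eq_intros)

lemma continuous_head0: "continuous_on S head0"
  using C1_fun_head0 continuous_on_subset unfolding C1_fun_def by blast

text \<open>A maximum principle by energy. For H = - h - e the truncation has compact support
  because h tends to 0. The transport term vanishes and \<open>head_lamb_orthogonal\<close> turns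
  the Lamb term into minus the integral of 2 max(0, H) |grad H|^2, so a nonnegative number equals a
  nonpositive one.\<close>

lemma head0_nonneg: "head0 x \<ge> 0"
proof -
  have "- head0 x \<le> e" if e: "e > 0" for e x
  proof -
    define H where "H x = -1 * head0 x + - e" for x
    define H' where "H' i x = -1 * pd i head x + 0" for i x
    have H: "C1_fun H H'" unfolding H_def[abs_def] H'_def[abs_def]
      by (intro C1_fun_add C1_fun_cmult C1_fun_head0) (auto simp: C1_fun_def)
    let ?S = "\<lambda>x. \<Sum>j\<in>UNIV. H' j x ^ 2"
    define g where "g x = max 0 (H x) ^ 2" for x
    define g' where "g' i x = (2 * max 0 (H x)) * H' i x" for i x
    have d2: "((\<lambda>t. max 0 t ^ 2) has_real_derivative 2 * max 0 t) (at t)" for t :: real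
      using DERIV_max0_power[of 0 t UNIV] by (simp add: numeral_2_eq_2)
    have d3: "((\<lambda>t. max 0 t ^ 3 / 3) has_real_derivative max 0 t ^ 2) (at t)" for t :: real
      using DERIV_cdivide[OF DERIV_max0_power[of 1 t UNIV], of 3] by (simp add: numeral_3_eq_3 numeral_2_eq_2)
    have g: "C1_fun g g'" unfolding g_def[abs_def] g'_def[abs_def]
      by (rule C1_fun_compose[OF H, of UNIV]) (auto intro!: d2 continuous_intros)
    obtain R where R: "\<And>x. norm x \<ge> R \<Longrightarrow> \<bar>head0 x\<bar> < e"
      using head0_tendsto_0 e unfolding Lim_at_infinity by (auto simp: dist_real_def)
    have H0: "max 0 (H x) = 0" if "norm x > R" for x using R[of x] that by (auto simp: H_def)
    have gs: "g x = 0" if "norm x > R" for x using H0[OF that] by (simp add: g_def)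
    have cH: "continuous_on UNIV H" "continuous_on UNIV (H' j)" for j using H by (auto simp: C1_fun_def)
    have t: "(LBINT x. max 0 (H x) ^ 2 * (\<Sum>j\<in>UNIV. V j x * H' j x)) = 0"
      by (rule transport_identity[where F="\<lambda>t. max 0 t ^ 3 / 3" and f="\<lambda>t. max 0 t ^ 2" and S=UNIV and R=R, OF H]) (auto intro!: d3 continuous_intros simp: H0)
    have i1: "integrable lborel (\<lambda>x. \<Sum>j\<in>UNIV. g' j x * u j x)" if "\<And>j. smooth (u j)" for u
      by (rule integrable_continuous_support[of _ R])
        (auto intro!: continuous_intros smooth_continuous_on[OF that] cH simp: g'_def H0)
    have "(LBINT x. g x * rho x ^ 2) = (LBINT x. g x * (\<Sum>j\<in>UNIV. V j x * pd j head x))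
       + (LBINT x. (\<Sum>j\<in>UNIV. g' j x * lamb j x))"
      by (rule energy_identity[OF g gs])
    also have "(LBINT x. g x * (\<Sum>j\<in>UNIV. V j x * pd j head x)) = 0"
      using t by (simp add: H'_def sum_negf g_def)
    also have "(LBINT x. (\<Sum>j\<in>UNIV. g' j x * lamb j x)) = (LBINT x. (\<Sum>j\<in>UNIV. g' j x * pd j head x))"
      using head_lamb_orthogonal[OF g gs] i1[of lamb, OF smooth_lamb]
        i1[of "\<lambda>j. pd j head", OF smooth_pd[OF smooth_head]] by (simp add: right_diff_distrib sum_subtractf)
    also have "(\<lambda>x. \<Sum>j\<in>UNIV. g' j x * pd j head x) = (\<lambda>x. - (2 * max 0 (H x) * ?S x))"
      by (simp add: g'_def H'_def sum_distrib_left sum_negf power2_eq_square mult_ac)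
    finally have e1: "(LBINT x. g x * rho x ^ 2) = - (LBINT x. 2 * max 0 (H x) * ?S x)"
      by simp
    have n1: "0 \<le> (LBINT x. g x * rho x ^ 2)"
      by (intro Bochner_Integration.integral_nonneg) (simp add: g_def)
    have nn: "0 \<le> 2 * max 0 (H x) * ?S x" for x
      by (intro mult_nonneg_nonneg sum_nonneg) auto
    have "0 \<le> (LBINT x. 2 * max 0 (H x) * ?S x)"
      by (intro Bochner_Integration.integral_nonneg nn)
    then have z: "(LBINT x. 2 * max 0 (H x) * ?S x) = 0"
      using e1 n1 by linarith
    have zero: "2 * max 0 (H x) * ?S x = 0" for x
    proof (rule continuous_integral_eq_0[OF _ nn _ z])
      show c: "continuous_on UNIV (\<lambda>x. 2 * max 0 (H x) * ?S x)"
        by (intro continuous_intros cH)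
      show "integrable lborel (\<lambda>x. 2 * max 0 (H x) * ?S x)"
        by (rule integrable_continuous_support[OF c, of R]) (simp add: H0)
    qed
    \<comment> \<open>So \<open>g\<close> has zero gradient everywhere; it remains to connect
      \<open>x\<close> by a segment with a point outside the support.\<close>
    have g'0: "g' i x = 0" for i x
    proof (cases "max 0 (H x) = 0")
      case False
      then have "?S x = 0" using zero[of x] by (metis mult_eq_0_iff zero_neq_numeral)
      then have "H' i x ^ 2 = 0" by (subst (asm) sum_nonneg_eq_0_iff) auto
      then show ?thesis by (simp add: g'_def)
    qed (simp only: g'_def mult_zero_right mult_zero_left)
    have der: "((\<lambda>t. g (x + t *\<^sub>R axis 1 1)) has_real_derivative 0) (at t)" for t
    proof -
      have "((\<lambda>s. g ((x + t *\<^sub>R axis 1 1) + s *\<^sub>R axis 1 1)) has_real_derivative 0) (at 0)"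
        using g g'0 by (metis C1_fun_def)
      then show ?thesis
        using DERIV_shift[of "\<lambda>s. g (x + s *\<^sub>R axis 1 1)" 0 0 t] by (simp add: algebra_simps)
    qed
    \<comment> \<open>Large enough that moving by \<open>T\<close> along the first axis leaves the
      ball of radius \<open>R\<close>.\<close>
    define T where "T = \<bar>R\<bar> + norm x + 1"
    have "T = norm (T *\<^sub>R axis 1 1 :: real^3)" by (simp add: T_def)
    also have "\<dots> \<le> norm (x + T *\<^sub>R axis 1 1) + norm x"
      by (metis add_diff_cancel_left' norm_triangle_ineq4)
    finally have "norm (x + T *\<^sub>R axis 1 1) > R" by (simp add: T_def)
    then have "g (x + T *\<^sub>R axis 1 1) = 0" by (rule gs)
    moreover have "g (x + T *\<^sub>R axis 1 1) = g (x + 0 *\<^sub>R axis 1 1)"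
      by (rule DERIV_isconst_all[of "\<lambda>t. g (x + t *\<^sub>R axis 1 1)"]) (use der in blast)
    ultimately have "g x = 0" by simp
    then have "H x \<le> 0" by (simp add: g_def max_def split: if_splits)
    then show ?thesis by (simp add: H_def)
  qed
  from field_le_epsilon[of "- head0 x" 0, OF _] this show ?thesis by (metis add_0 neg_le_0_iff_le)
qed

lemma head0_bounded: "\<exists>T\<ge>0. \<forall>x. head0 x \<le> T"
proof -
  obtain b where "\<forall>x. norm x \<ge> b \<longrightarrow> dist (head0 x) 0 < 1"
    using head0_tendsto_0 zero_less_one unfolding Lim_at_infinity by blast
  then have b: "\<bar>head0 x\<bar> < 1" if "norm x \<ge> b" for x using that by (simp add: dist_real_def)
  have "bounded (head0 ` cball 0 b)"
    by (intro compact_imp_bounded compact_continuous_image continuous_head0) auto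
  then obtain B where "\<forall>x\<in>cball 0 b. norm (head0 x) \<le> B"
    by (auto simp: bounded_iff)
  then have B: "\<bar>head0 x\<bar> \<le> B" if "norm x \<le> b" for x using that by simp
  have "head0 x \<le> max B 1" for x
    using b[of x] B[of x] by (cases "norm x \<le> b") auto
  then show ?thesis by (intro exI[of _ "max B 1"]) auto
qed

end

section \<open>The dissipation estimate and the two limits\<close>

context weak_vorticity_flow
begin

lemma C1_fun_kap: "C1_fun kap kap_partial"
  unfolding C1_fun_def using kap_deriv continuous_kap continuous_kap_partial by blast

lemma level_bounds:
  assumes m: "mass > 0"
  obtains T where "T \<ge> 1" "\<And>c x. 0 < c \<Longrightarrow> 0 < head0 x + c * kap x"
    "\<And>c x. 0 < c \<Longrightarrow> c \<le> 1 \<Longrightarrow> head0 x + c * kap x \<le> T"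
proof -
  obtain T0 where T0: "T0 \<ge> 0" "\<And>x. head0 x \<le> T0" using head0_bounded by blast
  show ?thesis
  proof (rule that[of "T0 + mass + 1"])
    fix c :: real and x assume c: "0 < c"
    show "head0 x + c * kap x > 0"
      using head0_nonneg[of x] mult_pos_pos[OF c kap_pos[OF m, of x]] by linarith
    assume "c \<le> 1"
    then have "c * kap x \<le> 1 * mass" using c kap_le_mass kap_nonneg by (intro mult_mono) auto
    then show "head0 x + c * kap x \<le> T0 + mass + 1" using T0(2)[of x] by simp
  qed (use T0 m in simp)
qed

text \<open>The order of the quantifiers matters: \<open>K\<close> is free of \<open>c\<close>, and
  \<open>Kc\<close> is free of \<open>a\<close> and \<eta>, so that \<open>a\<close> can tend to 0
  at fixed \<open>c\<close> and \<open>c\<close> afterwards. The flux of the head costs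
  \<open>c * K\<close>, the Lamb term \<open>a * Kc\<close>.\<close>

lemma dissipation_estimate:
  assumes m: "mass > 0"
  shows "\<exists>K. \<forall>c. 0 < c \<longrightarrow> c \<le> 1 \<longrightarrow> (\<exists>Kc. \<forall>a \<eta>. 0 < a \<longrightarrow> a \<le> 1 \<longrightarrow> 0 < \<eta> \<longrightarrow>
    (LBINT x. cutoff a \<eta> (head0 x + c * kap x) * rho x ^ 2) \<le> a * Kc + c * K)"
proof -
  obtain T where T: "T \<ge> 1" and lb: "\<And>c x. 0 < c \<Longrightarrow> 0 < head0 x + c * kap x"
    "\<And>c x. 0 < c \<Longrightarrow> c \<le> 1 \<Longrightarrow> head0 x + c * kap x \<le> T" using level_bounds[OF m] by metis
  obtain Cl where Cl: "Cl > 0" "\<And>x i. lamb i x ^ 2 \<le> Cl * (kap x * wt x)" using lamb_squared_le by blast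
  obtain Cv where Cv: "Cv > 0" "\<And>x i. \<bar>V i x * kap_partial i x\<bar> \<le> Cv * (kap x powr (5/11) * kap1 x)"
    using V_kap_partial_le by blast
  define k2 where "k2 = conv wt (japanese (17/10))"
  have k2: "integrable lborel k2" unfolding k2_def by (rule integrable_conv_wt) simp
  define K where "K = T ^ 2 * (3 * Cv * (LBINT x. kap x powr (5/11) * kap1 x))"
  show ?thesis
  proof (rule exI[of _ K], intro allI impI)
    fix c :: real assume c: "0 < c" "c \<le> 1"
    define H where "H x = head0 x + c * kap x" for x
    define H' where "H' i x = pd i head x + c * kap_partial i x" for i x
    have H: "C1_fun H H'" unfolding H_def[abs_def] H'_def[abs_def]
      by (intro C1_fun_add C1_fun_cmult C1_fun_head0 C1_fun_kap)
    have cH: "continuous_on UNIV H" "continuous_on UNIV (H' i)" for i using H by (auto simp: C1_fun_def)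
    have ckap: "c * kap x \<le> H x" for x using head0_nonneg[of x] by (simp add: H_def)
    have Hpos: "H x > 0" and HT: "H x \<le> T" for x using lb[OF c(1)] c(2) by (auto simp: H_def)
    have H0: "(H \<longlongrightarrow> 0) at_infinity"
      unfolding H_def[abs_def]
      using tendsto_add[OF head0_tendsto_0 tendsto_mult_right_zero[OF kap_tendsto_0]] by simp
    \<comment> \<open>6 = 3 * 2 from the three components and the factor 2 in
      \<open>cutoff_bounds\<close>. The summand with \<open>Cl / c\<close> stems from the Lamb
      vector and blows up as \<open>c\<close> tends to 0; the other stems from the gradient of
      \<open>c * kap\<close>.\<close>
    define Kc where "Kc = 6 * T ^ 2 * (2 * Cl / c * mass + c * (LBINT x. k2 x))"
    show "\<exists>Kc. \<forall>a \<eta>. 0 < a \<longrightarrow> a \<le> 1 \<longrightarrow> 0 < \<eta> \<longrightarrow>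
      (LBINT x. cutoff a \<eta> (head0 x + c * kap x) * rho x ^ 2) \<le> a * Kc + c * K"
    proof (rule exI[of _ Kc], intro allI impI)
      fix a \<eta> :: real assume a: "0 < a" "a \<le> 1" and \<eta>: "0 < \<eta>"
      note cb = cutoff_bounds[OF a less_imp_le[OF \<eta>] Hpos HT T]
      define g where "g x = cutoff a \<eta> (H x)" for x
      define g' where "g' i x = cutoff_deriv a \<eta> (H x) * H' i x" for i x
      have g: "C1_fun g g'" unfolding g_def[abs_def] g'_def[abs_def]
        by (rule C1_fun_compose[OF H, of "{0<..}"]) (auto intro!: cutoff_has_derivative continuous_cut_deriv Hpos)
      have cg: "continuous_on UNIV g" "continuous_on UNIV (g' i)" for i using g by (auto simp: C1_fun_def)
      have \<eta>a: "\<eta> powr (1/a) > 0" using \<eta> by simp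
      then obtain R where R: "\<forall>x. norm x \<ge> R \<longrightarrow> dist (H x) 0 < \<eta> powr (1/a)"
        using H0 unfolding Lim_at_infinity by blast
      have Hs: "H x \<le> \<eta> powr (1/a)" if "norm x > R" for x
        using R[rule_format, of x] that Hpos[of x] by (simp add: dist_real_def)
      have gs: "g x = 0" if "norm x > R" for x
        unfolding g_def using Hs[OF that] Hpos[of x] by (intro cutoff_eq_0 a \<eta>) auto
      have g's: "g' i x = 0" if "norm x > R" for i x by (rule C1_fun_support[OF g gs that])
      obtain F where F: "\<And>t. t > 0 \<Longrightarrow> (F has_real_derivative cutoff a \<eta> t) (at t)"
        "\<And>t. 0 < t \<Longrightarrow> t \<le> \<eta> powr (1/a) \<Longrightarrow> F t = 0"
        using cutoff_antiderivative[OF a(1) \<eta>] by blast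
      have ccut: "continuous_on {0<..} (cutoff a \<eta>)"
        by (rule DERIV_continuous_on[where D="cutoff_deriv a \<eta>"])
          (auto intro!: has_field_derivative_at_within cutoff_has_derivative)
      have transport: "(LBINT x. g x * (\<Sum>j\<in>UNIV. V j x * H' j x)) = 0"
        unfolding g_def
        by (rule transport_identity[OF H, of "{0<..}" F "cutoff a \<eta>" R]) (auto intro!: F ccut Hpos Hs)
      have cV: "continuous_on UNIV (V j)" "continuous_on UNIV (lamb j)" "continuous_on UNIV (pd j head)" for j
        by (intro smooth_continuous_on smooth_V smooth_lamb smooth_pd smooth_head)+
      have i1: "integrable lborel (\<lambda>x. g x * (\<Sum>j\<in>UNIV. V j x * u j x))" if "\<And>j. continuous_on UNIV (u j)" for u
        by (rule integrable_continuous_support[of _ R]) (auto intro!: continuous_intros cg cV that simp: gs)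
      have i2: "integrable lborel (\<lambda>x. \<Sum>j\<in>UNIV. g' j x * u j x)" if "\<And>j. continuous_on UNIV (u j)" for u
        by (rule integrable_continuous_support[of _ R]) (auto intro!: continuous_intros cg that simp: g's)
      let ?s = "\<lambda>x. \<Sum>j\<in>UNIV. V j x * kap_partial j x" and ?B = "\<lambda>x. 3 * Cv * (kap x powr (5/11) * kap1 x)"
      have A: "(LBINT x. g x * (\<Sum>j\<in>UNIV. V j x * pd j head x)) \<le> c * K"
      proof -
        let ?I = "LBINT x. g x * ?s x"
        \<comment> \<open>By \<open>transport\<close> the flux of the head is \<open>- c\<close>
          times that of \<open>kap\<close>, which is integrable.\<close>
        have "(LBINT x. g x * (\<Sum>j\<in>UNIV. V j x * H' j x)) =
          (LBINT x. g x * (\<Sum>j\<in>UNIV. V j x * pd j head x) + c * (g x * ?s x))"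
          by (simp add: H'_def sum_distrib_left distrib_left sum.distrib mult_ac)
        then have "(LBINT x. g x * (\<Sum>j\<in>UNIV. V j x * pd j head x))
          = - (c * ?I)"
          using transport i1[of "\<lambda>j. pd j head", OF cV(3)] i1[of kap_partial, OF continuous_kap_partial]
          by simp
        also have "\<dots> = c * - ?I" by simp
        also have "\<dots> \<le> c * K"
        proof (rule mult_left_mono)
          have "- ?I \<le> \<bar>?I\<bar>"
            by linarith
          also have "\<dots> \<le> (LBINT x. \<bar>g x * ?s x\<bar>)" by (rule integral_abs_bound)
          also have "\<dots> \<le> (LBINT x. T ^ 2 * (?B x))"
          proof (intro integral_mono integrable_abs i1 continuous_kap_partial integrable_mult_right integrable_kap_kap1)
            fix x
            have "\<bar>?s x\<bar> \<le> (\<Sum>j\<in>UNIV. \<bar>V j x * kap_partial j x\<bar>)" by (rule sum_abs)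
            also have "\<dots> \<le> (\<Sum>j\<in>(UNIV::3 set). Cv * (kap x powr (5/11) * kap1 x))" by (intro sum_mono Cv)
            finally have "\<bar>?s x\<bar> \<le> ?B x" by simp
            then show "\<bar>g x * ?s x\<bar> \<le> T ^ 2 * (?B x)"
              unfolding abs_mult using cb(1,2)[of x] by (intro mult_mono) (auto simp: g_def)
          qed
          also have "\<dots> = K" by (simp add: K_def)
          finally show "- ?I \<le> K" .
        qed (use c in simp)
        finally show ?thesis .
      qed
      let ?L = "\<lambda>x. \<Sum>j\<in>UNIV. g' j x * lamb j x" and ?U = "\<lambda>x. a * (6 * T ^ 2 * (2 * Cl / c * wt x + c * k2 x))"
      let ?D = "\<lambda>x. \<Sum>j\<in>UNIV. g' j x * (pd j head x - lamb j x)"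
      let ?W = "\<lambda>x. 2 * Cl * (kap x * wt x) + c ^ 2 * (kap x * k2 x)"
      have B: "(LBINT x. ?L x) \<le> a * Kc"
      proof -
        have cd: "continuous_on UNIV (\<lambda>x. pd j head x - lamb j x)" for j by (intro continuous_intros cV)
        \<comment> \<open>\<open>?D\<close> has integral 0. Subtracting it brings in minus the
          cutoff derivative times |grad H|^2, a term of good sign.\<close>
        have "(LBINT x. ?L x) =
          (LBINT x. ?L x - ?D x)"
          using head_lamb_orthogonal[OF g gs] i2[of lamb, OF cV(2)] i2[of "\<lambda>j x. pd j head x - lamb j x", OF cd] by simp
        also have "\<dots> \<le> (LBINT x. ?U x)"
        proof (intro integral_mono Bochner_Integration.integrable_diff i2 cV cd integrable_mult_right
            Bochner_Integration.integrable_add integrable_wt k2)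
          fix x
          define D where "D = cutoff_deriv a \<eta> (H x)"
          have D: "0 \<le> D" "D \<le> 2 * a * T ^ 2 / H x" using cb(3,4)[of x] by (auto simp: D_def)
          have k: "kap x > 0" by (rule kap_pos[OF m])
          have pt: "g' j x * lamb j x - g' j x * (pd j head x - lamb j x)
             \<le> D * ?W x" for j
          proof -
            define u where "u = H' j x"
            define l where "l = lamb j x"
            define q where "q = c * kap_partial j x"
            have "g' j x * lamb j x - g' j x * (pd j head x - lamb j x) = D * (2 * (u * l) + u * q - u * u)"
              by (simp add: g'_def D_def[symmetric] u_def l_def q_def H'_def algebra_simps)
            \<comment> \<open>The good term - u^2 is divided equally: one half completes the square
              with \<open>2 * l\<close>, the other with \<open>q\<close>.\<close>
            also have "2 * (u * l) + u * q - u * u \<le> 2 * l ^ 2 + q ^ 2 / 2"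
            proof -
              have "(u - 2 * l) ^ 2 / 2 + (u - q) ^ 2 / 2 = 2 * l ^ 2 + q ^ 2 / 2 - (2 * (u * l) + u * q - u * u)"
                by (simp add: power2_eq_square field_simps)
              moreover have "0 \<le> (u - 2 * l) ^ 2 / 2 + (u - q) ^ 2 / 2" by simp
              ultimately show ?thesis by linarith
            qed
            also have "2 * l ^ 2 + q ^ 2 / 2 \<le> 2 * Cl * (kap x * wt x) + c ^ 2 * (kap x * k2 x)"
              using Cl(2)[of j x] mult_left_mono[OF kap_partial_squared_le[of j x], of "c ^ 2"]
              by (simp add: l_def q_def k2_def power_mult_distrib)
            finally show ?thesis using D(1) by (simp add: mult_left_mono)
          qed
          have nn: "0 \<le> 2 * Cl * (kap x * wt x) + c ^ 2 * (kap x * k2 x)"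
            using Cl k wt_nonneg[of x] conv_nonneg[of wt "japanese (17/10)" x, OF wt_nonneg less_imp_le[OF japanese_bounds(1)]]
            by (simp add: k2_def)
          \<comment> \<open>The lower bound \<open>c * kap x \<le> H x\<close> replaces 1/H by a
            multiple of 1/kap, which cancels the factor \<open>kap x\<close> in both terms of
            \<open>?W\<close>.\<close>
          have "2 * a * T ^ 2 / H x \<le> 2 * a * T ^ 2 / (c * kap x)"
            using ckap[of x] c k a T by (intro divide_left_mono) (auto intro!: mult_pos_pos Hpos)
          then have DD: "D \<le> 2 * a * T ^ 2 / (c * kap x)" using D by linarith
          have "?L x - ?D x
            = (\<Sum>j\<in>UNIV. g' j x * lamb j x - g' j x * (pd j head x - lamb j x))" by (simp add: sum_subtractf)
          also have "\<dots> \<le> (\<Sum>j\<in>(UNIV::3 set). D * ?W x)"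
            by (intro sum_mono pt)
          also have "\<dots> \<le> (\<Sum>j\<in>(UNIV::3 set). 2 * a * T ^ 2 / (c * kap x) * ?W x)"
            by (intro sum_mono mult_right_mono DD nn)
          also have "\<dots> = ?U x"
            using c k by (simp add: field_simps power2_eq_square)
          finally show "?L x - ?D x
            \<le> ?U x" .
        qed
        also have "\<dots> = a * Kc"
          using integrable_wt k2 by (simp add: Kc_def mass_def)
        finally show ?thesis .
      qed
      show "(LBINT x. cutoff a \<eta> (head0 x + c * kap x) * rho x ^ 2) \<le> a * Kc + c * K"
        using energy_identity[OF g gs] A B by (simp add: g_def H_def)
    qed
  qed
qed

lemma dissipation_limit:
  assumes m: "mass > 0" and c: "0 < c" "c \<le> 1"
  shows "(\<lambda>n. LBINT x. cutoff (inverse (real (Suc n))) (exp (- real (Suc n))) (head0 x + c * kap x) * rho x ^ 2)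
    \<longlonglongrightarrow> (LBINT x. rho x ^ 2)"
proof -
  obtain T where T: "T \<ge> 1" and Hpos: "\<And>x. 0 < head0 x + c * kap x" and HT: "\<And>x. head0 x + c * kap x \<le> T"
    using level_bounds[OF m] c by metis
  have mH: "(\<lambda>x. head0 x + c * kap x) \<in> borel_measurable borel"
    by (intro borel_measurable_continuous_onI continuous_intros continuous_head0 continuous_kap)
  have mc: "cutoff a \<eta> \<in> borel_measurable borel" for a \<eta> unfolding cutoff_def[abs_def] by measurable
  let ?f = "\<lambda>n x. cutoff (inverse (real (Suc n))) (exp (- real (Suc n))) (head0 x + c * kap x) * rho x ^ 2"
  show ?thesis
  proof (rule integral_dominated_convergence)
    show "integrable lborel (\<lambda>x. T ^ 2 * rho x ^ 2)" using integrable_rho_squared by simp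
    show "?f n \<in> borel_measurable lborel" for n
      using measurable_compose[OF mH mc] by (auto intro!: borel_measurable_times)
    show "AE x in lborel. (\<lambda>n. ?f n x) \<longlonglongrightarrow> rho x ^ 2"
    proof (rule AE_I2)
      fix x
      show "(\<lambda>n. ?f n x) \<longlonglongrightarrow> rho x ^ 2"
        using tendsto_mult[OF cutoff_tendsto_1[OF Hpos[of x]] tendsto_const[of "rho x ^ 2"]] by (simp only: mult_1)
    qed
    show "AE x in lborel. norm (?f n x) \<le> T ^ 2 * rho x ^ 2" for n
    proof (rule AE_I2)
      fix x
      have "inverse (real (Suc n)) \<le> 1" by (simp add: inverse_le_1_iff)
      from cutoff_bounds(1,2)[OF _ this _ Hpos HT T, of "exp (- real (Suc n))" x]
      show "norm (?f n x) \<le> T ^ 2 * rho x ^ 2"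
        by (simp add: abs_mult mult_right_mono)
    qed
  qed simp
qed

lemma v_eq_0: "v x = 0"
proof (rule v_eq_0_of_mass, rule ccontr)
  assume "mass \<noteq> 0"
  then have m: "mass > 0" using mass_nonneg by linarith
  obtain K where K: "\<And>c. 0 < c \<Longrightarrow> c \<le> 1 \<Longrightarrow> \<exists>Kc. \<forall>a \<eta>. 0 < a \<longrightarrow> a \<le> 1 \<longrightarrow> 0 < \<eta> \<longrightarrow>
    (LBINT x. cutoff a \<eta> (head0 x + c * kap x) * rho x ^ 2) \<le> a * Kc + c * K"
    using dissipation_estimate[OF m] by blast
  have le: "(LBINT x. rho x ^ 2) \<le> c * K" if c: "0 < c" "c \<le> 1" for c
  proof -
    obtain Kc where Kc: "\<And>a \<eta>. 0 < a \<Longrightarrow> a \<le> 1 \<Longrightarrow> 0 < \<eta> \<Longrightarrow>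
      (LBINT x. cutoff a \<eta> (head0 x + c * kap x) * rho x ^ 2) \<le> a * Kc + c * K"
      using K[OF c] by blast
    have "(\<lambda>n. inverse (real (Suc n)) * Kc + c * K) \<longlonglongrightarrow> 0 * Kc + c * K"
      by (intro tendsto_intros LIMSEQ_inverse_real_of_nat)
    then have "(LBINT x. rho x ^ 2) \<le> 0 * Kc + c * K"
      by (rule LIMSEQ_le[OF dissipation_limit[OF m c]])
        (auto intro!: exI[of _ 0] Kc simp: inverse_le_1_iff)
    then show ?thesis by simp
  qed
  have "(\<lambda>n. inverse (real (Suc n)) * K) \<longlonglongrightarrow> 0 * K"
    by (intro tendsto_intros LIMSEQ_inverse_real_of_nat)
  then have "(LBINT x. rho x ^ 2) \<le> 0 * K"
    by (rule LIMSEQ_le_const) (auto intro!: exI[of _ 0] le simp: inverse_le_1_iff)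
  moreover have "0 \<le> (LBINT x. rho x ^ 2)" by (intro Bochner_Integration.integral_nonneg) simp
  ultimately have z: "(LBINT x. rho x ^ 2) = 0" by simp
  have "rho x ^ 2 = 0" for x
    by (rule continuous_integral_eq_0[OF _ _ integrable_rho_squared z]) (auto intro!: continuous_intros continuous_rho)
  then have "wt x = 0" for x by (simp add: wt_def)
  then have "mass = 0" by (simp add: mass_def)
  then show False using m by simp
qed

end

theorem theorem1p1:
  fixes v :: "real^3 \<Rightarrow> real^3" and p :: "real^3 \<Rightarrow> real"
  assumes "smooth v" and "smooth p"
    and "\<And>x. - laplacian v x + convective v v x + gradient p x = 0"
    and "\<And>x. divergence v x = 0"
    and "(v \<longlongrightarrow> 0) at_infinity"
    and "curl v \<in> weak_Lq (9/5) UNIV"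
  shows "\<forall>x. v x = 0"
proof -
  interpret weak_vorticity_flow v p
    by unfold_locales (use assms in auto)
  show ?thesis using v_eq_0 by blast
qed

end
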